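(* Let $0<p\le q<\infty$, $\alpha>0$, let $\psi$ be an entire function and let $g$ be an entire function on $\mathbb{C}$. Then $V_{(g,\psi)}:F_\alpha^p\to F_\alpha^q$ is (i) bounded if and only if $B_{(\psi,\alpha)}(|g|^q)\in L^\infty(\mathbb{C},dm)$. Moreover, $$\|V_{(g,\psi)}\|\simeq\Big(\sup_{w\in\mathbb{C}}B_{(\psi,\alpha)}(|g|^q)(w)\Big)^{1/q}.$$ (ii) compact if and only if $\lim_{|z|\to\infty}B_{(\psi,\alpha)}(|g|^q)(z)=0$.
   Context: Let $dm$ be Lebesgue measure on $\mathbb{C}$. For $0<p<\infty$ and $\alpha>0$, the Fock space $F_\alpha^p$ consists of all entire functions $f$ with $$\|f\|_{(p,\alpha)}^p=\frac{p\alpha}{2\pi}\int_{\mathbb{C}}|f(z)|^pe^{-\frac{p\alpha}{2}|z|^2}\,dm(z)<\infty.$$ For entire functions $g,\psi$, the operator $V_{(g,\psi)}$ (product of Volterra type integral and composition operators) acts on entire functions $f$ by $$V_{(g,\psi)}f(z)=\int_0^z f(\psi(w))g'(w)\,dw.$$ For $0<q<\infty$, the Berezin type integral transform is $$B_{(\psi,\alpha)}(|g|^q)(w)=\int_{\mathbb{C}}e^{\frac{q\alpha}{2}\left(2\Re\langle\psi(z),w\rangle-|z|^2-|w|^2\right)}\frac{|g'(z)|^q}{(1+|z|)^q}\,dm(z),\quad w\in\mathbb{C},$$ where $\langle a,b\rangle=a\overline{b}$ is the standard inner product in $\mathbb{C}$. $\|V_{(g,\psi)}\|$ denotes the operator norm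 of $V_{(g,\psi)}:F_\alpha^p\to F_\alpha^q$. The notation $U(z)\lesssim V(z)$ means that there is a constant $C$ such that $U(z)\le CV(z)$ holds for all $z$ in the set in question (which may be a Hilbert space or a set of complex numbers), and $U\simeq V$ means that both $U\lesssim V$ and $V\lesssim U$. *)

theory Defs
  imports "HOL-Complex_Analysis.Complex_Analysis" "HOL-Probability.Essential_Supremum"
begin

text \<open>
  Powers with a positive real exponent on the extended nonnegative reals, with value
  \<open>\<infinity>\<close> at \<open>\<infinity>\<close>. It is only used with exponents \<open>1/p\<close> and \<open>1/q\<close>, where \<open>p, q > 0\<close>.
\<close>

definition ennreal_powr :: "ennreal \<Rightarrow> real \<Rightarrow> ennreal" where
  "ennreal_powr x a = (if x = \<infinity> then \<infinity> else ennreal (enn2real x powr a))"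

text \<open>The norm (a quasi-norm when \<open>p < 1\<close>) is \<open>\<infinity>\<close> exactly when the integral diverges.\<close>

definition fock_norm :: "real \<Rightarrow> real \<Rightarrow> (complex \<Rightarrow> complex) \<Rightarrow> ennreal" where
  "fock_norm p \<alpha> f =
     ennreal_powr
       (ennreal (p * \<alpha> / (2 * pi)) *
        (\<integral>\<^sup>+ z. ennreal (norm (f z) powr p * exp (- (p * \<alpha> / 2) * (norm z)\<^sup>2)) \<partial>lborel))
       (1 / p)"

definition fock_space :: "real \<Rightarrow> real \<Rightarrow> (complex \<Rightarrow> complex) set" where
  "fock_space p \<alpha> = {f. f holomorphic_on UNIV \<and> fock_norm p \<alpha> f < \<infinity>}"

definition volterra_comp ::
    "(complex \<Rightarrow> complex) \<Rightarrow> (complex \<Rightarrow> complex) \<Rightarrow> (complex \<Rightarrow> complex) \<Rightarrow> complex \<Rightarrow> complex" where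
  "volterra_comp g \<psi> f z = contour_integral (linepath 0 z) (\<lambda>w. f (\<psi> w) * deriv g w)"

text \<open>
  The arguments \<open>p q \<alpha>\<close> below refer to an operator from \<open>fock_space p \<alpha>\<close> to \<open>fock_space q \<alpha>\<close>.
\<close>

definition fock_bounded_op ::
    "real \<Rightarrow> real \<Rightarrow> real \<Rightarrow> ((complex \<Rightarrow> complex) \<Rightarrow> (complex \<Rightarrow> complex)) \<Rightarrow> bool" where
  "fock_bounded_op p q \<alpha> T \<longleftrightarrow>
     (\<forall>f\<in>fock_space p \<alpha>. T f \<in> fock_space q \<alpha>) \<and>
     (\<exists>C::real. \<forall>f\<in>fock_space p \<alpha>. fock_norm q \<alpha> (T f) \<le> ennreal C * fock_norm p \<alpha> f)"

text \<open>The operator norm of a linear operator, with value \<open>\<infinity>\<close> if the operator is unbounded.\<close>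

definition fock_op_norm ::
    "real \<Rightarrow> real \<Rightarrow> real \<Rightarrow> ((complex \<Rightarrow> complex) \<Rightarrow> (complex \<Rightarrow> complex)) \<Rightarrow> ennreal" where
  "fock_op_norm p q \<alpha> T =
     (SUP f\<in>{f \<in> fock_space p \<alpha>. fock_norm p \<alpha> f \<le> 1}. fock_norm q \<alpha> (T f))"

text \<open>
  Compactness: images of (quasi-)norm bounded sequences have subsequences converging in the
  target space.
\<close>

definition fock_compact_op ::
    "real \<Rightarrow> real \<Rightarrow> real \<Rightarrow> ((complex \<Rightarrow> complex) \<Rightarrow> (complex \<Rightarrow> complex)) \<Rightarrow> bool" where
  "fock_compact_op p q \<alpha> T \<longleftrightarrow>
     (\<forall>f\<in>fock_space p \<alpha>. T f \<in> fock_space q \<alpha>) \<and>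
     (\<forall>F :: nat \<Rightarrow> complex \<Rightarrow> complex.
        (\<forall>n. F n \<in> fock_space p \<alpha>) \<and> (\<exists>M::real. \<forall>n. fock_norm p \<alpha> (F n) \<le> ennreal M) \<longrightarrow>
        (\<exists>r h. strict_mono r \<and> h \<in> fock_space q \<alpha> \<and>
           (\<lambda>n. fock_norm q \<alpha> (\<lambda>z. T (F (r n)) z - h z)) \<longlonglongrightarrow> 0))"

text \<open>The transform \<open>B\<^sub>(\<^sub>\<psi>\<^sub>,\<^sub>\<alpha>\<^sub>) (|g|\<^sup>q)\<close>; its value may be \<open>\<infinity>\<close>.\<close>

definition berezin_transform ::
    "real \<Rightarrow> real \<Rightarrow> (complex \<Rightarrow> complex) \<Rightarrow> (complex \<Rightarrow> complex) \<Rightarrow> complex \<Rightarrow> ennreal" where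
  "berezin_transform q \<alpha> \<psi> g w =
     (\<integral>\<^sup>+ z. ennreal
        (exp (q * \<alpha> / 2 * (2 * Re (\<psi> z * cnj w) - (norm z)\<^sup>2 - (norm w)\<^sup>2)) *
         (norm (deriv g z) powr q / (1 + norm z) powr q)) \<partial>lborel)"

text \<open>Membership in \<open>L\<^sup>\<infinity>\<close> for functions with values in the extended nonnegative reals.\<close>

definition in_Linfty :: "'a measure \<Rightarrow> ('a \<Rightarrow> ennreal) \<Rightarrow> bool" where
  "in_Linfty M f \<longleftrightarrow> f \<in> borel_measurable M \<and> esssup M f < \<infinity>"

end

theory Submission
  imports Defs
begin

text \<open>
  Write \<open>F = V f\<close> for \<open>V = V\<^sub>(\<^sub>g\<^sub>,\<^sub>\<psi>\<^sub>)\<close>. Then \<open>F 0 = 0\<close> and \<open>F' = (f \<circ> \<psi>) g'\<close>. The integral over paths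
  disappears from the problem once the norm of \<open>F\<close> is expressed by \<open>F'\<close>: for entire \<open>F\<close> with \<open>F 0 = 0\<close>,
  the integral of \<open>|F|\<^sup>q\<close> against \<open>exp (- q \<alpha> |z|\<^sup>2 / 2)\<close> is comparable to the integral of
  \<open>(|F'| / (1 + |z|))\<^sup>q\<close> against the same weight (\<open>fock_derivative_integral_le\<close> and
  \<open>fock_integral_le_derivative_integral\<close>). Hence \<open>\<parallel>V f\<parallel>\<^sup>q\<close> is comparable to the integral of
  \<open>|f \<circ> \<psi>|\<^sup>q\<close> against a fixed measure \<open>\<mu>\<close>, given by \<open>volterra_density\<close>, and the theorem becomes a
  statement on Carleson measures.

  The Berezin transform \<open>B w\<close> is the value of this integral at the coherent state \<open>k\<^sub>w\<close>
  (\<open>fock_kernel\<close>), whose norm does not depend on \<open>w\<close>. Therefore \<open>B w\<close> is at most a constant times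
  \<open>\<parallel>V\<parallel>\<^sup>q\<close> (\<open>berezin_le_volterra_kernel\<close>). Conversely, at a point \<open>\<zeta>\<close>, \<open>|f|\<^sup>q\<close> is bounded by its own
  weighted average over a unit disc, and for \<open>w\<close> in that disc the factor \<open>exp (q \<alpha> |\<zeta>|\<^sup>2 / 2)\<close> is
  comparable to \<open>|k\<^sub>w \<zeta>|\<^sup>q\<close>.
  Integration over \<open>\<mu>\<close> and Tonelli turn this into
  \<open>\<parallel>V f\<parallel>\<^sup>q \<le> C \<integral> |f w|\<^sup>q exp (- q \<alpha> |w|\<^sup>2 / 2) B w dw\<close> (\<open>volterra_comp_le_berezin_integral\<close>).
  If \<open>B\<close> is bounded almost everywhere, the right side is at most \<open>C \<parallel>f\<parallel>\<^sub>q\<^sup>q\<close>, and \<open>\<parallel>f\<parallel>\<^sub>q\<close> is at most a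
  constant times \<open>\<parallel>f\<parallel>\<^sub>p\<close> because functions in the Fock space obey a pointwise growth bound
  (\<open>fock_norm_embedding\<close>). This settles boundedness and the norm.

  For compactness, \<open>k\<^sub>w\<close> tends to zero locally uniformly as \<open>w\<close> tends to infinity, so that any norm
  limit of \<open>V k\<^sub>w\<close> along a sequence is zero, and \<open>B\<close> vanishes at infinity. In the other direction Montel's
  theorem reduces the claim to bounded sequences that tend to zero locally uniformly; the integral
  against \<open>B\<close> is then small on a large disc because the functions are small there, and small outside it
  because \<open>B\<close> is.

  The local estimates rest on the sub-mean value property of \<open>|f|\<^sup>q\<close> on discs of radius one, for every
  \<open>q > 0\<close> (\<open>powr_sub_mean_value\<close>). Since constants need not be sharp, the case \<open>q < 1\<close> follows from the
  case \<open>q = 1\<close> by a maximum argument, without a factorisation of zeros. Multiplication of \<open>f\<close> by a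
  suitable exponential (\<open>fock_twist\<close>) moves the Gaussian weight to any given centre, which is why discs
  of a fixed radius are enough throughout.
\<close>

section \<open>Area mean values of entire functions\<close>

text \<open>
  Transfers to the plane the invariance of Lebesgue measure on \<open>real^2\<close> under orthogonal maps.
\<close>

lemma lborel_complex_eq_distr_vec:
  "(lborel :: complex measure) = distr (lborel :: (real^2) measure) borel (\<lambda>v. Complex (v $ 1) (v $ 2))"
proof (rule lborel_eqI)
  have m [measurable]: "(\<lambda>v::real^2. Complex (v $ 1) (v $ 2)) \<in> borel_measurable borel"
    unfolding Complex_eq by (intro borel_measurable_continuous_onI continuous_intros)
  show "sets (distr (lborel :: (real^2) measure) borel (\<lambda>v. Complex (v $ 1) (v $ 2))) = sets borel"
    by simp
  fix l u :: complex
  assume le: "\<And>b. b \<in> Basis \<Longrightarrow> l \<bullet> b \<le> u \<bullet> b"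
  have le': "Re l \<le> Re u" "Im l \<le> Im u"
    using le[of 1] le[of \<i>] by (auto simp: Basis_complex_def)
  let ?l = "vector [Re l, Im l] :: real^2" and ?u = "vector [Re u, Im u] :: real^2"
  have eq: "(\<lambda>v::real^2. Complex (v $ 1) (v $ 2)) -` box l u = box ?l ?u"
    by (auto simp: box_def Basis_complex_def Basis_vec_def inner_axis forall_2)
  have "emeasure (distr (lborel :: (real^2) measure) borel (\<lambda>v. Complex (v $ 1) (v $ 2))) (box l u)
      = emeasure lborel (box ?l ?u)"
    by (subst emeasure_distr) (auto simp: eq)
  also have "\<dots> = ennreal ((Re u - Re l) * (Im u - Im l))"
  proof -
    have B: "(Basis :: (real^2) set) = {axis 1 1, axis 2 1}"
      by (auto simp: Basis_vec_def UNIV_2)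
    have ne: "axis 1 1 \<noteq> (axis 2 1 :: real^2)"
      by (simp add: axis_eq_axis)
    have "?l \<bullet> b \<le> ?u \<bullet> b" if "b \<in> Basis" for b
      using that le' by (auto simp: B inner_axis)
    then show ?thesis
      using ne by (subst emeasure_lborel_box_eq) (auto simp: B inner_axis)
  qed
  also have "\<dots> = ennreal (\<Prod>b\<in>Basis. (u - l) \<bullet> b)"
    by (simp add: Basis_complex_def)
  finally show "emeasure (distr (lborel :: (real^2) measure) borel (\<lambda>v. Complex (v $ 1) (v $ 2))) (box l u)
      = ennreal (\<Prod>b\<in>Basis. (u - l) \<bullet> b)" .
qed

lemma lborel_complex_rotation:
  fixes c :: complex
  assumes c: "norm c = 1"
  shows "distr lborel borel (\<lambda>z. c * z) = (lborel :: complex measure)"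
proof (rule lborel_eqI[symmetric])
  show "sets (distr lborel borel ((*) c)) = sets borel"
    by simp
  have [measurable]: "(\<lambda>v::real^2. Complex (v $ 1) (v $ 2)) \<in> borel_measurable borel"
    unfolding Complex_eq by (intro borel_measurable_continuous_onI continuous_intros)
  let ?p = "\<lambda>v::real^2. Complex (v $ 1) (v $ 2)"
  (* The inverse rotation in coordinates; the preimage of a set under multiplication by c is its
     image under this map. *)
  define T :: "real^2 \<Rightarrow> real^2" where
    "T v = vector [Re (cnj c * ?p v), Im (cnj c * ?p v)]" for v
  have pT: "?p (T v) = cnj c * ?p v" for v
    by (simp add: T_def complex_eq_iff)
  have linT: "linear T"
    unfolding linear_iff by (auto simp: vec_eq_iff T_def forall_2 algebra_simps)
  have normT: "norm (T v) = norm v" for v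
  proof -
    have n: "norm w = norm (?p w)" for w :: "real^2"
      by (simp add: norm_vec_def L2_set_def UNIV_2 cmod_def)
    show ?thesis
      unfolding n[of "T v"] pT by (simp add: n norm_mult c)
  qed
  have orthT: "orthogonal_transformation T"
    unfolding orthogonal_transformation using linT normT by auto
  fix l u :: complex
  assume le: "\<And>b. b \<in> Basis \<Longrightarrow> l \<bullet> b \<le> u \<bullet> b"
  define S where "S = ?p -` box l u"
  have injp: "?p v = ?p w \<longleftrightarrow> v = w" for v w
    by (auto simp: vec_eq_iff forall_2)
  have S: "S \<in> sets borel"
    unfolding S_def by (rule measurable_sets_borel[of _ borel]) auto
  have TS: "?p -` ((*) c -` box l u) = T ` S"
  proof (intro equalityI subsetI)
    fix v assume v: "v \<in> ?p -` ((*) c -` box l u)"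
    define w where "w = (vector [Re (c * ?p v), Im (c * ?p v)] :: real^2)"
    have pw: "?p w = c * ?p v" by (simp add: w_def complex_eq_iff)
    have "?p (T w) = ?p v"
      unfolding pT pw using c by (simp add: mult.assoc[symmetric] complex_norm_square[symmetric] mult.commute[of "cnj c"])
    then have "v = T w" unfolding injp by simp
    moreover have "w \<in> S" using v by (simp add: S_def pw)
    ultimately show "v \<in> T ` S" by blast
  next
    fix v assume "v \<in> T ` S"
    then obtain w where w: "w \<in> S" "v = T w" by blast
    have "c * ?p v = ?p w"
      unfolding w(2) pT using c by (simp add: mult.assoc[symmetric] complex_norm_square[symmetric])
    with w show "v \<in> ?p -` ((*) c -` box l u)" by (simp add: S_def)
  qed
  have TSb: "T ` S \<in> sets borel"
    unfolding TS[symmetric] by (rule measurable_sets_borel[of _ borel], simp, rule measurable_sets_borel[of _ borel]) auto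
  have "emeasure lborel S = emeasure lborel (box l u)"
    unfolding S_def by (subst lborel_complex_eq_distr_vec, subst emeasure_distr) auto
  then have Sfin: "emeasure lborel S < \<infinity>"
    using emeasure_lborel_box_finite[of l u] by simp
  have Sl: "S \<in> lmeasurable"
    using S Sfin by (auto simp: fmeasurable_def)
  have TSl: "T ` S \<in> lmeasurable"
    by (rule measurable_orthogonal_image[OF orthT Sl])
  have "emeasure (distr lborel borel ((*) c)) (box l u) = emeasure lborel ((*) c -` box l u)"
    by (subst emeasure_distr) auto
  also have "\<dots> = emeasure lborel (?p -` ((*) c -` box l u))"
  proof -
    have "(*) c -` box l u \<in> sets borel"
      by (rule measurable_sets_borel[of _ borel]) auto
    then show ?thesis
      by (subst lborel_complex_eq_distr_vec, subst emeasure_distr) auto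
  qed
  also have "\<dots> = emeasure lebesgue (T ` S)"
    using TSb by (simp add: TS)
  also have "\<dots> = ennreal (measure lebesgue (T ` S))"
    by (rule emeasure_eq_measure2) (use TSl in \<open>auto simp: fmeasurable_def\<close>)
  also have "\<dots> = ennreal (measure lebesgue S)"
    by (simp add: measure_orthogonal_image[OF orthT Sl])
  also have "\<dots> = emeasure lebesgue S"
    by (rule emeasure_eq_measure2[symmetric]) (use Sl in \<open>auto simp: fmeasurable_def\<close>)
  also have "\<dots> = emeasure lborel S"
    using S by simp
  also have "\<dots> = emeasure lborel (box l u)" by fact
  also have "\<dots> = (\<Prod>b\<in>Basis. (u - l) \<bullet> b)"
    using le by (simp add: emeasure_lborel_box)
  finally show "emeasure (distr lborel borel ((*) c)) (box l u) = ennreal (\<Prod>b\<in>Basis. (u - l) \<bullet> b)"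
    by simp
qed

lemma nn_integral_lborel_translate:
  fixes a :: "'a::euclidean_space"
  assumes [measurable]: "h \<in> borel_measurable borel"
  shows "(\<integral>\<^sup>+z. h (a + z) \<partial>lborel) = (\<integral>\<^sup>+z. h z \<partial>lborel)"
  by (subst (2) lborel_distr_plus[of a, symmetric], subst nn_integral_distr) auto

text \<open>
  Rotation by \<open>cis (\<pi> / n)\<close> preserves the disc and changes the sign of \<open>w\<^sup>n\<close>, so the integral equals
  its own negative.
\<close>

lemma integral_monomial_ball_0:
  assumes "n > 0"
  shows "(\<integral>w. indicat_real (ball 0 r) w *\<^sub>R w ^ n \<partial>lborel) = (0::complex)" (is "?I = _")
proof -
  define c where "c = cis (pi / n)"
  have cn: "c ^ n = -1" unfolding c_def Complex.DeMoivre using assms by simp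
  have c1: "norm c = 1" by (simp add: c_def)
  have [measurable]: "ball (0::complex) r \<in> sets borel" by auto
  have [measurable]: "(\<lambda>w::complex. w ^ n) \<in> borel_measurable borel"
    by (intro borel_measurable_continuous_onI continuous_intros)
  have "?I = (\<integral>w. indicat_real (ball 0 r) (c * w) *\<^sub>R (c * w) ^ n \<partial>lborel)"
    by (subst lborel_complex_rotation[OF c1, symmetric], subst integral_distr) auto
  also have "\<dots> = (\<integral>w. - (indicat_real (ball 0 r) w *\<^sub>R w ^ n) \<partial>lborel)"
    by (intro Bochner_Integration.integral_cong) (auto simp: indicator_def norm_mult c1 power_mult_distrib cn)
  also have "\<dots> = - ?I" by simp
  finally show ?thesis by simp
qed

lemma measure_ball_complex:
  fixes a :: complex
  assumes "0 \<le> r"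
  shows "emeasure lborel (ball a r) = ennreal (pi * r\<^sup>2)" "measure lborel (ball a r) = pi * r\<^sup>2"
proof -
  have "emeasure lborel (ball a r) = ennreal (pi * r\<^sup>2)"
    using emeasure_ball[OF assms, of a] unit_ball_vol_2 by simp
  then show "emeasure lborel (ball a r) = ennreal (pi * r\<^sup>2)" "measure lborel (ball a r) = pi * r\<^sup>2"
    by (auto simp: measure_def)
qed

text \<open>
  The Taylor series converges absolutely on the disc and may be integrated term by term; all terms
  except the constant one integrate to zero.
\<close>

lemma area_mean_value_0:
  fixes f :: "complex \<Rightarrow> complex"
  assumes f: "f holomorphic_on UNIV" and r: "0 < r"
  shows "(\<integral>w. indicat_real (ball 0 r) w *\<^sub>R f w \<partial>lborel) = complex_of_real (pi * r\<^sup>2) * f 0"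
proof -
  define c where "c n = (deriv ^^ n) f 0 / fact n" for n
  have sums: "(\<lambda>n. c n * w ^ n) sums f w" for w
    using holomorphic_power_series[of f 0 "norm w + 1" w] f
    holomorphic_on_subset[OF f] by (auto simp: c_def)
  have [measurable]: "ball (0::complex) r \<in> sets borel" by auto
  define h where "h n w = indicat_real (ball 0 r) w *\<^sub>R (c n * w ^ n)" for n w
  have ball_fin: "emeasure lborel (ball (0::complex) r) < \<infinity>"
    using emeasure_lborel_ball_finite .
  have bnd: "norm (h n w) \<le> indicat_real (ball 0 r) w * (norm (c n) * r ^ n)" for n w
    by (auto simp: h_def indicator_def norm_mult norm_power intro!: mult_left_mono power_mono)
  have hint: "integrable lborel (h n)" for n
  proof (rule Bochner_Integration.integrable_bound)
    show "integrable lborel (\<lambda>w::complex. indicat_real (ball 0 r) w * (norm (c n) * r ^ n))"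
      using ball_fin by (intro integrable_mult_left integrable_real_indicator) auto
    show "h n \<in> borel_measurable lborel"
      unfolding h_def using borel_measurable_continuous_onI[of "\<lambda>w. c n * w ^ n"]
      by (auto intro!: borel_measurable_scaleR continuous_intros)
    show "AE w in lborel. norm (h n w) \<le> norm (indicat_real (ball 0 r) w * (norm (c n) * r ^ n))"
      by (rule AE_I2) (metis bnd abs_ge_self order_trans real_norm_def)
  qed
  have summ: "summable (\<lambda>n. norm (c n) * r ^ n)"
  proof -
    have "summable (\<lambda>n. c n * (of_real (r + 1)) ^ n)"
      using sums sums_summable by blast
    then have "summable (\<lambda>n. norm (c n * (of_real r :: complex) ^ n))"
      using r by (elim powser_insidea) (auto simp: abs_if simp flip: of_real_add)
    then show ?thesis using r by (simp add: norm_mult norm_power)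
  qed
  have "(\<integral>w. (\<Sum>n. h n w) \<partial>lborel) = (\<Sum>n. \<integral>w. h n w \<partial>lborel)"
  proof (rule integral_suminf[OF hint])
    show "AE w in lborel. summable (\<lambda>n. norm (h n w))"
    proof (rule AE_I2)
      fix w :: complex
      show "summable (\<lambda>n. norm (h n w))"
      proof (rule summable_comparison_test'[OF summ, of 0])
        fix n
        have "norm (h n w) \<le> 1 * (norm (c n) * r ^ n)"
          using r by (intro order_trans[OF bnd] mult_right_mono) (auto simp: indicator_def)
        then show "norm (norm (h n w)) \<le> norm (c n) * r ^ n" by simp
      qed
    qed
    show "summable (\<lambda>n. \<integral>w. norm (h n w) \<partial>lborel)"
    proof (rule summable_comparison_test'[where N=0])
      show "summable (\<lambda>n. pi * r\<^sup>2 * (norm (c n) * r ^ n))"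
        by (intro summable_mult summ)
      fix n
      have "norm (\<integral>w. norm (h n w) \<partial>lborel) = (\<integral>w. norm (h n w) \<partial>lborel)"
        by (simp add: integral_nonneg_AE)
      also have "\<dots> \<le> (\<integral>w. indicat_real (ball (0::complex) r) w * (norm (c n) * r ^ n) \<partial>lborel)"
        using ball_fin by (intro integral_mono integrable_norm hint bnd integrable_mult_left integrable_real_indicator) auto
      also have "\<dots> = pi * r\<^sup>2 * (norm (c n) * r ^ n)"
        using r by (simp add: measure_ball_complex)
      finally show "norm (\<integral>w. norm (h n w) \<partial>lborel) \<le> pi * r\<^sup>2 * (norm (c n) * r ^ n)" .
    qed
  qed
  also have "(\<lambda>n. \<integral>w. h n w \<partial>lborel) = (\<lambda>n. if n = 0 then complex_of_real (pi * r\<^sup>2) * f 0 else 0)"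
  proof
    fix n
    show "(\<integral>w. h n w \<partial>lborel) = (if n = 0 then complex_of_real (pi * r\<^sup>2) * f 0 else 0)"
    proof (cases "n = 0")
      case True
      have "(\<integral>w. h n w \<partial>lborel) = (\<integral>w. indicat_real (ball (0::complex) r) w *\<^sub>R f 0 \<partial>lborel)"
        using True by (simp add: h_def c_def)
      also have "\<dots> = measure lborel (ball (0::complex) r) *\<^sub>R f 0"
        using ball_fin by (subst integral_scaleR_left) auto
      finally show ?thesis using True r by (simp add: measure_ball_complex scaleR_conv_of_real)
    next
      case False
      have "(\<integral>w. h n w \<partial>lborel) = (\<integral>w. c n * (indicat_real (ball 0 r) w *\<^sub>R w ^ n) \<partial>lborel)"
        by (simp add: h_def)
      also have "\<dots> = c n * (\<integral>w. indicat_real (ball 0 r) w *\<^sub>R w ^ n \<partial>lborel)"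
        by (rule integral_mult_right_zero)
      also have "\<dots> = 0"
        using False by (simp only: integral_monomial_ball_0 mult_zero_right)
      finally show ?thesis using False by simp
    qed
  qed
  also have "(\<lambda>w. \<Sum>n. h n w) = (\<lambda>w. indicat_real (ball 0 r) w *\<^sub>R f w)"
    using sums_unique[OF sums] by (auto simp: h_def indicator_def fun_eq_iff)
  finally show ?thesis
    using suminf_finite[of "{0::nat}" "\<lambda>n. if n = 0 then complex_of_real (pi * r\<^sup>2) * f 0 else 0"] by simp
qed

lemma holomorphic_UNIV_continuous: "f holomorphic_on UNIV \<Longrightarrow> continuous_on UNIV f"
  by (rule holomorphic_on_imp_continuous_on)

lemma area_mean_value_inequality:
  fixes f :: "complex \<Rightarrow> complex"
  assumes f: "f holomorphic_on UNIV" and r: "0 < r"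
  shows "ennreal (pi * r\<^sup>2 * norm (f a)) \<le> (\<integral>\<^sup>+w\<in>ball a r. ennreal (norm (f w)) \<partial>lborel)"
proof -
  have [measurable]: "f \<in> borel_measurable borel"
    by (intro borel_measurable_continuous_onI holomorphic_UNIV_continuous f)
  have [measurable]: "ball a r \<in> sets borel" by auto
  define g where "g z = f (a + z)" for z
  have g: "g holomorphic_on UNIV"
    unfolding g_def using holomorphic_on_compose[of "\<lambda>z. a + z" UNIV f] f
    by (simp add: o_def holomorphic_on_add holomorphic_on_subset)
  have [measurable]: "g \<in> borel_measurable borel" unfolding g_def by measurable
  have gint: "integrable lborel (\<lambda>w. indicat_real (ball 0 r) w *\<^sub>R g w)"
  proof -
    have "set_integrable lborel (cball 0 r) g"
      by (unfold set_integrable_def, intro borel_integrable_compact compact_cball holomorphic_on_imp_continuous_on)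
        (rule holomorphic_on_subset[OF g], simp)
    then have "set_integrable lborel (ball 0 r) g"
      by (rule set_integrable_subset) auto
    then show ?thesis by (simp add: set_integrable_def)
  qed
  have "pi * r\<^sup>2 * norm (f a) = norm (complex_of_real (pi * r\<^sup>2) * g 0)"
    by (simp add: norm_mult g_def norm_power)
  also have "ennreal \<dots> \<le> (\<integral>\<^sup>+w. norm (indicat_real (ball 0 r) w *\<^sub>R g w) \<partial>lborel)"
    unfolding area_mean_value_0[OF g r, symmetric] by (rule integral_norm_bound_ennreal[OF gint])
  also have "\<dots> = (\<integral>\<^sup>+w. (\<lambda>x. ennreal (norm (f x)) * indicator (ball a r) x) (a + w) \<partial>lborel)"
    by (intro nn_integral_cong) (auto simp: indicator_def g_def dist_norm)
  also have "\<dots> = (\<integral>\<^sup>+w\<in>ball a r. ennreal (norm (f w)) \<partial>lborel)"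
    by (rule nn_integral_lborel_translate) measurable
  finally show ?thesis .
qed

section \<open>Sub-mean values of powers of the modulus\<close>

text \<open>
  For \<open>q = 1\<close> this is the area mean value property. For smaller \<open>q\<close>, maximise
  \<open>|f z|\<^sup>q (1 - |z - a|)\<^sup>2\<close> over the closed disc. Near the maximum point \<open>z0\<close>, on the disc of half the
  distance to the boundary, maximality gives \<open>|f|\<^sup>q \<le> 4 |f z0|\<^sup>q\<close>. Hence \<open>|f| = |f|\<^sup>1\<^sup>-\<^sup>q |f|\<^sup>q\<close> is bounded
  there by a multiple of \<open>|f z0|\<^sup>1\<^sup>-\<^sup>q |f|\<^sup>q\<close>, and the mean value property at \<open>z0\<close> bounds the maximum, which
  dominates \<open>|f a|\<^sup>q\<close>.
\<close>

lemma powr_sub_mean_value_le_1: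
  fixes f :: "complex \<Rightarrow> complex"
  assumes f: "f holomorphic_on UNIV" and q: "0 < q" "q \<le> 1"
  shows "ennreal (norm (f a) powr q)
    \<le> ennreal (4 / pi * 4 powr ((1 - q) / q)) * (\<integral>\<^sup>+w\<in>ball a 1. ennreal (norm (f w) powr q) \<partial>lborel)"
proof -
  define X where "X = (\<integral>\<^sup>+w\<in>ball a 1. ennreal (norm (f w) powr q) \<partial>lborel)"
  define \<phi> where "\<phi> z = norm (f z) powr q * (1 - norm (z - a))\<^sup>2" for z
  have cf: "continuous_on UNIV f" by (rule holomorphic_UNIV_continuous[OF f])
  have [measurable]: "f \<in> borel_measurable borel"
    by (intro borel_measurable_continuous_onI cf)
  have "continuous_on (cball a 1) \<phi>"
    unfolding \<phi>_def using q
    by (intro continuous_intros continuous_on_powr' continuous_on_subset[OF cf]) auto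
  then obtain z0 where z0: "z0 \<in> cball a 1" and max: "\<And>z. z \<in> cball a 1 \<Longrightarrow> \<phi> z \<le> \<phi> z0"
    using continuous_attains_sup[of "cball a 1" \<phi>] by auto
  have a_le: "norm (f a) powr q \<le> \<phi> z0"
    using max[of a] by (simp add: \<phi>_def)
  show ?thesis
  proof (cases "\<phi> z0 = 0")
    case True
    then have "norm (f a) powr q = 0" using a_le by (simp add: order_antisym)
    then show ?thesis by simp
  next
    case False
    (* Half the distance from z0 to the unit circle about a. *)
    define s where "s = (1 - norm (z0 - a)) / 2"
    have fz0: "0 < norm (f z0)" using False by (auto simp: \<phi>_def)
    have "norm (z0 - a) \<noteq> 1" using False by (auto simp: \<phi>_def)
    then have s: "0 < s" using z0 by (auto simp: s_def dist_norm norm_minus_commute)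
    have \<phi>s: "\<phi> z0 = norm (f z0) powr q * (4 * s\<^sup>2)"
      by (simp add: \<phi>_def s_def power2_eq_square)
    have [measurable]: "ball a 1 \<in> sets borel" by auto
    define K where "K = (4 powr (1 / q) * norm (f z0)) powr (1 - q)"
    have K0: "0 < K" using fz0 by (simp add: K_def)
    have sub: "ball z0 s \<subseteq> ball a 1"
    proof
      fix z assume "z \<in> ball z0 s"
      then have "norm (z - a) < s + norm (z0 - a)"
        using norm_triangle_ineq[of "z - z0" "z0 - a"] by (auto simp: dist_norm norm_minus_commute)
      also have "\<dots> \<le> 1" using s by (simp add: s_def field_simps)
      finally show "z \<in> ball a 1" by (simp add: dist_norm norm_minus_commute)
    qed
    have bd: "norm (f z) \<le> K * norm (f z) powr q" if z: "z \<in> ball z0 s" for z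
    proof (cases "f z = 0")
      case False
      have "norm (z - a) < s + norm (z0 - a)"
        using norm_triangle_ineq[of "z - z0" "z0 - a"] z by (auto simp: dist_norm norm_minus_commute)
      then have "s \<le> 1 - norm (z - a)" by (simp add: s_def field_simps)
      then have "norm (f z) powr q * s\<^sup>2 \<le> \<phi> z"
        unfolding \<phi>_def using s by (intro mult_left_mono power_mono) auto
      also have "\<dots> \<le> \<phi> z0" using max sub z by (meson ball_subset_cball subsetD)
      also have "\<dots> = 4 * norm (f z0) powr q * s\<^sup>2" by (simp add: \<phi>s)
      finally have "norm (f z) powr q \<le> 4 * norm (f z0) powr q" using s by simp
      then have "(norm (f z) powr q) powr (1 / q) \<le> (4 * norm (f z0) powr q) powr (1 / q)"
        using q by (intro powr_mono2) auto
      then have "norm (f z) \<le> 4 powr (1 / q) * norm (f z0)"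
        using q by (simp add: powr_powr powr_mult)
      then have "norm (f z) powr (1 - q) \<le> K"
        unfolding K_def using q by (intro powr_mono2) auto
      then have "norm (f z) powr (1 - q) * norm (f z) powr q \<le> K * norm (f z) powr q"
        by (rule mult_right_mono) auto
      then show ?thesis using False by (simp flip: powr_add)
    qed simp
    have "ennreal (pi * s\<^sup>2 * norm (f z0)) \<le> (\<integral>\<^sup>+w\<in>ball z0 s. ennreal (norm (f w)) \<partial>lborel)"
      by (rule area_mean_value_inequality[OF f s])
    also have "\<dots> \<le> (\<integral>\<^sup>+w. ennreal K * (ennreal (norm (f w) powr q) * indicator (ball a 1) w) \<partial>lborel)"
      using bd sub K0 by (intro nn_integral_mono) (auto simp: indicator_def ennreal_mult[symmetric] intro!: ennreal_leI)
    also have "\<dots> = ennreal K * X"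
      unfolding X_def by (intro nn_integral_cmult) measurable
    finally have main: "ennreal (pi * s\<^sup>2 * norm (f z0)) \<le> ennreal K * X" .
    have "K = 4 powr ((1 - q) / q) * norm (f z0) powr (1 - q)"
      unfolding K_def by (simp add: powr_mult powr_powr)
    then have "\<phi> z0 * K = 4 / pi * 4 powr ((1 - q) / q) * (pi * s\<^sup>2 * (norm (f z0) powr q * norm (f z0) powr (1 - q)))"
      unfolding \<phi>s by simp
    also have "norm (f z0) powr q * norm (f z0) powr (1 - q) = norm (f z0)"
      using fz0 by (simp flip: powr_add)
    finally have "ennreal K * ennreal (\<phi> z0) = ennreal (4 / pi * 4 powr ((1 - q) / q)) * ennreal (pi * s\<^sup>2 * norm (f z0))"
      using K0 fz0 by (simp add: mult.commute \<phi>_def flip: ennreal_mult)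
    also have "\<dots> \<le> ennreal (4 / pi * 4 powr ((1 - q) / q)) * (ennreal K * X)"
      by (rule mult_left_mono[OF main]) auto
    finally have "ennreal K * ennreal (\<phi> z0) \<le> ennreal K * (ennreal (4 / pi * 4 powr ((1 - q) / q)) * X)"
      by (simp add: mult_ac)
    then have "ennreal (\<phi> z0) \<le> ennreal (4 / pi * 4 powr ((1 - q) / q)) * X"
      using K0 by (simp add: ennreal_mult_le_mult_iff)
    then show ?thesis
      unfolding X_def[symmetric] using a_le by (meson ennreal_leI order_trans)
  qed
qed

text \<open>
  Large exponents reduce to exponents at most one by \<open>|f|\<^sup>q = |f\<^sup>n|\<^sup>q\<^sup>/\<^sup>n\<close>.
\<close>

lemma powr_sub_mean_value:
  assumes q: "0 < q"
  obtains C :: real where "0 < C"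
    "\<And>f a. f holomorphic_on UNIV \<Longrightarrow> ennreal (norm (f a) powr q)
      \<le> ennreal C * (\<integral>\<^sup>+w\<in>ball (a::complex) 1. ennreal (norm (f w :: complex) powr q) \<partial>lborel)"
proof -
  define n where "n = nat \<lceil>q\<rceil>"
  have n: "q \<le> real n" "0 < n" using q by (auto simp: n_def of_nat_nat)
  define q' where "q' = q / n"
  have q': "0 < q'" "q' \<le> 1" using q n by (auto simp: q'_def)
  have eq: "norm (f z ^ n) powr q' = norm (f z) powr q" for f :: "complex \<Rightarrow> complex" and z
    using n by (cases "f z = 0") (auto simp: norm_power powr_powr q'_def simp flip: powr_realpow)
  show thesis
  proof (rule that)
    show "0 < 4 / pi * 4 powr ((1 - q') / q')" by simp
    fix f :: "complex \<Rightarrow> complex" and a assume "f holomorphic_on UNIV"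
    then have "(\<lambda>z. f z ^ n) holomorphic_on UNIV" by (intro holomorphic_intros)
    from powr_sub_mean_value_le_1[OF this q', of a]
    show "ennreal (norm (f a) powr q) \<le> ennreal (4 / pi * 4 powr ((1 - q') / q')) *
        (\<integral>\<^sup>+w\<in>ball a 1. ennreal (norm (f w) powr q) \<partial>lborel)"
      by (simp only: eq)
  qed
qed

section \<open>Local estimates with the Gaussian weight\<close>

text \<open>
  The modulus with the Gaussian factor of exponent one: the integrands of all Fock norms are powers of
  this one function.
\<close>

definition fock_mod :: "real \<Rightarrow> (complex \<Rightarrow> complex) \<Rightarrow> complex \<Rightarrow> real" where
  "fock_mod \<alpha> f z = norm (f z) * exp (- (\<alpha> / 2) * (norm z)\<^sup>2)"

lemma fock_mod_nonneg [simp]: "0 \<le> fock_mod \<alpha> f z"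
  by (simp add: fock_mod_def)

lemma fock_mod_powr:
  "fock_mod \<alpha> f z powr q = norm (f z) powr q * exp (- (q * \<alpha> / 2) * (norm z)\<^sup>2)"
  by (simp add: fock_mod_def powr_mult powr_def[of "exp _"] mult_ac)

lemma continuous_on_fock_mod:
  "continuous_on UNIV f \<Longrightarrow> continuous_on UNIV (fock_mod \<alpha> f)"
  unfolding fock_mod_def by (intro continuous_intros)

lemma continuous_on_fock_mod_powr:
  "f holomorphic_on UNIV \<Longrightarrow> 0 < q \<Longrightarrow> continuous_on UNIV (\<lambda>z. fock_mod \<alpha> f z powr q)"
  by (intro continuous_on_powr' continuous_intros continuous_on_fock_mod holomorphic_UNIV_continuous) auto

lemma borel_measurable_fock_mod [measurable (raw)]:
  "f \<in> borel_measurable borel \<Longrightarrow> fock_mod \<alpha> f \<in> borel_measurable borel"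
  unfolding fock_mod_def
proof -
  assume [measurable]: "f \<in> borel_measurable borel"
  have [measurable]: "(\<lambda>z::complex. exp (- (\<alpha> / 2) * (norm z)\<^sup>2)) \<in> borel_measurable borel"
    by (intro borel_measurable_continuous_onI continuous_intros)
  show "(\<lambda>z. norm (f z) * exp (- (\<alpha> / 2) * (norm z)\<^sup>2)) \<in> borel_measurable borel"
    by measurable
qed

lemma borel_measurable_entire: "f holomorphic_on UNIV \<Longrightarrow> f \<in> borel_measurable borel"
  by (intro borel_measurable_continuous_onI holomorphic_UNIV_continuous)

lemma sets_ball_borel [measurable]: "ball a r \<in> sets borel" for a :: complex
  by auto

text \<open>
  The weighted translation of the Fock space that moves \<open>a\<close> to the origin, written without the change of
  variable: its modulus is the weighted modulus of \<open>f\<close> up to a factor that depends only on \<open>|w - a|\<close>.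
\<close>

definition fock_twist :: "real \<Rightarrow> complex \<Rightarrow> (complex \<Rightarrow> complex) \<Rightarrow> complex \<Rightarrow> complex" where
  "fock_twist \<alpha> a f w = f w * exp (of_real \<alpha> * (of_real ((norm a)\<^sup>2 / 2) - w * cnj a))"

lemma norm_fock_twist:
  "norm (fock_twist \<alpha> a f w) = fock_mod \<alpha> f w * exp (\<alpha> / 2 * (norm (w - a))\<^sup>2)"
proof -
  have "(norm (w - a))\<^sup>2 = (norm w)\<^sup>2 + (norm a)\<^sup>2 - 2 * Re (w * cnj a)"
    unfolding cmod_power2 by (simp add: power2_eq_square algebra_simps)
  then have n: "(norm (w - a))\<^sup>2 = (norm w)\<^sup>2 + (norm a)\<^sup>2 - 2 * Re (w * cnj a)" .
  have "- (\<alpha> / 2) * (norm w)\<^sup>2 + \<alpha> / 2 * (norm (w - a))\<^sup>2 = \<alpha> * ((norm a)\<^sup>2 / 2 - Re (w * cnj a))"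
    unfolding n by (simp add: right_diff_distrib distrib_left)
  then have "exp (- (\<alpha> / 2) * (norm w)\<^sup>2) * exp (\<alpha> / 2 * (norm (w - a))\<^sup>2)
      = norm (exp (of_real \<alpha> * (of_real ((norm a)\<^sup>2 / 2) - w * cnj a)))"
    by (simp add: mult_exp_exp)
  then show ?thesis
    unfolding fock_twist_def fock_mod_def norm_mult by simp
qed

lemma holomorphic_fock_twist: "f holomorphic_on UNIV \<Longrightarrow> fock_twist \<alpha> a f holomorphic_on UNIV"
  unfolding fock_twist_def by (intro holomorphic_intros)

text \<open>
  The sub-mean value property applied to the twisted function, whose modulus is comparable to
  \<open>fock_mod \<alpha> f\<close> on the unit disc about \<open>z\<close> and equal to it at \<open>z\<close>.
\<close>

lemma fock_mod_powr_sub_mean_value: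
  assumes q: "0 < q" and \<alpha>: "0 < \<alpha>"
  obtains C :: real where "0 < C"
    "\<And>f z. f holomorphic_on UNIV \<Longrightarrow> ennreal (fock_mod \<alpha> f z powr q)
      \<le> ennreal C * (\<integral>\<^sup>+w\<in>ball z 1. ennreal (fock_mod \<alpha> f w powr q) \<partial>lborel)"
proof -
  obtain C :: real where C: "0 < C"
    "\<And>f a. f holomorphic_on UNIV \<Longrightarrow> ennreal (norm (f a) powr q)
      \<le> ennreal C * (\<integral>\<^sup>+w\<in>ball (a::complex) 1. ennreal (norm (f w :: complex) powr q) \<partial>lborel)"
    using powr_sub_mean_value[OF q] by blast
  define K where "K = exp (\<alpha> / 2) powr q"
  have K: "0 < K" by (simp add: K_def)
  show thesis
  proof (rule that)
    show "0 < C * K" using C(1) K by simp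
    fix f z assume f: "f holomorphic_on UNIV"
    note [measurable] = borel_measurable_entire[OF f]
    have "ennreal (fock_mod \<alpha> f z powr q) = ennreal (norm (fock_twist \<alpha> z f z) powr q)"
      by (simp add: norm_fock_twist)
    also have "\<dots> \<le> ennreal C * (\<integral>\<^sup>+w\<in>ball z 1. ennreal (norm (fock_twist \<alpha> z f w) powr q) \<partial>lborel)"
      by (intro C holomorphic_fock_twist f)
    also have "\<dots> \<le> ennreal C * (\<integral>\<^sup>+w. ennreal K * (ennreal (fock_mod \<alpha> f w powr q) * indicator (ball z 1) w) \<partial>lborel)"
    proof (intro mult_left_mono nn_integral_mono)
      fix w :: complex
      have "ennreal (norm (fock_twist \<alpha> z f w) powr q) \<le> ennreal K * ennreal (fock_mod \<alpha> f w powr q)"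
        if w: "w \<in> ball z 1"
      proof -
        have "(norm (w - z))\<^sup>2 \<le> 1"
          using w by (simp add: dist_norm norm_minus_commute abs_square_le_1)
        then have "exp (\<alpha> / 2 * (norm (w - z))\<^sup>2) \<le> exp (\<alpha> / 2)"
          using \<alpha> by simp
        then have "norm (fock_twist \<alpha> z f w) powr q \<le> (fock_mod \<alpha> f w * exp (\<alpha> / 2)) powr q"
          unfolding norm_fock_twist using q by (intro powr_mono2 mult_left_mono) auto
        also have "\<dots> = K * fock_mod \<alpha> f w powr q"
          by (simp add: K_def powr_mult)
        finally show ?thesis by (simp add: K_def ennreal_leI flip: ennreal_mult)
      qed
      then show "ennreal (norm (fock_twist \<alpha> z f w) powr q) * indicator (ball z 1) w
          \<le> ennreal K * (ennreal (fock_mod \<alpha> f w powr q) * indicator (ball z 1) w)"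
        by (simp add: indicator_def)
    qed auto
    also have "\<dots> = ennreal (C * K) * (\<integral>\<^sup>+w\<in>ball z 1. ennreal (fock_mod \<alpha> f w powr q) \<partial>lborel)"
    proof -
      have "(\<lambda>w. ennreal (fock_mod \<alpha> f w powr q) * indicator (ball z 1) w) \<in> borel_measurable lborel"
        by measurable
      from nn_integral_cmult[OF this] show ?thesis
        using C(1) K by (simp add: ennreal_mult mult.assoc)
    qed
    finally show "ennreal (fock_mod \<alpha> f z powr q)
      \<le> ennreal (C * K) * (\<integral>\<^sup>+w\<in>ball z 1. ennreal (fock_mod \<alpha> f w powr q) \<partial>lborel)" .
  qed
qed

lemma fock_mod_powr_le_on_cball:
  assumes q: "0 < q" and \<alpha>: "0 < \<alpha>"
  obtains C :: real where "0 < C"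
    "\<And>f z w. f holomorphic_on UNIV \<Longrightarrow> w \<in> cball z 1 \<Longrightarrow> ennreal (fock_mod \<alpha> f w powr q)
      \<le> ennreal C * (\<integral>\<^sup>+v\<in>ball z 2. ennreal (fock_mod \<alpha> f v powr q) \<partial>lborel)"
proof -
  obtain C :: real where C: "0 < C"
    "\<And>f z. f holomorphic_on UNIV \<Longrightarrow> ennreal (fock_mod \<alpha> f z powr q)
      \<le> ennreal C * (\<integral>\<^sup>+w\<in>ball z 1. ennreal (fock_mod \<alpha> f w powr q) \<partial>lborel)"
    using fock_mod_powr_sub_mean_value[OF q \<alpha>] by blast
  show thesis
  proof (rule that[OF C(1)])
    fix f and z w :: complex assume f: "f holomorphic_on UNIV" and w: "w \<in> cball z 1"
    have "ball w 1 \<subseteq> ball z 2"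
    proof
      fix v assume "v \<in> ball w 1"
      then show "v \<in> ball z 2" using w dist_triangle[of z v w] by (simp add: dist_commute)
    qed
    then have "(\<integral>\<^sup>+v\<in>ball w 1. ennreal (fock_mod \<alpha> f v powr q) \<partial>lborel)
        \<le> (\<integral>\<^sup>+v\<in>ball z 2. ennreal (fock_mod \<alpha> f v powr q) \<partial>lborel)"
      by (intro nn_integral_mono) (auto simp: indicator_def)
    then show "ennreal (fock_mod \<alpha> f w powr q)
      \<le> ennreal C * (\<integral>\<^sup>+v\<in>ball z 2. ennreal (fock_mod \<alpha> f v powr q) \<partial>lborel)"
      by (intro order_trans[OF C(2)[OF f]] mult_left_mono) auto
  qed
qed

text \<open>
  Passes from a bound on \<open>q\<close>-th powers by a finite integral to a bound by a real number \<open>S\<close>, on which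
  real arithmetic is available.
\<close>

lemma ennreal_root_of_finite:
  assumes "0 < q" "I < \<infinity>" "0 < (C::real)"
  obtains S :: real where "0 \<le> S" "ennreal (S powr q) = ennreal C * I"
proof (rule that)
  show "0 \<le> (C * enn2real I) powr (1 / q)" by simp
  show "ennreal (((C * enn2real I) powr (1 / q)) powr q) = ennreal C * I"
    using assms by (simp add: powr_powr ennreal_mult)
qed

lemma le_of_ennreal_powr_le:
  assumes "0 < q" "0 \<le> a" "0 \<le> S" "ennreal (a powr q) \<le> ennreal (S powr q)"
  shows "a \<le> (S::real)"
proof (rule ccontr)
  assume "\<not> a \<le> S"
  then have "S powr q < a powr q" using assms by (intro powr_less_mono2) auto
  then show False using assms(4) by (simp add: ennreal_le_iff)
qed

text \<open>
  Cauchy's inequality on a circle of radius one bounds the derivative of the twisted function \<open>h\<close> at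
  \<open>z\<close>. Up to the exponential, \<open>h' z = f' z - \<alpha> (cnj z) f z\<close>; the second term grows like \<open>|z|\<close>, which is
  the reason for the factor \<open>1 + |z|\<close>.
\<close>

lemma fock_mod_deriv_le:
  assumes q: "0 < q" and \<alpha>: "0 < \<alpha>"
  obtains C :: real where "0 < C"
    "\<And>f z. f holomorphic_on UNIV \<Longrightarrow> ennreal ((fock_mod \<alpha> (deriv f) z / (1 + norm z)) powr q)
      \<le> ennreal C * (\<integral>\<^sup>+w\<in>ball z 2. ennreal (fock_mod \<alpha> f w powr q) \<partial>lborel)"
proof -
  obtain C :: real where C: "0 < C"
    "\<And>f z w. f holomorphic_on UNIV \<Longrightarrow> w \<in> cball z 1 \<Longrightarrow> ennreal (fock_mod \<alpha> f w powr q)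
      \<le> ennreal C * (\<integral>\<^sup>+v\<in>ball z 2. ennreal (fock_mod \<alpha> f v powr q) \<partial>lborel)"
    using fock_mod_powr_le_on_cball[OF q \<alpha>] by blast
  define L where "L = exp (\<alpha> / 2) + \<alpha>"
  have L: "0 < L" using \<alpha> by (simp add: L_def add_pos_pos)
  show thesis
  proof (rule that)
    show "0 < L powr q * C" using C(1) L by simp
    fix f z assume f: "f holomorphic_on UNIV"
    define I where "I = (\<integral>\<^sup>+v\<in>ball z 2. ennreal (fock_mod \<alpha> f v powr q) \<partial>lborel)"
    show "ennreal ((fock_mod \<alpha> (deriv f) z / (1 + norm z)) powr q) \<le> ennreal (L powr q * C)
       * (\<integral>\<^sup>+w\<in>ball z 2. ennreal (fock_mod \<alpha> f w powr q) \<partial>lborel)"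
    proof (cases "I < \<infinity>")
      case False
      then have "I = \<infinity>" by (simp add: less_top[symmetric])
      then show ?thesis unfolding I_def[symmetric] using C(1) L by (simp add: ennreal_mult_top)
    next
      case True
      obtain S where S: "0 \<le> S" "ennreal (S powr q) = ennreal C * I"
        using ennreal_root_of_finite[OF q True C(1)] by blast
      have bd: "fock_mod \<alpha> f w \<le> S" if "w \<in> cball z 1" for w
        using C(2)[OF f that] unfolding I_def[symmetric] S(2)[symmetric]
        by (rule le_of_ennreal_powr_le[OF q fock_mod_nonneg S(1)])
      define h where "h = fock_twist \<alpha> z f"
      have h: "h holomorphic_on UNIV" unfolding h_def by (rule holomorphic_fock_twist[OF f])
      have hb: "norm (h w) \<le> S * exp (\<alpha> / 2)" if "norm (z - w) = 1" for w
      proof -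
        have "norm (h w) = fock_mod \<alpha> f w * exp (\<alpha> / 2)"
          unfolding h_def norm_fock_twist using that by (simp add: norm_minus_commute)
        also have "\<dots> \<le> S * exp (\<alpha> / 2)"
          using that by (intro mult_right_mono bd) (auto simp: dist_norm)
        finally show ?thesis .
      qed
      have "norm ((deriv ^^ 1) h z) \<le> fact 1 * (S * exp (\<alpha> / 2)) / 1 ^ 1"
      proof (rule Cauchy_inequality)
        show "h holomorphic_on ball z 1" by (rule holomorphic_on_subset[OF h]) simp
        show "continuous_on (cball z 1) h"
          by (rule holomorphic_on_imp_continuous_on[OF holomorphic_on_subset[OF h]]) simp
      qed (use hb in auto)
      then have dh: "norm (deriv h z) \<le> S * exp (\<alpha> / 2)" by simp
      have fd: "(f has_field_derivative deriv f z) (at z)"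
        using f by (simp add: holomorphic_derivI)
      have "(h has_field_derivative
          (deriv f z - of_real \<alpha> * cnj z * f z) * exp (of_real \<alpha> * (of_real ((norm z)\<^sup>2 / 2) - z * cnj z))) (at z)"
        unfolding h_def fock_twist_def
        by (rule derivative_eq_intros fd refl | simp)+ (simp add: left_diff_distrib right_diff_distrib mult_ac)
      then have dheq: "deriv h z = (deriv f z - of_real \<alpha> * cnj z * f z) * exp (of_real \<alpha> * (of_real ((norm z)\<^sup>2 / 2) - z * cnj z))"
        by (rule DERIV_imp_deriv)
      have ne: "norm (exp (of_real \<alpha> * (of_real ((norm z)\<^sup>2 / 2) - z * cnj z))) = exp (- (\<alpha> / 2) * (norm z)\<^sup>2)"
        using norm_fock_twist[of \<alpha> z "\<lambda>_. 1" z] by (simp only: fock_twist_def fock_mod_def) simp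
      have "fock_mod \<alpha> (deriv f) z = norm (deriv h z + of_real \<alpha> * cnj z * f z * exp (of_real \<alpha> * (of_real ((norm z)\<^sup>2 / 2) - z * cnj z)))"
        unfolding fock_mod_def ne[symmetric] dheq norm_mult[symmetric] left_diff_distrib by simp
      also have "\<dots> \<le> norm (deriv h z) + \<alpha> * norm z * fock_mod \<alpha> f z"
        by (rule order_trans[OF norm_triangle_ineq]) (use \<alpha> in \<open>simp only: norm_mult ne fock_mod_def, simp\<close>)
      also have "\<dots> \<le> S * exp (\<alpha> / 2) + \<alpha> * norm z * S"
        using \<alpha> by (intro add_mono dh mult_left_mono bd) auto
      also have "\<dots> \<le> L * S * (1 + norm z)"
        using \<alpha> S(1) by (simp add: L_def algebra_simps)
      finally have "fock_mod \<alpha> (deriv f) z / (1 + norm z) \<le> L * S"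
        by (simp add: divide_le_eq add_pos_nonneg)
      then have "(fock_mod \<alpha> (deriv f) z / (1 + norm z)) powr q \<le> (L * S) powr q"
        using q by (intro powr_mono2) auto
      also have "\<dots> = L powr q * S powr q" using L S by (simp add: powr_mult)
      finally have "ennreal ((fock_mod \<alpha> (deriv f) z / (1 + norm z)) powr q) \<le> ennreal (L powr q) * ennreal (S powr q)"
        by (simp add: ennreal_leI flip: ennreal_mult)
      then show ?thesis
        unfolding S(2) I_def[symmetric] using C(1) by (simp add: ennreal_mult mult.assoc)
    qed
  qed
qed

section \<open>Weighted integrals of an entire function and of its derivative\<close>

text \<open>
  Joint measurability, needed to interchange averages over discs with integration over the plane.
\<close>

lemma borel_measurable_ball_kernel:
  fixes h :: "complex \<Rightarrow> ennreal"
  assumes [measurable]: "h \<in> borel_measurable borel"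
  shows "(\<lambda>(z, w). h w * indicator (ball z r) w) \<in> borel_measurable (lborel \<Otimes>\<^sub>M lborel)"
proof -
  have "(\<lambda>(z, w). h w * indicator (ball z r) w) = (\<lambda>x. h (snd x) * indicator {x. dist (fst x) (snd x) < r} x)"
    by (auto simp: indicator_def)
  then show ?thesis by simp
qed

lemma nn_integral_ball_average:
  fixes h :: "complex \<Rightarrow> ennreal"
  assumes h [measurable]: "h \<in> borel_measurable borel" and r: "0 \<le> r"
  shows "(\<integral>\<^sup>+z. (\<integral>\<^sup>+w\<in>ball z r. h w \<partial>lborel) \<partial>lborel) = ennreal (pi * r\<^sup>2) * (\<integral>\<^sup>+w. h w \<partial>lborel)"
proof -
  have "(\<integral>\<^sup>+z. (\<integral>\<^sup>+w\<in>ball z r. h w \<partial>lborel) \<partial>lborel) = (\<integral>\<^sup>+w. (\<integral>\<^sup>+z. h w * indicator (ball z r) w \<partial>lborel) \<partial>lborel)"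
    by (rule lborel_pair.Fubini'[symmetric]) (rule borel_measurable_ball_kernel[OF h])
  also have "\<dots> = (\<integral>\<^sup>+w. (\<integral>\<^sup>+z. h w * indicator (ball w r) z \<partial>lborel) \<partial>lborel)"
    by (intro nn_integral_cong) (auto simp: indicator_def dist_commute)
  also have "\<dots> = (\<integral>\<^sup>+w. ennreal (pi * r\<^sup>2) * h w \<partial>lborel)"
    using r by (intro nn_integral_cong) (simp add: nn_integral_cmult_indicator measure_ball_complex mult.commute)
  also have "\<dots> = ennreal (pi * r\<^sup>2) * (\<integral>\<^sup>+w. h w \<partial>lborel)"
    by (intro nn_integral_cmult) measurable
  finally show ?thesis .
qed

text \<open>
  Integration of the local bound over the plane: by Tonelli, averaging over discs of radius two
  multiplies an integral by the area of the disc.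
\<close>

lemma fock_derivative_integral_le:
  assumes q: "0 < q" and \<alpha>: "0 < \<alpha>"
  obtains C :: real where "0 < C"
    "\<And>f. f holomorphic_on UNIV \<Longrightarrow>
      (\<integral>\<^sup>+z. ennreal ((fock_mod \<alpha> (deriv f) z / (1 + norm z)) powr q) \<partial>lborel)
      \<le> ennreal C * (\<integral>\<^sup>+z. ennreal (fock_mod \<alpha> f z powr q) \<partial>lborel)"
proof -
  obtain C :: real where C: "0 < C"
    "\<And>f z. f holomorphic_on UNIV \<Longrightarrow> ennreal ((fock_mod \<alpha> (deriv f) z / (1 + norm z)) powr q)
      \<le> ennreal C * (\<integral>\<^sup>+w\<in>ball z 2. ennreal (fock_mod \<alpha> f w powr q) \<partial>lborel)"
    using fock_mod_deriv_le[OF q \<alpha>] by blast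
  show thesis
  proof (rule that)
    show "0 < C * (pi * 2\<^sup>2)" using C(1) by simp
    fix f assume f: "f holomorphic_on UNIV"
    note [measurable] = borel_measurable_entire[OF f]
    have "(\<integral>\<^sup>+z. ennreal ((fock_mod \<alpha> (deriv f) z / (1 + norm z)) powr q) \<partial>lborel)
      \<le> (\<integral>\<^sup>+z. ennreal C * (\<integral>\<^sup>+w\<in>ball z 2. ennreal (fock_mod \<alpha> f w powr q) \<partial>lborel) \<partial>lborel)"
      by (intro nn_integral_mono C f)
    also have "\<dots> = ennreal C * (\<integral>\<^sup>+z. (\<integral>\<^sup>+w\<in>ball z 2. ennreal (fock_mod \<alpha> f w powr q) \<partial>lborel) \<partial>lborel)"
      by (intro nn_integral_cmult lborel.borel_measurable_nn_integral borel_measurable_ball_kernel) measurable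
    also have "\<dots> = ennreal (C * (pi * 2\<^sup>2)) * (\<integral>\<^sup>+z. ennreal (fock_mod \<alpha> f z powr q) \<partial>lborel)"
      using C(1) by (subst nn_integral_ball_average) (auto simp: ennreal_mult mult_ac)
    finally show "(\<integral>\<^sup>+z. ennreal ((fock_mod \<alpha> (deriv f) z / (1 + norm z)) powr q) \<partial>lborel)
      \<le> ennreal (C * (pi * 2\<^sup>2)) * (\<integral>\<^sup>+z. ennreal (fock_mod \<alpha> f z powr q) \<partial>lborel)" .
  qed
qed

text \<open>
  One step of unit length towards the origin. Since \<open>Re (z cnj u) \<ge> |z| / 2\<close>, the weight at \<open>z\<close> is
  smaller than the weight at \<open>z - s u\<close> by a factor of order \<open>exp (- \<alpha> s |z| / 2)\<close>. This gives the small
  factor in front of \<open>fock_mod \<alpha> F (z - u)\<close>. It also makes the integral of \<open>F'\<close> over the step of size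
  \<open>M / |z|\<close> instead of \<open>M\<close>, because only the part of the step with \<open>s\<close> of order \<open>1 / |z|\<close> matters; this
  gain is the denominator \<open>1 + |z|\<close> in the integral of the derivative.
\<close>

lemma fock_mod_step:
  assumes \<alpha>: "0 < \<alpha>" and F: "F holomorphic_on UNIV"
    and u: "norm u = 1" "norm z / 2 \<le> Re (z * cnj u)" and z: "1 \<le> norm z"
    and M: "\<And>w. w \<in> cball z 1 \<Longrightarrow> fock_mod \<alpha> (deriv F) w \<le> M"
  shows "fock_mod \<alpha> F z \<le> exp (- (\<alpha> / 2) * (norm z - 1)) * fock_mod \<alpha> F (z - u)
    + exp (\<alpha> / 2) * (2 * M / (\<alpha> * norm z))"
proof -
  have M0: "0 \<le> M" using order_trans[OF fock_mod_nonneg M[of z]] by simp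
  have dist: "(norm (z - of_real s * u))\<^sup>2 \<le> (norm z)\<^sup>2 - s * norm z + s\<^sup>2" if s: "0 \<le> s" for s
  proof -
    have u2: "(Re u)\<^sup>2 + (Im u)\<^sup>2 = 1" using u(1) by (simp add: cmod_def)
    have "(norm (z - of_real s * u))\<^sup>2 = (norm z)\<^sup>2 - 2 * s * Re (z * cnj u) + s\<^sup>2 * ((Re u)\<^sup>2 + (Im u)\<^sup>2)"
      unfolding cmod_power2 by (simp add: power2_eq_square algebra_simps)
    moreover have "s * (norm z / 2) \<le> s * Re (z * cnj u)"
      using u(2) s by (rule mult_left_mono)
    ultimately show ?thesis unfolding u2 by simp
  qed
  define c where "c = \<alpha> * norm z / 2"
  have c: "0 < c" unfolding c_def using \<alpha> z by (intro divide_pos_pos mult_pos_pos) linarith+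
  define K where "K = M * exp (\<alpha> / 2 * (norm z)\<^sup>2 + \<alpha> / 2)"
  have K: "0 \<le> K" using M0 by (simp add: K_def)
  define \<gamma> where "\<gamma> s = F (z - of_real s * u)" for s :: real
  (* A primitive of K exp (- c s), the bound for the derivative of \<gamma>; its increment over the unit
     interval is at most K / c, and 1 / c is of order 1 / |z|. *)
  define \<Phi> where "\<Phi> s = - (K / c) * exp (- c * s)" for s :: real
  have dF: "(F has_field_derivative deriv F w) (at w)" for w
    using F by (simp add: holomorphic_derivI)
  have d\<gamma>: "(\<gamma> has_vector_derivative (- u * deriv F (z - of_real s * u))) (at s)" for s
  proof -
    have "((\<lambda>s. z - of_real s * u) has_vector_derivative - u) (at s)"
      by (auto intro!: derivative_eq_intros simp: has_vector_derivative_def scaleR_conv_of_real)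
    from field_vector_diff_chain_at[OF this dF] show ?thesis
      unfolding \<gamma>_def[abs_def] o_def .
  qed
  have d\<Phi>: "(\<Phi> has_vector_derivative K * exp (- c * s)) (at s)" for s
    unfolding \<Phi>_def has_real_derivative_iff_has_vector_derivative[symmetric]
    by (rule derivative_eq_intros refl | use c in simp)+
  have "norm (\<gamma> 1 - \<gamma> 0) \<le> \<Phi> 1 - \<Phi> 0"
  proof (rule differentiable_bound_general[OF zero_less_one _ _ d\<gamma> d\<Phi>])
    show "continuous_on {0..1} \<gamma>"
      using d\<gamma> by (meson continuous_at_imp_continuous_on has_vector_derivative_continuous)
    show "continuous_on {0..1} \<Phi>"
      using d\<Phi> by (meson continuous_at_imp_continuous_on has_vector_derivative_continuous)
    fix s :: real assume s: "0 < s" "s < 1"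
    let ?w = "z - of_real s * u"
    have "norm (- u * deriv F ?w) = fock_mod \<alpha> (deriv F) ?w * exp (\<alpha> / 2 * (norm ?w)\<^sup>2)"
      by (simp add: norm_mult u fock_mod_def mult_exp_exp)
    also have "\<dots> \<le> M * exp (\<alpha> / 2 * ((norm z)\<^sup>2 - s * norm z + 1))"
    proof (intro mult_mono M)
      show "?w \<in> cball z 1" using s by (simp add: dist_norm norm_mult u)
      have "(norm ?w)\<^sup>2 \<le> (norm z)\<^sup>2 - s * norm z + 1"
        using dist[of s] s power_le_one[of s 2] by simp
      then show "exp (\<alpha> / 2 * (norm ?w)\<^sup>2) \<le> exp (\<alpha> / 2 * ((norm z)\<^sup>2 - s * norm z + 1))"
        using \<alpha> by (subst exp_le_cancel_iff) (rule mult_left_mono, auto)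
    qed (use M0 in auto)
    also have "\<dots> = K * exp (- c * s)"
      by (simp add: K_def c_def algebra_simps mult_exp_exp)
    finally show "norm (- u * deriv F ?w) \<le> K * exp (- c * s)" .
  qed
  also have "\<dots> \<le> K / c"
    using K c by (simp add: \<Phi>_def)
  finally have diff: "norm (F (z - u) - F z) \<le> K / c"
    by (simp add: \<gamma>_def)
  have "norm (F z) \<le> norm (F (z - u)) + K / c"
    using diff norm_triangle_ineq2[of "F z" "F (z - u)"] by (simp add: norm_minus_commute)
  then have "fock_mod \<alpha> F z \<le> (norm (F (z - u)) + K / c) * exp (- (\<alpha> / 2) * (norm z)\<^sup>2)"
    unfolding fock_mod_def by (rule mult_right_mono) simp
  also have "\<dots> = norm (F (z - u)) * exp (- (\<alpha> / 2) * (norm z)\<^sup>2) + K * exp (- (\<alpha> / 2) * (norm z)\<^sup>2) / c"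
    by (simp add: algebra_simps)
  also have "K * exp (- (\<alpha> / 2) * (norm z)\<^sup>2) / c = exp (\<alpha> / 2) * (2 * M / (\<alpha> * norm z))"
    by (simp add: K_def c_def mult_exp_exp)
  also have "norm (F (z - u)) * exp (- (\<alpha> / 2) * (norm z)\<^sup>2)
      \<le> norm (F (z - u)) * (exp (- (\<alpha> / 2) * (norm z - 1)) * exp (- (\<alpha> / 2) * (norm (z - u))\<^sup>2))"
  proof (rule mult_left_mono)
    have "\<alpha> / 2 * (norm (z - u))\<^sup>2 \<le> \<alpha> / 2 * ((norm z)\<^sup>2 - norm z + 1)"
      using dist[of 1] \<alpha> by (intro mult_left_mono) auto
    then show "exp (- (\<alpha> / 2) * (norm z)\<^sup>2) \<le> exp (- (\<alpha> / 2) * (norm z - 1)) * exp (- (\<alpha> / 2) * (norm (z - u))\<^sup>2)"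
      by (simp add: mult_exp_exp field_simps)
  qed simp
  finally show ?thesis
    by (simp add: fock_mod_def mult_ac)
qed

lemma powr_add_le:
  fixes a b :: real
  assumes "0 \<le> a" "0 \<le> b" "0 \<le> q"
  shows "(a + b) powr q \<le> 2 powr q * (a powr q + b powr q)"
proof -
  have "(a + b) powr q \<le> (2 * max a b) powr q"
    using assms by (intro powr_mono2) auto
  also have "\<dots> = 2 powr q * (max a b) powr q"
    using assms by (simp add: powr_mult)
  also have "\<dots> \<le> 2 powr q * (a powr q + b powr q)"
    by (intro mult_left_mono) (auto simp: max_def)
  finally show ?thesis .
qed

text \<open>
  The denominator \<open>1 + |w|\<close> may be inserted at the price of its largest value on \<open>A\<close>.
\<close>

lemma nn_integral_unweight:
  assumes q: "0 < q" and B: "\<And>w. w \<in> A \<Longrightarrow> 1 + norm w \<le> B" and B0: "0 \<le> B"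
    and h: "h holomorphic_on UNIV" and A: "A \<in> sets borel"
  shows "(\<integral>\<^sup>+w\<in>A. ennreal (fock_mod \<alpha> h w powr q) \<partial>lborel)
    \<le> ennreal (B powr q) * (\<integral>\<^sup>+w\<in>A. ennreal ((fock_mod \<alpha> h w / (1 + norm w)) powr q) \<partial>lborel)"
proof -
  note [measurable] = borel_measurable_entire[OF h] A
  have "(\<integral>\<^sup>+w\<in>A. ennreal (fock_mod \<alpha> h w powr q) \<partial>lborel)
    \<le> (\<integral>\<^sup>+w. ennreal (B powr q) * (ennreal ((fock_mod \<alpha> h w / (1 + norm w)) powr q) * indicator A w) \<partial>lborel)"
  proof (rule nn_integral_mono)
    fix w :: complex
    have "ennreal (fock_mod \<alpha> h w powr q) \<le> ennreal (B powr q) * ennreal ((fock_mod \<alpha> h w / (1 + norm w)) powr q)"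
      if "w \<in> A"
    proof -
      have n: "0 < 1 + norm w" by (simp add: add_pos_nonneg)
      have "fock_mod \<alpha> h w = (1 + norm w) * (fock_mod \<alpha> h w / (1 + norm w))" using n by simp
      also have "\<dots> \<le> B * (fock_mod \<alpha> h w / (1 + norm w))"
        using B[OF that] n by (intro mult_right_mono) auto
      finally have "fock_mod \<alpha> h w powr q \<le> (B * (fock_mod \<alpha> h w / (1 + norm w))) powr q"
        using q by (intro powr_mono2) auto
      also have "\<dots> = B powr q * (fock_mod \<alpha> h w / (1 + norm w)) powr q"
        using B0 n by (intro powr_mult)
      finally show ?thesis by (simp add: ennreal_leI flip: ennreal_mult)
    qed
    then show "ennreal (fock_mod \<alpha> h w powr q) * indicator A w
      \<le> ennreal (B powr q) * (ennreal ((fock_mod \<alpha> h w / (1 + norm w)) powr q) * indicator A w)"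
      by (auto simp: indicator_def)
  qed
  also have "\<dots> = ennreal (B powr q) * (\<integral>\<^sup>+w\<in>A. ennreal ((fock_mod \<alpha> h w / (1 + norm w)) powr q) \<partial>lborel)"
    by (intro nn_integral_cmult) measurable
  finally show ?thesis .
qed

lemma holomorphic_deriv_UNIV: "f holomorphic_on UNIV \<Longrightarrow> deriv f holomorphic_on UNIV"
  by (intro holomorphic_deriv) auto

text \<open>
  The step estimate for \<open>q\<close>-th powers. The bound \<open>M\<close> on the derivative comes from the sub-mean value
  property of \<open>F'\<close>, and the factor \<open>1 + |w|\<close>, comparable to \<open>|z|\<close> on the disc of radius two, cancels the
  denominator \<open>|z|\<close> that the step gains.
\<close>

lemma fock_mod_powr_step:
  assumes q: "0 < q" and \<alpha>: "0 < \<alpha>"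
  obtains C :: real where "0 < C"
    "\<And>F z u. F holomorphic_on UNIV \<Longrightarrow> norm u = 1 \<Longrightarrow> norm z / 2 \<le> Re (z * cnj u) \<Longrightarrow> 1 \<le> norm z \<Longrightarrow>
      ennreal (fock_mod \<alpha> F z powr q) \<le>
        ennreal (2 powr q * exp (- (\<alpha> / 2) * (norm z - 1)) powr q) * ennreal (fock_mod \<alpha> F (z - u) powr q)
        + ennreal C * (\<integral>\<^sup>+w\<in>ball z 2. ennreal ((fock_mod \<alpha> (deriv F) w / (1 + norm w)) powr q) \<partial>lborel)"
proof -
  obtain C :: real where C: "0 < C"
    "\<And>f z w. f holomorphic_on UNIV \<Longrightarrow> w \<in> cball z 1 \<Longrightarrow> ennreal (fock_mod \<alpha> f w powr q)
      \<le> ennreal C * (\<integral>\<^sup>+v\<in>ball z 2. ennreal (fock_mod \<alpha> f v powr q) \<partial>lborel)"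
    using fock_mod_powr_le_on_cball[OF q \<alpha>] by blast
  (* The step turns M = 6 |z| S into exp (\<alpha> / 2) * 2 M / (\<alpha> |z|) = L S. *)
  define L where "L = exp (\<alpha> / 2) * (12 / \<alpha>)"
  have L: "0 < L" using \<alpha> by (simp add: L_def)
  define D where "D = 2 powr q * L powr q * C"
  show thesis
  proof (rule that)
    show "0 < D" using C(1) L by (simp add: D_def)
    fix F and z u :: complex
    assume F: "F holomorphic_on UNIV" and u: "norm u = 1" "norm z / 2 \<le> Re (z * cnj u)" and z: "1 \<le> norm z"
    define G where "G = (\<integral>\<^sup>+w\<in>ball z 2. ennreal ((fock_mod \<alpha> (deriv F) w / (1 + norm w)) powr q) \<partial>lborel)"
    define e where "e = exp (- (\<alpha> / 2) * (norm z - 1))"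
    show "ennreal (fock_mod \<alpha> F z powr q) \<le>
        ennreal (2 powr q * exp (- (\<alpha> / 2) * (norm z - 1)) powr q) * ennreal (fock_mod \<alpha> F (z - u) powr q)
        + ennreal D * (\<integral>\<^sup>+w\<in>ball z 2. ennreal ((fock_mod \<alpha> (deriv F) w / (1 + norm w)) powr q) \<partial>lborel)"
      unfolding G_def[symmetric] e_def[symmetric]
    proof (cases "G < \<infinity>")
      case False
      then have "G = \<infinity>" by (simp add: less_top[symmetric])
      then show "ennreal (fock_mod \<alpha> F z powr q) \<le>
        ennreal (2 powr q * e powr q) * ennreal (fock_mod \<alpha> F (z - u) powr q) + ennreal D * G"
        using C(1) L by (simp add: ennreal_mult_top D_def)
    next
      case True
      obtain S where S: "0 \<le> S" "ennreal (S powr q) = ennreal C * G"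
        using ennreal_root_of_finite[OF q True C(1)] by blast
      have M: "fock_mod \<alpha> (deriv F) w \<le> 6 * norm z * S" if w: "w \<in> cball z 1" for w
      proof (rule le_of_ennreal_powr_le[OF q])
        have "ennreal (fock_mod \<alpha> (deriv F) w powr q)
          \<le> ennreal C * (\<integral>\<^sup>+v\<in>ball z 2. ennreal (fock_mod \<alpha> (deriv F) v powr q) \<partial>lborel)"
          by (rule C(2)[OF holomorphic_deriv_UNIV[OF F] w])
        also have "\<dots> \<le> ennreal C * (ennreal ((6 * norm z) powr q) * G)"
          unfolding G_def
        proof (intro mult_left_mono nn_integral_unweight q holomorphic_deriv_UNIV F)
          fix v assume "v \<in> ball z 2"
          then have "norm v \<le> norm z + 2"
            using norm_triangle_ineq2[of v z] by (simp add: dist_norm norm_minus_commute)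
          then show "1 + norm v \<le> 6 * norm z" using z by linarith
        qed auto
        also have "\<dots> = ennreal ((6 * norm z) powr q) * ennreal (S powr q)"
          unfolding S(2) by (simp add: mult_ac)
        also have "\<dots> = ennreal ((6 * norm z * S) powr q)"
          using S(1) by (subst powr_mult) (auto simp: ennreal_mult)
        finally show "ennreal (fock_mod \<alpha> (deriv F) w powr q) \<le> ennreal ((6 * norm z * S) powr q)" .
      qed (use S(1) in auto)
      have "fock_mod \<alpha> F z \<le> e * fock_mod \<alpha> F (z - u) + exp (\<alpha> / 2) * (2 * (6 * norm z * S) / (\<alpha> * norm z))"
        unfolding e_def by (rule fock_mod_step[OF \<alpha> F u z M])
      also have "exp (\<alpha> / 2) * (2 * (6 * norm z * S) / (\<alpha> * norm z)) = L * S"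
      proof -
        have "norm z \<noteq> 0" using z by linarith
        then show ?thesis by (simp add: L_def)
      qed
      finally have "fock_mod \<alpha> F z powr q \<le> (e * fock_mod \<alpha> F (z - u) + L * S) powr q"
        using q by (intro powr_mono2) auto
      also have "\<dots> \<le> 2 powr q * ((e * fock_mod \<alpha> F (z - u)) powr q + (L * S) powr q)"
        using q L S(1) by (intro powr_add_le) (auto simp: e_def)
      also have "\<dots> = 2 powr q * e powr q * fock_mod \<alpha> F (z - u) powr q + 2 powr q * L powr q * S powr q"
        using L S(1) by (simp add: powr_mult e_def distrib_left)
      finally have "ennreal (fock_mod \<alpha> F z powr q) \<le>
          ennreal (2 powr q * e powr q) * ennreal (fock_mod \<alpha> F (z - u) powr q)
          + ennreal (2 powr q * L powr q) * ennreal (S powr q)"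
        by (simp add: ennreal_leI flip: ennreal_mult ennreal_plus)
      then show "ennreal (fock_mod \<alpha> F z powr q) \<le>
          ennreal (2 powr q * e powr q) * ennreal (fock_mod \<alpha> F (z - u) powr q) + ennreal D * G"
        unfolding S(2) D_def using C(1) by (simp add: ennreal_mult mult.assoc)
    qed
  qed
qed

text \<open>
  Near the origin, where no decay of the weight is available, \<open>F 0 = 0\<close> and a bound for \<open>F'\<close> on a disc
  are enough.
\<close>

lemma fock_mod_powr_le_near_0:
  assumes q: "0 < q" and \<alpha>: "0 < \<alpha>" and R: "0 < R"
  obtains C :: real where "0 < C"
    "\<And>F z. F holomorphic_on UNIV \<Longrightarrow> F 0 = 0 \<Longrightarrow> norm z \<le> R \<Longrightarrow>
      ennreal (fock_mod \<alpha> F z powr q) \<le>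
        ennreal C * (\<integral>\<^sup>+w. ennreal ((fock_mod \<alpha> (deriv F) w / (1 + norm w)) powr q) \<partial>lborel)"
proof -
  obtain C :: real where C: "0 < C"
    "\<And>f z. f holomorphic_on UNIV \<Longrightarrow> ennreal (fock_mod \<alpha> f z powr q)
      \<le> ennreal C * (\<integral>\<^sup>+w\<in>ball z 1. ennreal (fock_mod \<alpha> f w powr q) \<partial>lborel)"
    using fock_mod_powr_sub_mean_value[OF q \<alpha>] by blast
  define L where "L = (R + 2) * exp (\<alpha> / 2 * R\<^sup>2) * R"
  have L: "0 < L" using R by (simp add: L_def)
  show thesis
  proof (rule that)
    show "0 < L powr q * C" using C(1) L by simp
    fix F and z :: complex
    assume F: "F holomorphic_on UNIV" and F0: "F 0 = 0" and z: "norm z \<le> R"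
    define J where "J = (\<integral>\<^sup>+w. ennreal ((fock_mod \<alpha> (deriv F) w / (1 + norm w)) powr q) \<partial>lborel)"
    show "ennreal (fock_mod \<alpha> F z powr q) \<le> ennreal (L powr q * C)
      * (\<integral>\<^sup>+w. ennreal ((fock_mod \<alpha> (deriv F) w / (1 + norm w)) powr q) \<partial>lborel)"
      unfolding J_def[symmetric]
    proof (cases "J < \<infinity>")
      case False
      then have "J = \<infinity>" by (simp add: less_top[symmetric])
      then show "ennreal (fock_mod \<alpha> F z powr q) \<le> ennreal (L powr q * C) * J"
        using C(1) L by (simp add: ennreal_mult_top)
    next
      case True
      obtain S where S: "0 \<le> S" "ennreal (S powr q) = ennreal C * J"
        using ennreal_root_of_finite[OF q True C(1)] by blast
      have M: "fock_mod \<alpha> (deriv F) w \<le> (R + 2) * S" if w: "norm w \<le> R" for w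
      proof (rule le_of_ennreal_powr_le[OF q])
        have "ennreal (fock_mod \<alpha> (deriv F) w powr q)
          \<le> ennreal C * (\<integral>\<^sup>+v\<in>ball w 1. ennreal (fock_mod \<alpha> (deriv F) v powr q) \<partial>lborel)"
          by (rule C(2)[OF holomorphic_deriv_UNIV[OF F]])
        also have "\<dots> \<le> ennreal C * (ennreal ((R + 2) powr q)
            * (\<integral>\<^sup>+v\<in>ball w 1. ennreal ((fock_mod \<alpha> (deriv F) v / (1 + norm v)) powr q) \<partial>lborel))"
        proof (intro mult_left_mono nn_integral_unweight q holomorphic_deriv_UNIV F)
          fix v assume "v \<in> ball w 1"
          then have "norm v \<le> norm w + 1"
            using norm_triangle_ineq2[of v w] by (simp add: dist_norm norm_minus_commute)
          then show "1 + norm v \<le> R + 2" using w by linarith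
        qed (use R in auto)
        also have "\<dots> \<le> ennreal C * (ennreal ((R + 2) powr q) * J)"
          unfolding J_def by (intro mult_left_mono nn_integral_mono) (auto simp: indicator_def)
        also have "\<dots> = ennreal ((R + 2) powr q) * ennreal (S powr q)"
          unfolding S(2) by (simp add: mult_ac)
        also have "\<dots> = ennreal (((R + 2) * S) powr q)"
          using S(1) R by (subst powr_mult) (auto simp: ennreal_mult)
        finally show "ennreal (fock_mod \<alpha> (deriv F) w powr q) \<le> ennreal (((R + 2) * S) powr q)" .
      qed (use S(1) R in auto)
      have dF: "norm (deriv F w) \<le> (R + 2) * S * exp (\<alpha> / 2 * R\<^sup>2)" if w: "norm w \<le> R" for w
      proof -
        have "norm (deriv F w) = fock_mod \<alpha> (deriv F) w * exp (\<alpha> / 2 * (norm w)\<^sup>2)"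
          by (simp add: fock_mod_def mult_exp_exp)
        also have "\<dots> \<le> (R + 2) * S * exp (\<alpha> / 2 * R\<^sup>2)"
        proof (intro mult_mono M w)
          show "exp (\<alpha> / 2 * (norm w)\<^sup>2) \<le> exp (\<alpha> / 2 * R\<^sup>2)"
            using w \<alpha> by (simp add: power_mono)
        qed (use S(1) R in auto)
        finally show ?thesis .
      qed
      have "norm (F z - F 0) \<le> (R + 2) * S * exp (\<alpha> / 2 * R\<^sup>2) * norm (z - 0)"
      proof (rule field_differentiable_bound[of "cball 0 R"])
        show "(F has_field_derivative deriv F w) (at w within cball 0 R)" for w
          by (rule has_field_derivative_at_within, rule holomorphic_derivI[OF F]) auto
      qed (use dF z R in auto)
      also have "\<dots> \<le> (R + 2) * S * exp (\<alpha> / 2 * R\<^sup>2) * R"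
        using z S(1) R by (intro mult_left_mono) auto
      also have "\<dots> = L * S" by (simp add: L_def)
      finally have "norm (F z) \<le> L * S" by (simp add: F0)
      moreover have "fock_mod \<alpha> F z \<le> norm (F z)"
        unfolding fock_mod_def using \<alpha> by (intro mult_left_le) auto
      ultimately have "fock_mod \<alpha> F z powr q \<le> (L * S) powr q"
        using q by (intro powr_mono2) auto
      also have "\<dots> = L powr q * S powr q" using L S(1) by (simp add: powr_mult)
      finally have "ennreal (fock_mod \<alpha> F z powr q) \<le> ennreal (L powr q) * ennreal (S powr q)"
        by (simp add: ennreal_leI flip: ennreal_mult)
      then show "ennreal (fock_mod \<alpha> F z powr q) \<le> ennreal (L powr q * C) * J"
        unfolding S(2) using C(1) by (simp add: ennreal_mult mult.assoc)
    qed
  qed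
qed

lemma nn_integral_le_of_balls:
  fixes h :: "complex \<Rightarrow> ennreal"
  assumes [measurable]: "h \<in> borel_measurable borel"
    and le: "\<And>n::nat. (\<integral>\<^sup>+z\<in>ball 0 (real n). h z \<partial>lborel) \<le> X"
  shows "(\<integral>\<^sup>+z. h z \<partial>lborel) \<le> X"
proof -
  have "(SUP n::nat. h z * indicator (ball 0 (real n)) z) = h z" for z
  proof (rule antisym)
    show "(SUP n::nat. h z * indicator (ball 0 (real n)) z) \<le> h z"
      by (rule SUP_least) (simp add: indicator_def)
    obtain n :: nat where "norm z < real n" using reals_Archimedean2 by blast
    then show "h z \<le> (SUP n::nat. h z * indicator (ball 0 (real n)) z)"
      by (intro SUP_upper2[of n]) auto
  qed
  then have "(\<integral>\<^sup>+z. h z \<partial>lborel) = (\<integral>\<^sup>+z. (SUP n::nat. h z * indicator (ball 0 (real n)) z) \<partial>lborel)"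
    by simp
  also have "\<dots> = (SUP n::nat. \<integral>\<^sup>+z. h z * indicator (ball 0 (real n)) z \<partial>lborel)"
  proof (rule nn_integral_monotone_convergence_SUP)
    show "incseq (\<lambda>n z. h z * indicator (ball 0 (real n)) z)"
      by (auto simp: incseq_def le_fun_def indicator_def)
  qed measurable
  also have "\<dots> \<le> X" by (rule SUP_least) (rule le)
  finally show ?thesis .
qed

text \<open>
  Four directions suffice for the steps towards the origin. Steps along a fixed direction are
  translations and preserve Lebesgue measure.
\<close>

lemma exists_direction:
  obtains u :: complex where "u \<in> {1, -1, \<i>, -\<i>}" "norm z / 2 \<le> Re (z * cnj u)"
proof -
  have "norm z \<le> \<bar>Re z\<bar> + \<bar>Im z\<bar>" by (rule cmod_le)
  then have "norm z / 2 \<le> Re z \<or> norm z / 2 \<le> - Re z \<or> norm z / 2 \<le> Im z \<or> norm z / 2 \<le> - Im z"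
    by linarith
  then show thesis
    using that[of 1] that[of "-1"] that[of \<i>] that[of "-\<i>"] by auto
qed

text \<open>
  Let \<open>A\<close> be the integral of \<open>|F|\<^sup>q\<close> with its weight over a disc about the origin. Far from the origin the
  step estimate bounds the integrand at \<open>z\<close> by an eighth of its value at \<open>z - u\<close> plus a local average of
  the integrand with \<open>F'\<close>. A step towards the origin stays in the disc, so the four directions together
  contribute at most \<open>A / 2\<close>. This is absorbed in the left side since \<open>A\<close> is finite, with a constant that
  does not depend on the radius of the disc; the radius then tends to infinity.
\<close>

lemma fock_integral_le_derivative_integral:
  assumes q: "0 < q" and \<alpha>: "0 < \<alpha>"
  obtains C :: real where "0 < C"
    "\<And>F. F holomorphic_on UNIV \<Longrightarrow> F 0 = 0 \<Longrightarrow>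
      (\<integral>\<^sup>+z. ennreal (fock_mod \<alpha> F z powr q) \<partial>lborel)
      \<le> ennreal C * (\<integral>\<^sup>+z. ennreal ((fock_mod \<alpha> (deriv F) z / (1 + norm z)) powr q) \<partial>lborel)"
proof -
  obtain C1 :: real where C1: "0 < C1"
    "\<And>F z u. F holomorphic_on UNIV \<Longrightarrow> norm u = 1 \<Longrightarrow> norm z / 2 \<le> Re (z * cnj u) \<Longrightarrow> 1 \<le> norm z \<Longrightarrow>
      ennreal (fock_mod \<alpha> F z powr q) \<le>
        ennreal (2 powr q * exp (- (\<alpha> / 2) * (norm z - 1)) powr q) * ennreal (fock_mod \<alpha> F (z - u) powr q)
        + ennreal C1 * (\<integral>\<^sup>+w\<in>ball z 2. ennreal ((fock_mod \<alpha> (deriv F) w / (1 + norm w)) powr q) \<partial>lborel)"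
    using fock_mod_powr_step[OF q \<alpha>] by blast
  (* Beyond this radius the factor in the step estimate is at most 1 / 8, so that four directions
     contribute at most one half. *)
  define R where "R = 1 + 2 * (ln 2 + ln 8 / q) / \<alpha>"
  have R: "1 \<le> R" using q \<alpha> by (simp add: R_def)
  have eps: "2 powr q * exp (- (\<alpha> / 2) * (r - 1)) powr q \<le> 1 / 8" if "R \<le> r" for r
  proof -
    have "\<alpha> / 2 * (R - 1) \<le> \<alpha> / 2 * (r - 1)"
      using that \<alpha> by (intro mult_left_mono) auto
    moreover have "\<alpha> / 2 * (R - 1) = ln 2 + ln 8 / q"
      using \<alpha> by (simp add: R_def)
    ultimately have "exp (- (\<alpha> / 2) * (r - 1)) \<le> exp (- (ln 2 + ln 8 / q))"
      by simp
    then have "2 powr q * exp (- (\<alpha> / 2) * (r - 1)) powr q \<le> 2 powr q * exp (- (ln 2 + ln 8 / q)) powr q"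
      using q by (intro mult_left_mono powr_mono2) auto
    also have "\<dots> = exp (q * ln 2 + q * (- (ln 2 + ln 8 / q)))"
      unfolding exp_add by (simp add: powr_def)
    also have "q * ln 2 + q * (- (ln 2 + ln 8 / q)) = - ln 8"
      using q by (simp add: field_simps)
    also have "exp (- ln 8) = 1 / (8::real)" by (simp add: exp_minus)
    finally show ?thesis .
  qed
  obtain C2 :: real where C2: "0 < C2"
    "\<And>F z. F holomorphic_on UNIV \<Longrightarrow> F 0 = 0 \<Longrightarrow> norm z \<le> R \<Longrightarrow>
      ennreal (fock_mod \<alpha> F z powr q) \<le>
        ennreal C2 * (\<integral>\<^sup>+w. ennreal ((fock_mod \<alpha> (deriv F) w / (1 + norm w)) powr q) \<partial>lborel)"
    using fock_mod_powr_le_near_0[OF q \<alpha>, of R] R by auto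
  define D where "D = C2 * (pi * R\<^sup>2) + C1 * (pi * 2\<^sup>2)"
  have D: "0 < D" using C1(1) C2(1) R by (simp add: D_def add_pos_nonneg add_nonneg_pos)
  show thesis
  proof (rule that)
    show "0 < 2 * D" using D by simp
    fix F assume F: "F holomorphic_on UNIV" and F0: "F 0 = 0"
    note dF = holomorphic_deriv_UNIV[OF F]
    note [measurable] = borel_measurable_entire[OF F] borel_measurable_entire[OF dF]
    define J where "J = (\<integral>\<^sup>+z. ennreal ((fock_mod \<alpha> (deriv F) z / (1 + norm z)) powr q) \<partial>lborel)"
    define G where "G z = (\<integral>\<^sup>+w\<in>ball z 2. ennreal ((fock_mod \<alpha> (deriv F) w / (1 + norm w)) powr q) \<partial>lborel)" for z
    have jm: "(\<lambda>w. ennreal ((fock_mod \<alpha> (deriv F) w / (1 + norm w)) powr q)) \<in> borel_measurable borel"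
      by measurable
    have Gm [measurable]: "G \<in> borel_measurable borel"
      using lborel.borel_measurable_nn_integral[OF borel_measurable_ball_kernel[OF jm, of 2]]
      by (simp add: G_def[abs_def])
    have GJ: "(\<integral>\<^sup>+z. G z \<partial>lborel) = ennreal (pi * 2\<^sup>2) * J"
      unfolding G_def J_def by (rule nn_integral_ball_average[OF jm]) simp
    let ?h = "\<lambda>z. ennreal (fock_mod \<alpha> F z powr q)"
    let ?U = "{1, -1, \<i>, -\<i>} :: complex set"
    have cardU: "card ?U = 4" by (simp add: complex_eq_iff)
    have "(\<integral>\<^sup>+z\<in>ball 0 (real n). ?h z \<partial>lborel) \<le> ennreal (2 * D) * J" for n :: nat
    proof -
      define A where "A = (\<integral>\<^sup>+z\<in>ball 0 (real n). ?h z \<partial>lborel)"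
      have pw: "?h z * indicator (ball 0 (real n)) z
          \<le> ennreal C2 * J * indicator (ball 0 R) z
            + (\<Sum>u\<in>?U. ennreal (1 / 8) * (?h (- u + z) * indicator (ball 0 (real n)) (- u + z))) + ennreal C1 * G z" for z
      proof (cases "norm z < R")
        case True
        have "?h z * indicator (ball 0 (real n)) z \<le> ?h z"
          by (simp add: indicator_def)
        also have "\<dots> \<le> ennreal C2 * J"
          unfolding J_def using True by (intro C2 F F0) simp
        also have "\<dots> = ennreal C2 * J * indicator (ball 0 R) z"
          using True by simp
        finally show ?thesis by (simp add: add_increasing2 add.assoc)
      next
        case False
        obtain u where u: "u \<in> ?U" "norm z / 2 \<le> Re (z * cnj u)" by (rule exists_direction)
        have u1: "norm u = 1" using u(1) by auto
        have z1: "1 \<le> norm z" using False R by simp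
        have "norm (z - u) \<le> norm z"
        proof (rule power2_le_imp_le)
          have u2: "(Re u)\<^sup>2 + (Im u)\<^sup>2 = 1" using u1 by (simp add: cmod_def)
          have "(norm (z - u))\<^sup>2 = (norm z)\<^sup>2 - 2 * Re (z * cnj u) + ((Re u)\<^sup>2 + (Im u)\<^sup>2)"
            unfolding cmod_power2 by (simp add: power2_eq_square algebra_simps)
          then show "(norm (z - u))\<^sup>2 \<le> (norm z)\<^sup>2" unfolding u2 using u(2) z1 by linarith
        qed simp
        then have ind: "indicator (ball 0 (real n)) z \<le> (indicator (ball 0 (real n)) (- u + z) :: ennreal)"
          by (auto simp: indicator_def)
        have "?h z \<le> ennreal (2 powr q * exp (- (\<alpha> / 2) * (norm z - 1)) powr q) * ?h (z - u) + ennreal C1 * G z"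
          unfolding G_def by (rule C1(2)[OF F u1 u(2) z1])
        also have "\<dots> \<le> ennreal (1 / 8) * ?h (- u + z) + ennreal C1 * G z"
          using False by (intro add_right_mono mult_mono ennreal_leI eps) auto
        finally have "?h z * indicator (ball 0 (real n)) z
            \<le> (ennreal (1 / 8) * ?h (- u + z) + ennreal C1 * G z) * indicator (ball 0 (real n)) z"
          by (rule mult_right_mono) simp
        also have "\<dots> \<le> ennreal (1 / 8) * (?h (- u + z) * indicator (ball 0 (real n)) z) + ennreal C1 * G z"
          by (auto simp: indicator_def)
        also have "\<dots> \<le> ennreal (1 / 8) * (?h (- u + z) * indicator (ball 0 (real n)) (- u + z)) + ennreal C1 * G z"
          by (intro add_right_mono mult_left_mono ind) auto
        also have "\<dots> \<le> (\<Sum>u\<in>?U. ennreal (1 / 8) * (?h (- u + z) * indicator (ball 0 (real n)) (- u + z))) + ennreal C1 * G z"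
          by (intro add_right_mono member_le_sum u(1)) auto
        finally show ?thesis by (simp add: add_increasing add.assoc)
      qed
      have tr: "(\<integral>\<^sup>+z. ?h (- u + z) * indicator (ball 0 (real n)) (- u + z) \<partial>lborel) = A" for u
        unfolding A_def
        by (rule nn_integral_lborel_translate[of "\<lambda>z. ?h z * indicator (ball 0 (real n)) z" "- u"]) measurable
      have tm [measurable]: "(\<lambda>z. ?h (- u + z) * indicator (ball 0 (real n)) (- u + z)) \<in> borel_measurable borel" for u
        by measurable
      have "A \<le> (\<integral>\<^sup>+z. ennreal C2 * J * indicator (ball 0 R) z
            + (\<Sum>u\<in>?U. ennreal (1 / 8) * (?h (- u + z) * indicator (ball 0 (real n)) (- u + z))) + ennreal C1 * G z \<partial>lborel)"
        unfolding A_def by (rule nn_integral_mono) (rule pw)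
      also have "\<dots> = (\<integral>\<^sup>+z. ennreal C2 * J * indicator (ball (0::complex) R) z \<partial>lborel)
            + (\<Sum>u\<in>?U. ennreal (1 / 8) * (\<integral>\<^sup>+z. ?h (- u + z) * indicator (ball 0 (real n)) (- u + z) \<partial>lborel))
            + ennreal C1 * (\<integral>\<^sup>+z. G z \<partial>lborel)"
      proof -
        have b2: "(\<lambda>z. ?h (- u + z) * indicator (ball 0 (real n)) (- u + z)) \<in> borel_measurable lborel" for u
          by measurable
        have b3: "G \<in> borel_measurable lborel"
          by measurable
        have m1: "(\<lambda>z::complex. ennreal C2 * J * indicator (ball 0 R) z) \<in> borel_measurable lborel"
          by measurable
        have m2: "(\<lambda>z. ennreal (1 / 8) * (?h (- u + z) * indicator (ball 0 (real n)) (- u + z))) \<in> borel_measurable lborel" for u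
          by measurable
        have m3: "(\<lambda>z. ennreal C1 * G z) \<in> borel_measurable lborel"
          by measurable
        have m2': "(\<lambda>z. \<Sum>u\<in>?U. ennreal (1 / 8) * (?h (- u + z) * indicator (ball 0 (real n)) (- u + z))) \<in> borel_measurable lborel"
          by (rule borel_measurable_sum) (rule m2)
        show ?thesis
          unfolding nn_integral_add[OF borel_measurable_add[OF m1 m2'] m3] nn_integral_add[OF m1 m2'] nn_integral_sum[OF m2]
            nn_integral_cmult[OF b2] nn_integral_cmult[OF b3] by (rule refl)
      qed
      also have "\<dots> = ennreal C2 * J * ennreal (pi * R\<^sup>2) + (\<Sum>u\<in>?U. ennreal (1 / 8) * A) + ennreal C1 * (ennreal (pi * 2\<^sup>2) * J)"
        using R unfolding tr GJ by (simp add: nn_integral_cmult_indicator measure_ball_complex)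
      also have "(\<Sum>u\<in>?U. ennreal (1 / 8) * A) = ennreal (1 / 2) * A"
      proof -
        have "(\<Sum>u\<in>?U. ennreal (1 / 8) * A) = ennreal 4 * (ennreal (1 / 8) * A)"
          by (simp only: sum_constant cardU) simp
        also have "\<dots> = ennreal (4 * (1 / 8)) * A" by (subst ennreal_mult) (auto simp: mult.assoc)
        finally show ?thesis by simp
      qed
      also have "ennreal C2 * J * ennreal (pi * R\<^sup>2) + ennreal (1 / 2) * A + ennreal C1 * (ennreal (pi * 2\<^sup>2) * J)
          = ennreal (1 / 2) * A + ennreal D * J"
        using C1(1) C2(1) by (simp add: D_def ennreal_mult ennreal_plus distrib_right distrib_left mult_ac add_ac)
      finally have main: "A \<le> ennreal (1 / 2) * A + ennreal D * J" .
      have Afin: "A < \<infinity>"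
      proof -
        have "compact ((\<lambda>z. fock_mod \<alpha> F z powr q) ` cball 0 (real n))"
          by (intro compact_continuous_image continuous_on_subset[OF continuous_on_fock_mod_powr[OF F q]]) auto
        then obtain B where B: "\<And>z. z \<in> cball 0 (real n) \<Longrightarrow> fock_mod \<alpha> F z powr q \<le> B"
          by (meson bounded_imp_bdd_above bdd_above.unfold compact_imp_bounded image_eqI)
        have "A \<le> (\<integral>\<^sup>+z. ennreal B * indicator (ball (0::complex) (real n)) z \<partial>lborel)"
          unfolding A_def using B by (intro nn_integral_mono) (auto simp: indicator_def intro!: ennreal_leI)
        also have "\<dots> < \<infinity>"
          by (simp add: nn_integral_cmult_indicator measure_ball_complex ennreal_mult_less_top)
        finally show ?thesis .
      qed
      have "ennreal (1 / 2) * A + ennreal (1 / 2) * A = A"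
      proof -
        have "ennreal (1 / 2) + ennreal (1 / 2) = 1"
          by (subst ennreal_plus[symmetric]) auto
        then show ?thesis by (simp only: distrib_right[symmetric] mult_1)
      qed
      then have "ennreal (1 / 2) * A + ennreal (1 / 2) * A \<le> ennreal (1 / 2) * A + ennreal D * J"
        using main by simp
      then have "ennreal (1 / 2) * A \<le> ennreal D * J"
        using Afin by (subst (asm) ennreal_add_left_cancel_le) (auto simp: ennreal_mult_eq_top_iff)
      then have "ennreal 2 * (ennreal (1 / 2) * A) \<le> ennreal 2 * (ennreal D * J)"
        by (rule mult_left_mono) simp
      moreover have "ennreal 2 * (ennreal (1 / 2) * A) = A"
      proof -
        have "ennreal 2 * ennreal (1 / 2) = 1"
          by (subst ennreal_mult[symmetric]) auto
        then show ?thesis by (simp only: mult.assoc[symmetric] mult_1)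
      qed
      ultimately show ?thesis
        unfolding A_def[symmetric] using D by (subst ennreal_mult) (simp_all add: mult.assoc)
    qed
    then show "(\<integral>\<^sup>+z. ?h z \<partial>lborel)
      \<le> ennreal (2 * D) * (\<integral>\<^sup>+z. ennreal ((fock_mod \<alpha> (deriv F) z / (1 + norm z)) powr q) \<partial>lborel)"
      unfolding J_def[symmetric] by (rule nn_integral_le_of_balls[rotated]) measurable
  qed
qed

section \<open>The Fock norm\<close>

lemma ennreal_powr_ennreal: "0 \<le> r \<Longrightarrow> ennreal_powr (ennreal r) a = ennreal (r powr a)"
  by (simp add: ennreal_powr_def)

lemma ennreal_powr_top [simp]: "ennreal_powr \<infinity> a = \<infinity>" "ennreal_powr top a = \<infinity>"
  by (simp_all add: ennreal_powr_def)

lemma ennreal_powr_0 [simp]: "ennreal_powr 0 a = 0"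
  by (simp add: ennreal_powr_def)

lemma ennreal_powr_eq_top_iff: "ennreal_powr x a = \<infinity> \<longleftrightarrow> x = \<infinity>"
  by (simp add: ennreal_powr_def)

lemma ennreal_powr_less_top_iff: "ennreal_powr x a < \<infinity> \<longleftrightarrow> x < \<infinity>"
  using ennreal_powr_eq_top_iff[of x a] by (simp add: less_top[symmetric])

lemma ennreal_powr_mono:
  assumes "x \<le> y" "0 \<le> a" shows "ennreal_powr x a \<le> ennreal_powr y a"
  using assms
proof (cases y)
  case (real r)
  then obtain s where s: "0 \<le> s" "x = ennreal s" "s \<le> r"
    using assms(1) by (cases x) (auto simp: ennreal_le_iff top_unique)
  then show ?thesis using real assms(2) by (simp add: ennreal_powr_ennreal ennreal_leI powr_mono2)
qed simp

lemma ennreal_powr_mult: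
  assumes a: "0 < a" shows "ennreal_powr (x * y) a = ennreal_powr x a * ennreal_powr y a"
proof -
  have *: "ennreal_powr (top * y) a = top * ennreal_powr y a" for y
  proof (cases y)
    case (real r)
    show ?thesis
    proof (cases "r = 0")
      case False
      then have "0 < r powr a" using real by simp
      then show ?thesis
        using real False by (simp add: ennreal_powr_ennreal ennreal_top_mult)
    qed (simp add: real)
  qed simp
  show ?thesis
  proof (cases x)
    case x: (real r)
    show ?thesis
    proof (cases y)
      case y: (real s)
      have "ennreal_powr (ennreal r * ennreal s) a = ennreal ((r * s) powr a)"
        using x(1) y(1) by (simp add: ennreal_powr_ennreal flip: ennreal_mult)
      also have "\<dots> = ennreal (r powr a) * ennreal (s powr a)"
        using x(1) y(1) by (simp add: powr_mult ennreal_mult)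
      finally show ?thesis using x y by (simp add: ennreal_powr_ennreal)
    next
      case top
      then show ?thesis using *[of x] by (simp add: mult.commute)
    qed
  next
    case top
    then show ?thesis using *[of y] by simp
  qed
qed

lemma ennreal_powr_powr: "ennreal_powr (ennreal_powr x a) b = ennreal_powr x (a * b)"
  by (cases x) (auto simp: ennreal_powr_ennreal powr_powr)

lemma ennreal_powr_1 [simp]: "ennreal_powr x 1 = x"
  by (cases x) (auto simp: ennreal_powr_ennreal)

lemma ennreal_tendsto_0I:
  assumes "\<And>e::real. 0 < e \<Longrightarrow> eventually (\<lambda>x. X x \<le> ennreal e) F"
  shows "(X \<longlongrightarrow> 0) F"
proof (rule order_tendstoI)
  fix y :: ennreal assume y: "0 < y"
  obtain e where e: "0 < e" "ennreal e < y"
  proof (cases y)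
    case top
    then show thesis using that[of 1] by simp
  next
    case (real t)
    then show thesis using that[of "t / 2"] y by (simp add: ennreal_less_iff)
  qed
  show "eventually (\<lambda>x. X x < y) F"
    using assms[OF e(1)] by eventually_elim (use e(2) in auto)
qed simp

lemma ennreal_powr_tendsto_0:
  assumes a: "0 < a" and X: "(X \<longlongrightarrow> 0) F"
  shows "((\<lambda>n. ennreal_powr (X n) a) \<longlongrightarrow> 0) F"
proof (rule ennreal_tendsto_0I)
  fix e :: real assume e: "0 < e"
  have "eventually (\<lambda>n. X n < ennreal (e powr (1 / a))) F"
    using X e by (intro order_tendstoD) auto
  then show "eventually (\<lambda>n. ennreal_powr (X n) a \<le> ennreal e) F"
  proof eventually_elim
    case (elim n)
    have "ennreal_powr (X n) a \<le> ennreal_powr (ennreal (e powr (1 / a))) a"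
      using elim a by (intro ennreal_powr_mono) auto
    also have "\<dots> = ennreal e" using a e by (simp add: ennreal_powr_ennreal powr_powr)
    finally show ?case .
  qed
qed

lemma fock_norm_eq:
  "fock_norm q \<alpha> f = ennreal_powr (ennreal (q * \<alpha> / (2 * pi)) * (\<integral>\<^sup>+z. ennreal (fock_mod \<alpha> f z powr q) \<partial>lborel)) (1 / q)"
  unfolding fock_norm_def fock_mod_powr ..

lemma fock_norm_powr:
  assumes "0 < q"
  shows "ennreal_powr (fock_norm q \<alpha> f) q
    = ennreal (q * \<alpha> / (2 * pi)) * (\<integral>\<^sup>+z. ennreal (fock_mod \<alpha> f z powr q) \<partial>lborel)"
  using assms by (simp add: fock_norm_eq ennreal_powr_powr)

lemma nn_integral_fock_mod_powr:
  assumes "0 < q" "0 < \<alpha>"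
  shows "(\<integral>\<^sup>+z. ennreal (fock_mod \<alpha> f z powr q) \<partial>lborel)
    = ennreal (2 * pi / (q * \<alpha>)) * ennreal_powr (fock_norm q \<alpha> f) q"
proof -
  have "ennreal (2 * pi / (q * \<alpha>)) * ennreal (q * \<alpha> / (2 * pi)) = 1"
    using assms by (simp flip: ennreal_mult)
  then show ?thesis
    unfolding fock_norm_powr[OF assms(1)] mult.assoc[symmetric] by simp
qed

lemma le_ennreal_powr_inverse:
  assumes "0 < q" "ennreal_powr x q \<le> y"
  shows "x \<le> ennreal_powr y (1 / q)"
proof -
  have "ennreal_powr (ennreal_powr x q) (1 / q) \<le> ennreal_powr y (1 / q)"
    using assms by (intro ennreal_powr_mono) auto
  then show ?thesis using assms(1) by (simp add: ennreal_powr_powr)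
qed

text \<open>
  Functions of finite norm grow at most like \<open>exp (\<alpha> |z|\<^sup>2 / 2)\<close>.
\<close>

lemma fock_mod_le_fock_norm:
  assumes q: "0 < q" and \<alpha>: "0 < \<alpha>"
  obtains C :: real where "0 < C"
    "\<And>f z. f holomorphic_on UNIV \<Longrightarrow> ennreal (fock_mod \<alpha> f z) \<le> ennreal C * fock_norm q \<alpha> f"
proof -
  obtain C :: real where C: "0 < C"
    "\<And>f z. f holomorphic_on UNIV \<Longrightarrow> ennreal (fock_mod \<alpha> f z powr q)
      \<le> ennreal C * (\<integral>\<^sup>+w\<in>ball z 1. ennreal (fock_mod \<alpha> f w powr q) \<partial>lborel)"
    using fock_mod_powr_sub_mean_value[OF q \<alpha>] by blast
  define K where "K = C * (2 * pi / (q * \<alpha>))"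
  have K: "0 < K" using C(1) q \<alpha> by (simp add: K_def)
  show thesis
  proof (rule that)
    show "0 < K powr (1 / q)" using K by simp
    fix f z assume f: "f holomorphic_on UNIV"
    have "ennreal_powr (ennreal (fock_mod \<alpha> f z)) q
      \<le> ennreal C * (\<integral>\<^sup>+w\<in>ball z 1. ennreal (fock_mod \<alpha> f w powr q) \<partial>lborel)"
      using C(2)[OF f] by (simp add: ennreal_powr_ennreal)
    also have "\<dots> \<le> ennreal C * (\<integral>\<^sup>+w. ennreal (fock_mod \<alpha> f w powr q) \<partial>lborel)"
      by (intro mult_left_mono nn_integral_mono) (auto simp: indicator_def)
    also have "\<dots> = ennreal K * ennreal_powr (fock_norm q \<alpha> f) q"
      unfolding nn_integral_fock_mod_powr[OF q \<alpha>] K_def using C(1) q \<alpha>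
      by (simp add: ennreal_mult mult.assoc del: times_divide_eq_right)
    finally have "ennreal (fock_mod \<alpha> f z) \<le> ennreal_powr (ennreal K * ennreal_powr (fock_norm q \<alpha> f) q) (1 / q)"
      by (rule le_ennreal_powr_inverse[OF q])
    also have "\<dots> = ennreal (K powr (1 / q)) * fock_norm q \<alpha> f"
      using q K by (simp add: ennreal_powr_mult ennreal_powr_powr ennreal_powr_ennreal)
    finally show "ennreal (fock_mod \<alpha> f z) \<le> ennreal (K powr (1 / q)) * fock_norm q \<alpha> f" .
  qed
qed

text \<open>
  By the pointwise bound, \<open>fock_mod \<alpha> f z powr (q - p)\<close> is at most a multiple of \<open>\<parallel>f\<parallel>\<^sub>p\<^sup>q\<^sup>-\<^sup>p\<close>, which
  leaves the \<open>p\<close>-th power under the integral.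
\<close>

lemma fock_norm_embedding:
  assumes p: "0 < p" and pq: "p \<le> q" and \<alpha>: "0 < \<alpha>"
  obtains C :: real where "0 < C"
    "\<And>f. f holomorphic_on UNIV \<Longrightarrow> fock_norm q \<alpha> f \<le> ennreal C * fock_norm p \<alpha> f"
proof -
  have q: "0 < q" using p pq by simp
  obtain C :: real where C: "0 < C"
    "\<And>f z. f holomorphic_on UNIV \<Longrightarrow> ennreal (fock_mod \<alpha> f z) \<le> ennreal C * fock_norm p \<alpha> f"
    using fock_mod_le_fock_norm[OF p \<alpha>] by blast
  define K where "K = q * \<alpha> / (2 * pi) * (C powr (q - p) * (2 * pi / (p * \<alpha>)))"
  have K: "0 < K" using C(1) p q \<alpha> by (simp add: K_def)
  show thesis
  proof (rule that)
    show "0 < K powr (1 / q)" using K by simp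
    fix f assume f: "f holomorphic_on UNIV"
    note [measurable] = borel_measurable_entire[OF f]
    show "fock_norm q \<alpha> f \<le> ennreal (K powr (1 / q)) * fock_norm p \<alpha> f"
    proof (cases "fock_norm p \<alpha> f")
      case top
      then show ?thesis using K by (simp add: ennreal_mult_top)
    next
      case (real X)
      have bd: "fock_mod \<alpha> f z \<le> C * X" for z
        using C(2)[OF f, of z] C(1) real(1) unfolding real(2)
        by (simp add: ennreal_le_iff flip: ennreal_mult)
      have pt: "fock_mod \<alpha> f z powr q \<le> (C * X) powr (q - p) * fock_mod \<alpha> f z powr p" for z
      proof -
        have "fock_mod \<alpha> f z powr q = fock_mod \<alpha> f z powr (q - p) * fock_mod \<alpha> f z powr p"
          by (simp flip: powr_add)
        also have "\<dots> \<le> (C * X) powr (q - p) * fock_mod \<alpha> f z powr p"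
          using pq bd by (intro mult_right_mono powr_mono2) auto
        finally show ?thesis .
      qed
      have "ennreal_powr (fock_norm q \<alpha> f) q \<le> ennreal (q * \<alpha> / (2 * pi)) *
          (\<integral>\<^sup>+z. ennreal ((C * X) powr (q - p)) * ennreal (fock_mod \<alpha> f z powr p) \<partial>lborel)"
        unfolding fock_norm_powr[OF q]
        by (intro mult_left_mono nn_integral_mono) (auto intro!: ennreal_leI pt simp flip: ennreal_mult)
      also have "\<dots> = ennreal (q * \<alpha> / (2 * pi)) * (ennreal ((C * X) powr (q - p)) *
          (\<integral>\<^sup>+z. ennreal (fock_mod \<alpha> f z powr p) \<partial>lborel))"
        by (subst nn_integral_cmult) auto
      also have "\<dots> = ennreal (q * \<alpha> / (2 * pi)) * (ennreal ((C * X) powr (q - p)) * (ennreal (2 * pi / (p * \<alpha>)) * ennreal (X powr p)))"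
        unfolding nn_integral_fock_mod_powr[OF p \<alpha>] real(2) ennreal_powr_ennreal[OF real(1)] ..
      also have "\<dots> = ennreal (q * \<alpha> / (2 * pi) * ((C * X) powr (q - p) * (2 * pi / (p * \<alpha>) * X powr p)))"
        using q p \<alpha> by (simp add: ennreal_mult[symmetric] del: times_divide_eq_left times_divide_eq_right)
      also have "q * \<alpha> / (2 * pi) * ((C * X) powr (q - p) * (2 * pi / (p * \<alpha>) * X powr p)) = K * X powr q"
      proof -
        have "X powr q = X powr (q - p) * X powr p" by (simp flip: powr_add)
        then show ?thesis
          using C(1) real(1) by (simp add: K_def powr_mult)
      qed
      finally have "fock_norm q \<alpha> f \<le> ennreal_powr (ennreal (K * X powr q)) (1 / q)"
        by (rule le_ennreal_powr_inverse[OF q])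
      also have "\<dots> = ennreal (K powr (1 / q)) * fock_norm p \<alpha> f"
        unfolding real(2) using K real(1) q by (simp add: ennreal_powr_ennreal powr_mult powr_powr flip: ennreal_mult)
      finally show ?thesis .
    qed
  qed
qed

section \<open>Coherent states and the Berezin transform\<close>

lemma summable_gaussian_layers:
  assumes c: "0 < (c::real)"
  shows "summable (\<lambda>n::nat. exp (- c * (real n)\<^sup>2) * (pi * (real n + 1)\<^sup>2))"
proof (rule summable_comparison_test'[where N = 1])
  have "summable (\<lambda>n::nat. inverse ((real n)\<^sup>2))"
    by (rule inverse_power_summable) simp
  then show "summable (\<lambda>n::nat. 8 * pi / c\<^sup>2 * inverse ((real n)\<^sup>2))"
    by (rule summable_mult)
  fix n :: nat assume n: "1 \<le> n"
  (* The quadratic Taylor term of exp at c n^2 beats the growth of the area by a factor n^2. *)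
  have "(c * (real n)\<^sup>2)\<^sup>2 / 2 \<le> 1 + c * (real n)\<^sup>2 + (c * (real n)\<^sup>2)\<^sup>2 / 2"
    using c by simp
  also have "\<dots> \<le> exp (c * (real n)\<^sup>2)"
    using c by (intro exp_lower_Taylor_quadratic) simp
  finally have e: "(c * (real n)\<^sup>2)\<^sup>2 / 2 \<le> exp (c * (real n)\<^sup>2)" .
  have pos: "0 < (c * (real n)\<^sup>2)\<^sup>2 / 2" using c n by simp
  have "exp (- c * (real n)\<^sup>2) = inverse (exp (c * (real n)\<^sup>2))"
    by (simp add: exp_minus)
  also have "\<dots> \<le> inverse ((c * (real n)\<^sup>2)\<^sup>2 / 2)"
    by (rule le_imp_inverse_le[OF e pos])
  finally have "exp (- c * (real n)\<^sup>2) * (pi * (real n + 1)\<^sup>2)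
      \<le> inverse ((c * (real n)\<^sup>2)\<^sup>2 / 2) * (pi * (2 * real n)\<^sup>2)"
    using n pos by (intro mult_mono power_mono) auto
  also have "\<dots> = 8 * pi / c\<^sup>2 * inverse ((real n)\<^sup>2)"
    using c n by (simp add: field_simps power2_eq_square)
  finally show "norm (exp (- c * (real n)\<^sup>2) * (pi * (real n + 1)\<^sup>2)) \<le> 8 * pi / c\<^sup>2 * inverse ((real n)\<^sup>2)"
    by simp
qed

text \<open>
  The Gaussian is bounded by its values at integer radii, hence by a sum over discs of radius \<open>n + 1\<close>.
\<close>

lemma gaussian_integral_finite:
  assumes c: "0 < (c::real)"
  shows "(\<integral>\<^sup>+z. ennreal (exp (- c * (norm (z::complex))\<^sup>2)) \<partial>lborel) < \<infinity>"
proof -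
  let ?a = "\<lambda>n::nat. ennreal (exp (- c * (real n)\<^sup>2))"
  have "(\<integral>\<^sup>+z. ennreal (exp (- c * (norm (z::complex))\<^sup>2)) \<partial>lborel)
      \<le> (\<integral>\<^sup>+z. (\<Sum>n. ?a n * indicator (ball (0::complex) (real n + 1)) z) \<partial>lborel)"
  proof (rule nn_integral_mono)
    fix z :: complex
    define n where "n = nat \<lfloor>norm z\<rfloor>"
    have n: "real n \<le> norm z" "norm z < real n + 1"
      by (simp_all add: n_def of_nat_nat)
    have "ennreal (exp (- c * (norm z)\<^sup>2)) \<le> ?a n * indicator (ball 0 (real n + 1)) z"
      using n c by (auto intro!: ennreal_leI power_mono)
    also have "\<dots> = (\<Sum>k\<in>{n}. ?a k * indicator (ball 0 (real k + 1)) z)"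
      by (simp only: sum.insert sum.empty finite.emptyI empty_iff add_0_right not_False_eq_True)
    also have "\<dots> \<le> (\<Sum>n. ?a n * indicator (ball 0 (real n + 1)) z)"
      by (rule sum_le_suminf[OF summableI]) auto
    finally show "ennreal (exp (- c * (norm z)\<^sup>2)) \<le> (\<Sum>n. ?a n * indicator (ball 0 (real n + 1)) z)" .
  qed
  also have "\<dots> = (\<Sum>n. \<integral>\<^sup>+z. ?a n * indicator (ball (0::complex) (real n + 1)) z \<partial>lborel)"
    by (intro nn_integral_suminf) measurable
  also have "\<dots> = (\<Sum>n. ennreal (exp (- c * (real n)\<^sup>2) * (pi * (real n + 1)\<^sup>2)))"
    by (intro suminf_cong) (simp add: nn_integral_cmult_indicator measure_ball_complex ennreal_mult)
  also have "\<dots> < \<infinity>"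
    using summable_gaussian_layers[OF c] by (subst suminf_ennreal2) auto
  finally show ?thesis .
qed

text \<open>
  The normalised reproducing kernel \<open>k\<^sub>w\<close> of the Hilbert space \<open>F\<^sup>2\<close>. Its weighted modulus is a Gaussian
  centred at \<open>w\<close>, so its norms do not depend on \<open>w\<close>.
\<close>

definition fock_kernel :: "real \<Rightarrow> complex \<Rightarrow> complex \<Rightarrow> complex" where
  "fock_kernel \<alpha> w \<zeta> = exp (of_real \<alpha> * (\<zeta> * cnj w - of_real ((norm w)\<^sup>2 / 2)))"

lemma norm_fock_kernel: "norm (fock_kernel \<alpha> w \<zeta>) = exp (\<alpha> * (Re (\<zeta> * cnj w) - (norm w)\<^sup>2 / 2))"
  by (simp add: fock_kernel_def)

lemma fock_mod_kernel: "fock_mod \<alpha> (fock_kernel \<alpha> w) \<zeta> = exp (- (\<alpha> / 2) * (norm (\<zeta> - w))\<^sup>2)"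
proof -
  have "(norm (\<zeta> - w))\<^sup>2 = (norm \<zeta>)\<^sup>2 + (norm w)\<^sup>2 - 2 * Re (\<zeta> * cnj w)"
    unfolding cmod_power2 by (simp add: power2_eq_square algebra_simps)
  then have n: "(norm (\<zeta> - w))\<^sup>2 = (norm \<zeta>)\<^sup>2 + (norm w)\<^sup>2 - 2 * Re (\<zeta> * cnj w)" .
  have "\<alpha> * (Re (\<zeta> * cnj w) - (norm w)\<^sup>2 / 2) + - (\<alpha> / 2) * (norm \<zeta>)\<^sup>2 = - (\<alpha> / 2) * (norm (\<zeta> - w))\<^sup>2"
    unfolding n by (simp add: field_simps)
  then show ?thesis
    unfolding fock_mod_def norm_fock_kernel mult_exp_exp by (rule arg_cong)
qed

lemma holomorphic_fock_kernel: "fock_kernel \<alpha> w holomorphic_on A"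
  unfolding fock_kernel_def by (intro holomorphic_intros)

lemma fock_norm_kernel_bounded:
  assumes p: "0 < p" and \<alpha>: "0 < \<alpha>"
  obtains K :: real where "0 < K" "\<And>w. fock_norm p \<alpha> (fock_kernel \<alpha> w) \<le> ennreal K"
proof -
  let ?g = "\<lambda>z::complex. ennreal (exp (- (p * \<alpha> / 2) * (norm z)\<^sup>2))"
  define I where "I = (\<integral>\<^sup>+z. ?g z \<partial>lborel)"
  have I: "I < \<infinity>" unfolding I_def using p \<alpha> by (intro gaussian_integral_finite) simp
  define X where "X = ennreal_powr (ennreal (p * \<alpha> / (2 * pi)) * I) (1 / p)"
  have X: "X < \<infinity>" unfolding X_def ennreal_powr_less_top_iff using I by (simp add: ennreal_mult_less_top)
  have gm [measurable]: "?g \<in> borel_measurable borel"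
    by (intro measurable_compose[OF _ measurable_ennreal] borel_measurable_continuous_onI continuous_intros)
  have "fock_norm p \<alpha> (fock_kernel \<alpha> w) = X" for w
  proof -
    have "(\<integral>\<^sup>+z. ennreal (fock_mod \<alpha> (fock_kernel \<alpha> w) z powr p) \<partial>lborel) = (\<integral>\<^sup>+z. ?g (- w + z) \<partial>lborel)"
      by (intro nn_integral_cong) (simp add: fock_mod_kernel powr_def mult_ac)
    also have "\<dots> = I"
      unfolding I_def by (rule nn_integral_lborel_translate[OF gm])
    finally show ?thesis by (simp add: fock_norm_eq X_def)
  qed
  then show thesis
    using X by (intro that[of "enn2real X + 1"]) (auto simp: ennreal_plus less_top intro: add_increasing2 add_nonneg_pos)
qed

text \<open>
  The weighted modulus of \<open>k\<^sub>w\<close> at \<open>\<zeta>\<close> is bounded below for \<open>w\<close> in the unit disc about \<open>\<zeta>\<close>. In the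
  sub-mean value property the weight \<open>exp (\<alpha> |\<zeta>|\<^sup>2 / 2)\<close> may therefore be replaced by \<open>|k\<^sub>w \<zeta>|\<close>, and the
  average over the disc may be enlarged to the plane.
\<close>

lemma norm_powr_le_kernel_average:
  assumes q: "0 < q" and \<alpha>: "0 < \<alpha>"
  obtains C :: real where "0 < C"
    "\<And>f \<zeta>. f holomorphic_on UNIV \<Longrightarrow> ennreal (norm (f \<zeta>) powr q)
      \<le> ennreal C * (\<integral>\<^sup>+w. ennreal (fock_mod \<alpha> f w powr q) * ennreal (norm (fock_kernel \<alpha> w \<zeta>) powr q) \<partial>lborel)"
proof -
  obtain C :: real where C: "0 < C"
    "\<And>f z. f holomorphic_on UNIV \<Longrightarrow> ennreal (fock_mod \<alpha> f z powr q)
      \<le> ennreal C * (\<integral>\<^sup>+w\<in>ball z 1. ennreal (fock_mod \<alpha> f w powr q) \<partial>lborel)"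
    using fock_mod_powr_sub_mean_value[OF q \<alpha>] by blast
  define K where "K = exp (\<alpha> / 2) powr q"
  have K: "0 < K" by (simp add: K_def)
  show thesis
  proof (rule that)
    show "0 < C * K" using C(1) K by simp
    fix f and \<zeta> :: complex assume f: "f holomorphic_on UNIV"
    note [measurable] = borel_measurable_entire[OF f]
    define E where "E = exp (\<alpha> / 2 * (norm \<zeta>)\<^sup>2)"
    have E: "0 < E" by (simp add: E_def)
    have km: "(\<lambda>w. ennreal (norm (fock_kernel \<alpha> w \<zeta>) powr q)) \<in> borel_measurable borel"
      unfolding norm_fock_kernel powr_def
      by (intro measurable_compose[OF _ measurable_ennreal] borel_measurable_continuous_onI) (auto intro!: continuous_intros)
    have kb: "E powr q \<le> K * norm (fock_kernel \<alpha> w \<zeta>) powr q" if w: "w \<in> ball \<zeta> 1" for w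
    proof -
      have "(norm (\<zeta> - w))\<^sup>2 \<le> 1"
        using w by (simp add: dist_norm abs_square_le_1)
      then have "exp (- (\<alpha> / 2)) \<le> fock_mod \<alpha> (fock_kernel \<alpha> w) \<zeta>"
        unfolding fock_mod_kernel using \<alpha> by simp
      then have e1: "exp (- (\<alpha> / 2)) * (exp (\<alpha> / 2) * E) \<le> fock_mod \<alpha> (fock_kernel \<alpha> w) \<zeta> * (exp (\<alpha> / 2) * E)"
        using E by (intro mult_right_mono) auto
      have e2: "exp (- (\<alpha> / 2)) * (exp (\<alpha> / 2) * E) = E"
        by (simp add: mult.assoc[symmetric] mult_exp_exp)
      have e3: "fock_mod \<alpha> (fock_kernel \<alpha> w) \<zeta> * (exp (\<alpha> / 2) * E)
          = norm (fock_kernel \<alpha> w \<zeta>) * exp (\<alpha> / 2) * (exp (- (\<alpha> / 2) * (norm \<zeta>)\<^sup>2) * E)"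
        by (simp add: fock_mod_def)
      have e4: "exp (- (\<alpha> / 2) * (norm \<zeta>)\<^sup>2) * E = 1"
        by (simp add: E_def mult_exp_exp)
      have "E \<le> exp (\<alpha> / 2) * norm (fock_kernel \<alpha> w \<zeta>)"
        using e1 unfolding e2 e3 e4 by (simp add: mult.commute)
      then have "E powr q \<le> (exp (\<alpha> / 2) * norm (fock_kernel \<alpha> w \<zeta>)) powr q"
        using q E by (intro powr_mono2) auto
      then show ?thesis by (simp add: powr_mult K_def)
    qed
    have "norm (f \<zeta>) = E * fock_mod \<alpha> f \<zeta>"
      by (simp add: E_def fock_mod_def mult_exp_exp)
    then have "ennreal (norm (f \<zeta>) powr q) = ennreal (E powr q) * ennreal (fock_mod \<alpha> f \<zeta> powr q)"
      using E by (simp add: powr_mult ennreal_mult)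
    also have "\<dots> \<le> ennreal (E powr q) * (ennreal C * (\<integral>\<^sup>+w\<in>ball \<zeta> 1. ennreal (fock_mod \<alpha> f w powr q) \<partial>lborel))"
      by (intro mult_left_mono C(2) f) simp
    also have "\<dots> = ennreal C * (\<integral>\<^sup>+w. ennreal (E powr q) * (ennreal (fock_mod \<alpha> f w powr q) * indicator (ball \<zeta> 1) w) \<partial>lborel)"
      by (subst nn_integral_cmult) (auto simp: mult_ac)
    also have "\<dots> \<le> ennreal C * (\<integral>\<^sup>+w. ennreal K *
        (ennreal (fock_mod \<alpha> f w powr q) * ennreal (norm (fock_kernel \<alpha> w \<zeta>) powr q)) \<partial>lborel)"
    proof (intro mult_left_mono nn_integral_mono)
      fix w
      have "E powr q * fock_mod \<alpha> f w powr q \<le> K * (fock_mod \<alpha> f w powr q * norm (fock_kernel \<alpha> w \<zeta>) powr q)" if "w \<in> ball \<zeta> 1"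
        using mult_right_mono[OF kb[OF that], of "fock_mod \<alpha> f w powr q"] by (simp add: mult_ac)
      then show "ennreal (E powr q) * (ennreal (fock_mod \<alpha> f w powr q) * indicator (ball \<zeta> 1) w)
        \<le> ennreal K * (ennreal (fock_mod \<alpha> f w powr q) * ennreal (norm (fock_kernel \<alpha> w \<zeta>) powr q))"
        using K by (auto simp: indicator_def ennreal_mult[symmetric] intro!: ennreal_leI)
    qed auto
    also have "\<dots> = ennreal (C * K) * (\<integral>\<^sup>+w. ennreal (fock_mod \<alpha> f w powr q) * ennreal (norm (fock_kernel \<alpha> w \<zeta>) powr q) \<partial>lborel)"
    proof -
      have "(\<lambda>w. ennreal (fock_mod \<alpha> f w powr q) * ennreal (norm (fock_kernel \<alpha> w \<zeta>) powr q)) \<in> borel_measurable lborel"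
        using km by measurable
      from nn_integral_cmult[OF this] show ?thesis
        using C(1) K by (simp add: ennreal_mult mult.assoc)
    qed
    finally show "ennreal (norm (f \<zeta>) powr q) \<le> ennreal (C * K) *
      (\<integral>\<^sup>+w. ennreal (fock_mod \<alpha> f w powr q) * ennreal (norm (fock_kernel \<alpha> w \<zeta>) powr q) \<partial>lborel)" .
  qed
qed

text \<open>
  The density of the measure \<open>\<mu>\<close> for which the norm of \<open>V\<^sub>(\<^sub>g\<^sub>,\<^sub>\<psi>\<^sub>) f\<close> is comparable to the \<open>L\<^sup>q\<close> norm
  of \<open>f \<circ> \<psi>\<close>.
\<close>

definition volterra_density :: "real \<Rightarrow> real \<Rightarrow> (complex \<Rightarrow> complex) \<Rightarrow> complex \<Rightarrow> real" where
  "volterra_density q \<alpha> g z = (fock_mod \<alpha> (deriv g) z / (1 + norm z)) powr q"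

lemma volterra_density_nonneg [simp]: "0 \<le> volterra_density q \<alpha> g z"
  by (simp add: volterra_density_def)

lemma borel_measurable_volterra_density:
  assumes g: "g holomorphic_on UNIV"
  shows "volterra_density q \<alpha> g \<in> borel_measurable borel"
proof -
  note [measurable] = borel_measurable_entire[OF holomorphic_deriv_UNIV[OF g]]
  show ?thesis unfolding volterra_density_def[abs_def] by measurable
qed

lemma fock_mod_volterra_derivative:
  "(fock_mod \<alpha> (\<lambda>z. f (\<psi> z) * deriv g z) z / (1 + norm z)) powr q
    = norm (f (\<psi> z)) powr q * volterra_density q \<alpha> g z"
proof -
  have "fock_mod \<alpha> (\<lambda>z. f (\<psi> z) * deriv g z) z / (1 + norm z)
      = norm (f (\<psi> z)) * (fock_mod \<alpha> (deriv g) z / (1 + norm z))"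
    by (simp add: fock_mod_def norm_mult)
  then show ?thesis
    unfolding volterra_density_def by (simp only: powr_mult)
qed

text \<open>
  The Berezin transform is the integral of \<open>|k\<^sub>w \<circ> \<psi>|\<^sup>q\<close> against \<open>\<mu>\<close>.
\<close>

lemma berezin_transform_eq:
  "berezin_transform q \<alpha> \<psi> g w
    = (\<integral>\<^sup>+z. ennreal (norm (fock_kernel \<alpha> w (\<psi> z)) powr q * volterra_density q \<alpha> g z) \<partial>lborel)"
  unfolding berezin_transform_def
proof (intro nn_integral_cong arg_cong[where f = ennreal])
  fix z
  have "volterra_density q \<alpha> g z
      = norm (deriv g z) powr q * exp (- (q * \<alpha> / 2) * (norm z)\<^sup>2) / (1 + norm z) powr q"
    unfolding volterra_density_def fock_mod_powr[symmetric] by (rule powr_divide)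
  moreover have "norm (fock_kernel \<alpha> w (\<psi> z)) powr q = exp (q * (\<alpha> * (Re (\<psi> z * cnj w) - (norm w)\<^sup>2 / 2)))"
    by (simp add: norm_fock_kernel powr_def)
  moreover have "exp (q * \<alpha> / 2 * (2 * Re (\<psi> z * cnj w) - (norm z)\<^sup>2 - (norm w)\<^sup>2))
      = exp (q * (\<alpha> * (Re (\<psi> z * cnj w) - (norm w)\<^sup>2 / 2))) * exp (- (q * \<alpha> / 2) * (norm z)\<^sup>2)"
    unfolding mult_exp_exp by (rule arg_cong[where f = exp]) (simp add: field_simps)
  ultimately show "exp (q * \<alpha> / 2 * (2 * Re (\<psi> z * cnj w) - (norm z)\<^sup>2 - (norm w)\<^sup>2)) *
      (norm (deriv g z) powr q / (1 + norm z) powr q)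
    = norm (fock_kernel \<alpha> w (\<psi> z)) powr q * volterra_density q \<alpha> g z"
    by simp
qed

lemma borel_measurable_berezin_integrand:
  assumes \<psi>: "\<psi> holomorphic_on UNIV" and g: "g holomorphic_on UNIV"
  shows "(\<lambda>(z, w). ennreal (norm (fock_kernel \<alpha> w (\<psi> z)) powr q * volterra_density q \<alpha> g z))
    \<in> borel_measurable (lborel \<Otimes>\<^sub>M lborel)"
proof -
  have "continuous_on UNIV (\<lambda>x. \<psi> (fst x))"
    by (rule continuous_on_compose2[OF holomorphic_UNIV_continuous[OF \<psi>]]) (auto intro!: continuous_intros)
  then have "continuous_on UNIV (\<lambda>x::complex \<times> complex. fock_kernel \<alpha> (snd x) (\<psi> (fst x)))"
    unfolding fock_kernel_def by (intro continuous_intros) auto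
  then have "(\<lambda>x::complex \<times> complex. fock_kernel \<alpha> (snd x) (\<psi> (fst x))) \<in> borel_measurable borel"
    by (rule borel_measurable_continuous_onI)
  then have [measurable]: "(\<lambda>x. fock_kernel \<alpha> (snd x) (\<psi> (fst x))) \<in> borel_measurable (lborel \<Otimes>\<^sub>M lborel)"
    by (simp add: lborel_prod)
  note [measurable] = borel_measurable_volterra_density[OF g]
  show ?thesis
    unfolding case_prod_beta by measurable
qed

lemma borel_measurable_berezin_transform:
  assumes \<psi>: "\<psi> holomorphic_on UNIV" and g: "g holomorphic_on UNIV"
  shows "berezin_transform q \<alpha> \<psi> g \<in> borel_measurable borel"
proof -
  have "(\<lambda>(w, z). ennreal (norm (fock_kernel \<alpha> w (\<psi> z)) powr q * volterra_density q \<alpha> g z))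
      \<in> borel_measurable (lborel \<Otimes>\<^sub>M lborel)"
    using measurable_compose[OF measurable_pair_swap' borel_measurable_berezin_integrand[OF assms]]
    by (simp add: case_prod_beta)
  from lborel.borel_measurable_nn_integral[OF this] show ?thesis
    unfolding berezin_transform_eq[abs_def] by simp
qed

text \<open>
  Integrate the kernel average at \<open>\<zeta> = \<psi> z\<close> against \<open>\<mu>\<close> and interchange the integrals: the inner
  integral over \<open>z\<close> is the Berezin transform.
\<close>

lemma volterra_integral_le_berezin_integral:
  assumes q: "0 < q" and \<alpha>: "0 < \<alpha>"
  obtains C :: real where "0 < C"
    "\<And>f \<psi> g. f holomorphic_on UNIV \<Longrightarrow> \<psi> holomorphic_on UNIV \<Longrightarrow> g holomorphic_on UNIV \<Longrightarrow>
      (\<integral>\<^sup>+z. ennreal (norm (f (\<psi> z)) powr q * volterra_density q \<alpha> g z) \<partial>lborel)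
      \<le> ennreal C * (\<integral>\<^sup>+w. ennreal (fock_mod \<alpha> f w powr q) * berezin_transform q \<alpha> \<psi> g w \<partial>lborel)"
proof -
  obtain C :: real where C: "0 < C"
    "\<And>f \<zeta>. f holomorphic_on UNIV \<Longrightarrow> ennreal (norm (f \<zeta>) powr q)
      \<le> ennreal C * (\<integral>\<^sup>+w. ennreal (fock_mod \<alpha> f w powr q) * ennreal (norm (fock_kernel \<alpha> w \<zeta>) powr q) \<partial>lborel)"
    using norm_powr_le_kernel_average[OF q \<alpha>] by blast
  show thesis
  proof (rule that[OF C(1)])
    fix f \<psi> g :: "complex \<Rightarrow> complex"
    assume f: "f holomorphic_on UNIV" and \<psi>: "\<psi> holomorphic_on UNIV" and g: "g holomorphic_on UNIV"
    note [measurable] = borel_measurable_entire[OF f] borel_measurable_volterra_density[OF g]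
    let ?m = "\<lambda>w. ennreal (fock_mod \<alpha> f w powr q)"
    let ?k = "\<lambda>z w. ennreal (norm (fock_kernel \<alpha> w (\<psi> z)) powr q * volterra_density q \<alpha> g z)"
    note [measurable] = borel_measurable_berezin_integrand[OF \<psi> g]
    have joint: "(\<lambda>(z, w). ?m w * ?k z w) \<in> borel_measurable (lborel \<Otimes>\<^sub>M lborel)"
    proof -
      have "(\<lambda>x. ?m (snd x) * (case x of (z, w) \<Rightarrow> ?k z w)) \<in> borel_measurable (lborel \<Otimes>\<^sub>M lborel)"
        by measurable
      then show ?thesis by (simp add: case_prod_beta)
    qed
    have km: "(\<lambda>w. ?k z w) \<in> borel_measurable lborel" for z
      using measurable_compose_Pair1[OF _ borel_measurable_berezin_integrand[OF \<psi> g, of \<alpha> q], of z] by simp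
    have kz: "(\<lambda>z. ?k z w) \<in> borel_measurable lborel" for w
      using measurable_Pair_compose_split[OF borel_measurable_berezin_integrand[OF \<psi> g, of \<alpha> q], of "\<lambda>z. z" lborel "\<lambda>_. w"]
      by simp
    have kern: "(\<lambda>w. ennreal (norm (fock_kernel \<alpha> w \<zeta>) powr q)) \<in> borel_measurable borel" for \<zeta>
      unfolding norm_fock_kernel powr_def
      by (intro measurable_compose[OF _ measurable_ennreal] borel_measurable_continuous_onI) (auto intro!: continuous_intros)
    have "(\<integral>\<^sup>+z. ennreal (norm (f (\<psi> z)) powr q * volterra_density q \<alpha> g z) \<partial>lborel)
        \<le> (\<integral>\<^sup>+z. ennreal C * (\<integral>\<^sup>+w. ?m w * ?k z w \<partial>lborel) \<partial>lborel)"
    proof (rule nn_integral_mono)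
      fix z :: complex
      have "ennreal (norm (f (\<psi> z)) powr q * volterra_density q \<alpha> g z)
          = ennreal (norm (f (\<psi> z)) powr q) * ennreal (volterra_density q \<alpha> g z)"
        by (simp add: ennreal_mult)
      also have "\<dots> \<le> (ennreal C * (\<integral>\<^sup>+w. ?m w * ennreal (norm (fock_kernel \<alpha> w (\<psi> z)) powr q) \<partial>lborel))
          * ennreal (volterra_density q \<alpha> g z)"
        by (intro mult_right_mono C(2) f) simp
      also have "\<dots> = ennreal C * ((\<integral>\<^sup>+w. ?m w * ennreal (norm (fock_kernel \<alpha> w (\<psi> z)) powr q) \<partial>lborel)
          * ennreal (volterra_density q \<alpha> g z))"
        by (simp add: mult.assoc)
      also have "(\<integral>\<^sup>+w. ?m w * ennreal (norm (fock_kernel \<alpha> w (\<psi> z)) powr q) \<partial>lborel) * ennreal (volterra_density q \<alpha> g z)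
          = (\<integral>\<^sup>+w. ?m w * ennreal (norm (fock_kernel \<alpha> w (\<psi> z)) powr q) * ennreal (volterra_density q \<alpha> g z) \<partial>lborel)"
        by (rule nn_integral_multc[symmetric]) (use kern in measurable)
      also have "\<dots> = (\<integral>\<^sup>+w. ?m w * ?k z w \<partial>lborel)"
        by (simp add: ennreal_mult mult.assoc)
      finally show "ennreal (norm (f (\<psi> z)) powr q * volterra_density q \<alpha> g z) \<le> ennreal C * (\<integral>\<^sup>+w. ?m w * ?k z w \<partial>lborel)" .
    qed
    also have "\<dots> = ennreal C * (\<integral>\<^sup>+z. (\<integral>\<^sup>+w. ?m w * ?k z w \<partial>lborel) \<partial>lborel)"
      by (intro nn_integral_cmult lborel.borel_measurable_nn_integral joint)
    also have "(\<integral>\<^sup>+z. (\<integral>\<^sup>+w. ?m w * ?k z w \<partial>lborel) \<partial>lborel) = (\<integral>\<^sup>+w. (\<integral>\<^sup>+z. ?m w * ?k z w \<partial>lborel) \<partial>lborel)"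
      by (rule lborel_pair.Fubini'[OF joint, symmetric])
    also have "\<dots> = (\<integral>\<^sup>+w. ?m w * berezin_transform q \<alpha> \<psi> g w \<partial>lborel)"
      unfolding berezin_transform_eq by (intro nn_integral_cong nn_integral_cmult kz)
    finally show "(\<integral>\<^sup>+z. ennreal (norm (f (\<psi> z)) powr q * volterra_density q \<alpha> g z) \<partial>lborel)
      \<le> ennreal C * (\<integral>\<^sup>+w. ?m w * berezin_transform q \<alpha> \<psi> g w \<partial>lborel)" .
  qed
qed

section \<open>Boundedness of the Volterra operator\<close>

lemma volterra_comp_primitive:
  assumes f: "f holomorphic_on UNIV" and \<psi>: "\<psi> holomorphic_on UNIV" and g: "g holomorphic_on UNIV"
  shows "(volterra_comp g \<psi> f has_field_derivative f (\<psi> z) * deriv g z) (at z)"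
    and "volterra_comp g \<psi> f 0 = 0"
    and "volterra_comp g \<psi> f holomorphic_on UNIV"
    and "deriv (volterra_comp g \<psi> f) = (\<lambda>z. f (\<psi> z) * deriv g z)"
proof -
  have "(f \<circ> \<psi>) holomorphic_on UNIV"
    by (rule holomorphic_on_compose[OF \<psi> holomorphic_on_subset[OF f]]) simp
  then have h: "(\<lambda>w. f (\<psi> w) * deriv g w) holomorphic_on UNIV"
    using holomorphic_deriv_UNIV[OF g] by (auto simp: o_def intro: holomorphic_on_mult)
  obtain P where P: "\<And>w. (P has_field_derivative f (\<psi> w) * deriv g w) (at w)"
    using holomorphic_convex_primitive'[OF convex_UNIV open_UNIV h] by auto
  have eq: "volterra_comp g \<psi> f w = P w - P 0" for w
    unfolding volterra_comp_def
    using contour_integral_primitive[of UNIV P "\<lambda>w. f (\<psi> w) * deriv g w" "linepath 0 w"] P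
    by (auto intro!: contour_integral_unique)
  have V: "volterra_comp g \<psi> f = (\<lambda>w. P w - P 0)" using eq by blast
  show d: "(volterra_comp g \<psi> f has_field_derivative f (\<psi> z) * deriv g z) (at z)" for z
    unfolding V by (auto intro!: derivative_eq_intros P)
  show "volterra_comp g \<psi> f 0 = 0" by (simp add: V)
  show "volterra_comp g \<psi> f holomorphic_on UNIV"
    using d by (auto simp: holomorphic_on_open)
  show "deriv (volterra_comp g \<psi> f) = (\<lambda>z. f (\<psi> z) * deriv g z)"
    using d by (intro ext DERIV_imp_deriv)
qed

text \<open>
  Characterises the operator by an initial value problem, from which its linearity is immediate.
\<close>

lemma volterra_comp_unique:
  assumes f: "f holomorphic_on UNIV" and \<psi>: "\<psi> holomorphic_on UNIV" and g: "g holomorphic_on UNIV"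
    and W: "\<And>z. (W has_field_derivative f (\<psi> z) * deriv g z) (at z)" and W0: "W 0 = 0"
  shows "volterra_comp g \<psi> f = W"
proof
  fix z
  have "((\<lambda>z. volterra_comp g \<psi> f z - W z) has_field_derivative 0) (at z within UNIV)" for z
    using volterra_comp_primitive(1)[OF f \<psi> g, of z] W[of z] by (auto intro!: derivative_eq_intros)
  then obtain c where c: "\<And>z. volterra_comp g \<psi> f z - W z = c"
    using has_field_derivative_zero_constant[of UNIV "\<lambda>z. volterra_comp g \<psi> f z - W z"] by auto
  have "c = 0" using c[of 0] W0 volterra_comp_primitive(2)[OF f \<psi> g] by simp
  then show "volterra_comp g \<psi> f z = W z" using c[of z] by simp
qed

lemma volterra_comp_diff:
  assumes "f1 holomorphic_on UNIV" "f2 holomorphic_on UNIV" "\<psi> holomorphic_on UNIV" "g holomorphic_on UNIV"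
  shows "volterra_comp g \<psi> (\<lambda>z. f1 z - f2 z) = (\<lambda>z. volterra_comp g \<psi> f1 z - volterra_comp g \<psi> f2 z)"
  using assms
  by (intro volterra_comp_unique)
    (auto intro!: holomorphic_on_diff derivative_eq_intros volterra_comp_primitive simp: volterra_comp_primitive(2) left_diff_distrib)

lemma volterra_comp_cmult:
  assumes "f holomorphic_on UNIV" "\<psi> holomorphic_on UNIV" "g holomorphic_on UNIV"
  shows "volterra_comp g \<psi> (\<lambda>z. c * f z) = (\<lambda>z. c * volterra_comp g \<psi> f z)"
  using assms
  by (intro volterra_comp_unique)
    (auto intro!: holomorphic_on_mult derivative_eq_intros volterra_comp_primitive simp: volterra_comp_primitive(2))

lemma fock_norm_cmult:
  assumes q: "0 < q" and f: "f holomorphic_on UNIV"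
  shows "fock_norm q \<alpha> (\<lambda>z. c * f z) = ennreal (norm c) * fock_norm q \<alpha> f"
proof -
  note [measurable] = borel_measurable_entire[OF f]
  have "(\<integral>\<^sup>+z. ennreal (fock_mod \<alpha> (\<lambda>z. c * f z) z powr q) \<partial>lborel)
      = (\<integral>\<^sup>+z. ennreal (norm c powr q) * ennreal (fock_mod \<alpha> f z powr q) \<partial>lborel)"
  proof (rule nn_integral_cong)
    fix z
    have "fock_mod \<alpha> (\<lambda>z. c * f z) z = norm c * fock_mod \<alpha> f z"
      by (simp add: fock_mod_def norm_mult)
    then show "ennreal (fock_mod \<alpha> (\<lambda>z. c * f z) z powr q) = ennreal (norm c powr q) * ennreal (fock_mod \<alpha> f z powr q)"
      by (simp add: powr_mult ennreal_mult)
  qed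
  also have "\<dots> = ennreal (norm c powr q) * (\<integral>\<^sup>+z. ennreal (fock_mod \<alpha> f z powr q) \<partial>lborel)"
    by (intro nn_integral_cmult) measurable
  finally show ?thesis
    unfolding fock_norm_eq using q
    by (simp add: ennreal_powr_mult ennreal_powr_ennreal powr_powr mult_ac)
qed

lemma fock_norm_volterra_comp_le:
  assumes q: "0 < q" and \<alpha>: "0 < \<alpha>"
  obtains C :: real where "0 < C"
    "\<And>f \<psi> g. f holomorphic_on UNIV \<Longrightarrow> \<psi> holomorphic_on UNIV \<Longrightarrow> g holomorphic_on UNIV \<Longrightarrow>
      fock_norm q \<alpha> (volterra_comp g \<psi> f) \<le> ennreal C *
        ennreal_powr (\<integral>\<^sup>+z. ennreal (norm (f (\<psi> z)) powr q * volterra_density q \<alpha> g z) \<partial>lborel) (1 / q)"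
proof -
  obtain A :: real where A: "0 < A"
    "\<And>F. F holomorphic_on UNIV \<Longrightarrow> F 0 = 0 \<Longrightarrow>
      (\<integral>\<^sup>+z. ennreal (fock_mod \<alpha> F z powr q) \<partial>lborel)
      \<le> ennreal A * (\<integral>\<^sup>+z. ennreal ((fock_mod \<alpha> (deriv F) z / (1 + norm z)) powr q) \<partial>lborel)"
    using fock_integral_le_derivative_integral[OF q \<alpha>] by blast
  show thesis
  proof (rule that)
    show "0 < (q * \<alpha> / (2 * pi) * A) powr (1 / q)" using A(1) q \<alpha> by simp
    fix f \<psi> g :: "complex \<Rightarrow> complex"
    assume f: "f holomorphic_on UNIV" and \<psi>: "\<psi> holomorphic_on UNIV" and g: "g holomorphic_on UNIV"
    let ?V = "volterra_comp g \<psi> f"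
    note V = volterra_comp_primitive[OF f \<psi> g]
    define J where "J = (\<integral>\<^sup>+z. ennreal (norm (f (\<psi> z)) powr q * volterra_density q \<alpha> g z) \<partial>lborel)"
    have J: "J = (\<integral>\<^sup>+z. ennreal ((fock_mod \<alpha> (deriv ?V) z / (1 + norm z)) powr q) \<partial>lborel)"
      unfolding J_def V(4) fock_mod_volterra_derivative ..
    have "fock_norm q \<alpha> ?V \<le> ennreal_powr (ennreal (q * \<alpha> / (2 * pi)) * (ennreal A * J)) (1 / q)"
      unfolding fock_norm_eq J using q by (intro ennreal_powr_mono mult_left_mono A(2) V) auto
    also have "ennreal (q * \<alpha> / (2 * pi)) * (ennreal A * J) = ennreal (q * \<alpha> / (2 * pi) * A) * J"
      using q \<alpha> A(1) by (subst ennreal_mult) (auto simp: mult.assoc)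
    also have "ennreal_powr \<dots> (1 / q) = ennreal ((q * \<alpha> / (2 * pi) * A) powr (1 / q)) * ennreal_powr J (1 / q)"
      using q \<alpha> A(1) by (simp add: ennreal_powr_mult ennreal_powr_ennreal)
    finally show "fock_norm q \<alpha> ?V \<le> ennreal ((q * \<alpha> / (2 * pi) * A) powr (1 / q)) *
        ennreal_powr (\<integral>\<^sup>+z. ennreal (norm (f (\<psi> z)) powr q * volterra_density q \<alpha> g z) \<partial>lborel) (1 / q)"
      unfolding J_def .
  qed
qed

lemma berezin_le_volterra_kernel:
  assumes q: "0 < q" and \<alpha>: "0 < \<alpha>"
  obtains C :: real where "0 < C"
    "\<And>\<psi> g w. \<psi> holomorphic_on UNIV \<Longrightarrow> g holomorphic_on UNIV \<Longrightarrow>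
      ennreal_powr (berezin_transform q \<alpha> \<psi> g w) (1 / q)
        \<le> ennreal C * fock_norm q \<alpha> (volterra_comp g \<psi> (fock_kernel \<alpha> w))"
proof -
  obtain B :: real where B: "0 < B"
    "\<And>F. F holomorphic_on UNIV \<Longrightarrow>
      (\<integral>\<^sup>+z. ennreal ((fock_mod \<alpha> (deriv F) z / (1 + norm z)) powr q) \<partial>lborel)
      \<le> ennreal B * (\<integral>\<^sup>+z. ennreal (fock_mod \<alpha> F z powr q) \<partial>lborel)"
    using fock_derivative_integral_le[OF q \<alpha>] by blast
  define b where "b = B * (2 * pi / (q * \<alpha>))"
  have b: "0 < b" using B(1) q \<alpha> by (simp add: b_def)
  show thesis
  proof (rule that)
    show "0 < b powr (1 / q)" using b by simp
    fix \<psi> g :: "complex \<Rightarrow> complex" and w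
    assume \<psi>: "\<psi> holomorphic_on UNIV" and g: "g holomorphic_on UNIV"
    let ?V = "volterra_comp g \<psi> (fock_kernel \<alpha> w)"
    note V = volterra_comp_primitive[OF holomorphic_fock_kernel \<psi> g]
    have "berezin_transform q \<alpha> \<psi> g w = (\<integral>\<^sup>+z. ennreal ((fock_mod \<alpha> (deriv ?V) z / (1 + norm z)) powr q) \<partial>lborel)"
      unfolding berezin_transform_eq V(4) fock_mod_volterra_derivative ..
    also have "\<dots> \<le> ennreal B * (ennreal (2 * pi / (q * \<alpha>)) * ennreal_powr (fock_norm q \<alpha> ?V) q)"
      unfolding nn_integral_fock_mod_powr[OF q \<alpha>, symmetric] by (intro B(2) V)
    also have "\<dots> = ennreal b * ennreal_powr (fock_norm q \<alpha> ?V) q"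
      unfolding b_def using B(1) q \<alpha> by (subst ennreal_mult) (auto simp: mult.assoc)
    finally have "ennreal_powr (berezin_transform q \<alpha> \<psi> g w) (1 / q)
        \<le> ennreal_powr (ennreal b * ennreal_powr (fock_norm q \<alpha> ?V) q) (1 / q)"
      using q by (intro ennreal_powr_mono) auto
    also have "\<dots> = ennreal (b powr (1 / q)) * fock_norm q \<alpha> ?V"
      using q b by (simp add: ennreal_powr_mult ennreal_powr_ennreal ennreal_powr_powr)
    finally show "ennreal_powr (berezin_transform q \<alpha> \<psi> g w) (1 / q) \<le> ennreal (b powr (1 / q)) * fock_norm q \<alpha> ?V" .
  qed
qed

lemma volterra_comp_le_berezin_integral:
  assumes q: "0 < q" and \<alpha>: "0 < \<alpha>"
  obtains C :: real where "0 < C"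
    "\<And>f \<psi> g. f holomorphic_on UNIV \<Longrightarrow> \<psi> holomorphic_on UNIV \<Longrightarrow> g holomorphic_on UNIV \<Longrightarrow>
      fock_norm q \<alpha> (volterra_comp g \<psi> f) \<le> ennreal C *
        ennreal_powr (\<integral>\<^sup>+w. ennreal (fock_mod \<alpha> f w powr q) * berezin_transform q \<alpha> \<psi> g w \<partial>lborel) (1 / q)"
proof -
  obtain A :: real where A: "0 < A"
    "\<And>f \<psi> g. f holomorphic_on UNIV \<Longrightarrow> \<psi> holomorphic_on UNIV \<Longrightarrow> g holomorphic_on UNIV \<Longrightarrow>
      fock_norm q \<alpha> (volterra_comp g \<psi> f) \<le> ennreal A *
        ennreal_powr (\<integral>\<^sup>+z. ennreal (norm (f (\<psi> z)) powr q * volterra_density q \<alpha> g z) \<partial>lborel) (1 / q)"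
    using fock_norm_volterra_comp_le[OF q \<alpha>] by blast
  obtain B :: real where B: "0 < B"
    "\<And>f \<psi> g. f holomorphic_on UNIV \<Longrightarrow> \<psi> holomorphic_on UNIV \<Longrightarrow> g holomorphic_on UNIV \<Longrightarrow>
      (\<integral>\<^sup>+z. ennreal (norm (f (\<psi> z)) powr q * volterra_density q \<alpha> g z) \<partial>lborel)
      \<le> ennreal B * (\<integral>\<^sup>+w. ennreal (fock_mod \<alpha> f w powr q) * berezin_transform q \<alpha> \<psi> g w \<partial>lborel)"
    using volterra_integral_le_berezin_integral[OF q \<alpha>] by blast
  show thesis
  proof (rule that)
    show "0 < A * B powr (1 / q)" using A(1) B(1) by simp
    fix f \<psi> g :: "complex \<Rightarrow> complex"
    assume hol: "f holomorphic_on UNIV" "\<psi> holomorphic_on UNIV" "g holomorphic_on UNIV"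
    let ?I = "\<integral>\<^sup>+w. ennreal (fock_mod \<alpha> f w powr q) * berezin_transform q \<alpha> \<psi> g w \<partial>lborel"
    have "fock_norm q \<alpha> (volterra_comp g \<psi> f) \<le> ennreal A * ennreal_powr (ennreal B * ?I) (1 / q)"
      using q by (intro order_trans[OF A(2)[OF hol]] mult_left_mono ennreal_powr_mono B(2) hol) auto
    also have "\<dots> = ennreal (A * B powr (1 / q)) * ennreal_powr ?I (1 / q)"
      using A(1) B(1) q by (simp add: ennreal_powr_mult ennreal_powr_ennreal ennreal_mult mult.assoc)
    finally show "fock_norm q \<alpha> (volterra_comp g \<psi> f) \<le> ennreal (A * B powr (1 / q)) * ennreal_powr ?I (1 / q)" .
  qed
qed

text \<open>
  The bound \<open>M\<close> is only required almost everywhere, as membership in \<open>L\<^sup>\<infinity>\<close> provides it; in the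
  norm estimate, \<open>M\<close> is the supremum of the transform.
\<close>

lemma volterra_comp_norm_bound:
  assumes p: "0 < p" and pq: "p \<le> q" and \<alpha>: "0 < \<alpha>"
  obtains C :: real where "0 < C"
    "\<And>f \<psi> g M. f holomorphic_on UNIV \<Longrightarrow> \<psi> holomorphic_on UNIV \<Longrightarrow> g holomorphic_on UNIV \<Longrightarrow>
      (AE w in lborel. berezin_transform q \<alpha> \<psi> g w \<le> M) \<Longrightarrow>
      fock_norm q \<alpha> (volterra_comp g \<psi> f) \<le> ennreal C * ennreal_powr M (1 / q) * fock_norm p \<alpha> f"
proof -
  have q: "0 < q" using p pq by simp
  obtain A :: real where A: "0 < A"
    "\<And>f \<psi> g. f holomorphic_on UNIV \<Longrightarrow> \<psi> holomorphic_on UNIV \<Longrightarrow> g holomorphic_on UNIV \<Longrightarrow>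
      fock_norm q \<alpha> (volterra_comp g \<psi> f) \<le> ennreal A *
        ennreal_powr (\<integral>\<^sup>+w. ennreal (fock_mod \<alpha> f w powr q) * berezin_transform q \<alpha> \<psi> g w \<partial>lborel) (1 / q)"
    using volterra_comp_le_berezin_integral[OF q \<alpha>] by blast
  obtain E :: real where E: "0 < E"
    "\<And>f. f holomorphic_on UNIV \<Longrightarrow> fock_norm q \<alpha> f \<le> ennreal E * fock_norm p \<alpha> f"
    using fock_norm_embedding[OF p pq \<alpha>] by blast
  define c where "c = (2 * pi / (q * \<alpha>)) powr (1 / q)"
  have c: "0 < c" using q \<alpha> by (simp add: c_def)
  show thesis
  proof (rule that)
    show "0 < A * c * E" using A(1) E(1) c by simp
    fix f \<psi> g :: "complex \<Rightarrow> complex" and M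
    assume f: "f holomorphic_on UNIV" and hol: "\<psi> holomorphic_on UNIV" "g holomorphic_on UNIV"
      and M: "AE w in lborel. berezin_transform q \<alpha> \<psi> g w \<le> M"
    note [measurable] = borel_measurable_entire[OF f]
    have "(\<integral>\<^sup>+w. ennreal (fock_mod \<alpha> f w powr q) * berezin_transform q \<alpha> \<psi> g w \<partial>lborel)
        \<le> (\<integral>\<^sup>+w. M * ennreal (fock_mod \<alpha> f w powr q) \<partial>lborel)"
      by (rule nn_integral_mono_AE) (use M in eventually_elim, auto simp: mult.commute intro: mult_right_mono)
    also have "\<dots> = M * (ennreal (2 * pi / (q * \<alpha>)) * ennreal_powr (fock_norm q \<alpha> f) q)"
      unfolding nn_integral_fock_mod_powr[OF q \<alpha>, symmetric] by (intro nn_integral_cmult) measurable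
    finally have "ennreal_powr (\<integral>\<^sup>+w. ennreal (fock_mod \<alpha> f w powr q) * berezin_transform q \<alpha> \<psi> g w \<partial>lborel) (1 / q)
        \<le> ennreal_powr (M * (ennreal (2 * pi / (q * \<alpha>)) * ennreal_powr (fock_norm q \<alpha> f) q)) (1 / q)"
      using q by (intro ennreal_powr_mono) auto
    also have "\<dots> = ennreal_powr M (1 / q) * (ennreal c * fock_norm q \<alpha> f)"
      using q \<alpha> by (simp add: ennreal_powr_mult ennreal_powr_powr ennreal_powr_ennreal c_def)
    also have "\<dots> \<le> ennreal_powr M (1 / q) * (ennreal c * (ennreal E * fock_norm p \<alpha> f))"
      by (intro mult_left_mono E(2) f) auto
    finally have "fock_norm q \<alpha> (volterra_comp g \<psi> f)
        \<le> ennreal A * (ennreal_powr M (1 / q) * (ennreal c * (ennreal E * fock_norm p \<alpha> f)))"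
      by (intro order_trans[OF A(2)[OF f hol]] mult_left_mono) auto
    also have "\<dots> = ennreal (A * c * E) * ennreal_powr M (1 / q) * fock_norm p \<alpha> f"
      using A(1) E(1) c by (simp add: ennreal_mult mult_ac)
    finally show "fock_norm q \<alpha> (volterra_comp g \<psi> f) \<le> ennreal (A * c * E) * ennreal_powr M (1 / q) * fock_norm p \<alpha> f" .
  qed
qed

lemma fock_spaceD: "f \<in> fock_space p \<alpha> \<Longrightarrow> f holomorphic_on UNIV" "f \<in> fock_space p \<alpha> \<Longrightarrow> fock_norm p \<alpha> f < \<infinity>"
  by (auto simp: fock_space_def)

text \<open>
  Used both for boundedness and, with a uniform bound on the transform, for compactness.
\<close>

lemma volterra_comp_bounded_if_berezin_AE_bounded:
  assumes p: "0 < p" and pq: "p \<le> q" and \<alpha>: "0 < \<alpha>"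
    and \<psi>: "\<psi> holomorphic_on UNIV" and g: "g holomorphic_on UNIV"
    and M: "AE w in lborel. berezin_transform q \<alpha> \<psi> g w \<le> M" "M < \<infinity>"
  shows "fock_bounded_op p q \<alpha> (volterra_comp g \<psi>)"
proof -
  obtain C :: real where C: "0 < C"
    "\<And>f \<psi> g M. f holomorphic_on UNIV \<Longrightarrow> \<psi> holomorphic_on UNIV \<Longrightarrow> g holomorphic_on UNIV \<Longrightarrow>
      (AE w in lborel. berezin_transform q \<alpha> \<psi> g w \<le> M) \<Longrightarrow>
      fock_norm q \<alpha> (volterra_comp g \<psi> f) \<le> ennreal C * ennreal_powr M (1 / q) * fock_norm p \<alpha> f"
    using volterra_comp_norm_bound[OF p pq \<alpha>] by blast
  have "ennreal_powr M (1 / q) < \<infinity>" unfolding ennreal_powr_less_top_iff by (rule M)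
  then obtain m where m: "0 \<le> m" "ennreal_powr M (1 / q) = ennreal m"
    by (cases "ennreal_powr M (1 / q)") auto
  have bd: "fock_norm q \<alpha> (volterra_comp g \<psi> f) \<le> ennreal (C * m) * fock_norm p \<alpha> f"
    if "f \<in> fock_space p \<alpha>" for f
    using C(2)[OF fock_spaceD(1)[OF that] \<psi> g M(1)] C(1) m by (simp add: ennreal_mult)
  have "volterra_comp g \<psi> f \<in> fock_space q \<alpha>" if f: "f \<in> fock_space p \<alpha>" for f
  proof -
    have "fock_norm q \<alpha> (volterra_comp g \<psi> f) < \<infinity>"
      by (rule order_le_less_trans[OF bd[OF f]]) (use fock_spaceD(2)[OF f] in \<open>simp add: ennreal_mult_less_top\<close>)
    then show ?thesis
      using volterra_comp_primitive(3)[OF fock_spaceD(1)[OF f] \<psi> g] by (simp add: fock_space_def)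
  qed
  with bd show ?thesis unfolding fock_bounded_op_def by blast
qed

lemma volterra_comp_bounded_iff:
  assumes p: "0 < p" and pq: "p \<le> q" and \<alpha>: "0 < \<alpha>"
    and \<psi>: "\<psi> holomorphic_on UNIV" and g: "g holomorphic_on UNIV"
  shows "fock_bounded_op p q \<alpha> (volterra_comp g \<psi>) \<longleftrightarrow> in_Linfty lborel (berezin_transform q \<alpha> \<psi> g)"
proof
  assume "in_Linfty lborel (berezin_transform q \<alpha> \<psi> g)"
  then show "fock_bounded_op p q \<alpha> (volterra_comp g \<psi>)"
    by (intro volterra_comp_bounded_if_berezin_AE_bounded[OF assms esssup_AE]) (simp add: in_Linfty_def)
next
  have q: "0 < q" using p pq by simp
  assume "fock_bounded_op p q \<alpha> (volterra_comp g \<psi>)"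
  then obtain N :: real where N: "\<And>f. f \<in> fock_space p \<alpha> \<Longrightarrow>
      fock_norm q \<alpha> (volterra_comp g \<psi> f) \<le> ennreal N * fock_norm p \<alpha> f"
    unfolding fock_bounded_op_def by blast
  obtain C :: real where C: "0 < C"
    "\<And>\<psi> g w. \<psi> holomorphic_on UNIV \<Longrightarrow> g holomorphic_on UNIV \<Longrightarrow>
      ennreal_powr (berezin_transform q \<alpha> \<psi> g w) (1 / q)
        \<le> ennreal C * fock_norm q \<alpha> (volterra_comp g \<psi> (fock_kernel \<alpha> w))"
    using berezin_le_volterra_kernel[OF q \<alpha>] by blast
  obtain K :: real where K: "0 < K" "\<And>w. fock_norm p \<alpha> (fock_kernel \<alpha> w) \<le> ennreal K"
    using fock_norm_kernel_bounded[OF p \<alpha>] by blast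
  define X where "X = ennreal C * (ennreal N * ennreal K)"
  have X: "X < \<infinity>" by (simp add: X_def ennreal_mult_less_top)
  have "berezin_transform q \<alpha> \<psi> g w \<le> ennreal_powr X q" for w
  proof -
    have k: "fock_kernel \<alpha> w \<in> fock_space p \<alpha>"
      unfolding fock_space_def using holomorphic_fock_kernel order_le_less_trans[OF K(2)[of w]] by simp
    have "ennreal_powr (berezin_transform q \<alpha> \<psi> g w) (1 / q) \<le> X"
      unfolding X_def
      by (intro order_trans[OF C(2)[OF \<psi> g]] mult_left_mono order_trans[OF N[OF k]] K(2)) auto
    then have "ennreal_powr (ennreal_powr (berezin_transform q \<alpha> \<psi> g w) (1 / q)) q \<le> ennreal_powr X q"
      using q by (intro ennreal_powr_mono) auto
    then show ?thesis using q by (simp add: ennreal_powr_powr)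
  qed
  then have "esssup lborel (berezin_transform q \<alpha> \<psi> g) \<le> ennreal_powr X q"
    using borel_measurable_berezin_transform[OF \<psi> g] by (intro esssup_I) auto
  also have "\<dots> < \<infinity>" unfolding ennreal_powr_less_top_iff by (rule X)
  finally show "in_Linfty lborel (berezin_transform q \<alpha> \<psi> g)"
    using borel_measurable_berezin_transform[OF \<psi> g] by (simp add: in_Linfty_def)
qed

text \<open>
  The lower bound tests the operator on \<open>k\<^sub>w / K\<close>, where the constant \<open>K\<close> bounds the norms of all \<open>k\<^sub>w\<close>.
\<close>

lemma volterra_comp_op_norm_equivalence:
  assumes p: "0 < p" and pq: "p \<le> q" and \<alpha>: "0 < \<alpha>"
  obtains C :: real where "0 < C"
    "\<And>\<psi> g. \<psi> holomorphic_on UNIV \<Longrightarrow> g holomorphic_on UNIV \<Longrightarrow>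
      fock_op_norm p q \<alpha> (volterra_comp g \<psi>)
        \<le> ennreal C * ennreal_powr (SUP w. berezin_transform q \<alpha> \<psi> g w) (1 / q)"
    "\<And>\<psi> g. \<psi> holomorphic_on UNIV \<Longrightarrow> g holomorphic_on UNIV \<Longrightarrow>
      ennreal_powr (SUP w. berezin_transform q \<alpha> \<psi> g w) (1 / q)
        \<le> ennreal C * fock_op_norm p q \<alpha> (volterra_comp g \<psi>)"
proof -
  have q: "0 < q" using p pq by simp
  obtain C :: real where C: "0 < C"
    "\<And>\<psi> g w. \<psi> holomorphic_on UNIV \<Longrightarrow> g holomorphic_on UNIV \<Longrightarrow>
      ennreal_powr (berezin_transform q \<alpha> \<psi> g w) (1 / q)
        \<le> ennreal C * fock_norm q \<alpha> (volterra_comp g \<psi> (fock_kernel \<alpha> w))"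
    using berezin_le_volterra_kernel[OF q \<alpha>] by blast
  obtain K :: real where K: "0 < K" "\<And>w. fock_norm p \<alpha> (fock_kernel \<alpha> w) \<le> ennreal K"
    using fock_norm_kernel_bounded[OF p \<alpha>] by blast
  obtain D :: real where D: "0 < D"
    "\<And>f \<psi> g M. f holomorphic_on UNIV \<Longrightarrow> \<psi> holomorphic_on UNIV \<Longrightarrow> g holomorphic_on UNIV \<Longrightarrow>
      (AE w in lborel. berezin_transform q \<alpha> \<psi> g w \<le> M) \<Longrightarrow>
      fock_norm q \<alpha> (volterra_comp g \<psi> f) \<le> ennreal D * ennreal_powr M (1 / q) * fock_norm p \<alpha> f"
    using volterra_comp_norm_bound[OF p pq \<alpha>] by blast
  show thesis
  proof (rule that)
    show "0 < D + C * K" using C(1) D(1) K(1) by (simp add: add_pos_pos)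
    fix \<psi> g :: "complex \<Rightarrow> complex"
    assume \<psi>: "\<psi> holomorphic_on UNIV" and g: "g holomorphic_on UNIV"
    let ?S = "SUP w. berezin_transform q \<alpha> \<psi> g w"
    let ?V = "volterra_comp g \<psi>"
    have "fock_op_norm p q \<alpha> ?V \<le> ennreal D * ennreal_powr ?S (1 / q)"
      unfolding fock_op_norm_def
    proof (rule SUP_least)
      fix f assume "f \<in> {f \<in> fock_space p \<alpha>. fock_norm p \<alpha> f \<le> 1}"
      then have f: "f holomorphic_on UNIV" "fock_norm p \<alpha> f \<le> 1" by (auto simp: fock_space_def)
      have "fock_norm q \<alpha> (?V f) \<le> ennreal D * ennreal_powr ?S (1 / q) * fock_norm p \<alpha> f"
        by (intro D(2) f \<psi> g AE_I2 SUP_upper) auto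
      also have "\<dots> \<le> ennreal D * ennreal_powr ?S (1 / q) * 1"
        by (intro mult_left_mono f) auto
      finally show "fock_norm q \<alpha> (?V f) \<le> ennreal D * ennreal_powr ?S (1 / q)" by simp
    qed
    also have "\<dots> \<le> ennreal (D + C * K) * ennreal_powr ?S (1 / q)"
      using C(1) K(1) by (intro mult_right_mono ennreal_leI) auto
    finally show "fock_op_norm p q \<alpha> ?V \<le> ennreal (D + C * K) * ennreal_powr ?S (1 / q)" .
    let ?N = "ennreal (C * K) * fock_op_norm p q \<alpha> ?V"
    have "berezin_transform q \<alpha> \<psi> g w \<le> ennreal_powr ?N q" for w
    proof -
      define f where "f z = of_real (1 / K) * fock_kernel \<alpha> w z" for z
      note k = holomorphic_fock_kernel[of \<alpha> w UNIV]
      have f: "f holomorphic_on UNIV" unfolding f_def by (intro holomorphic_intros k)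
      have "fock_norm p \<alpha> f = ennreal (1 / K) * fock_norm p \<alpha> (fock_kernel \<alpha> w)"
        unfolding f_def[abs_def] fock_norm_cmult[OF p k] using K(1) by (simp add: norm_divide)
      also have "\<dots> \<le> ennreal (1 / K) * ennreal K"
        by (intro mult_left_mono K(2)) simp
      also have "\<dots> = 1" using K(1) by (simp flip: ennreal_mult)
      finally have f1: "fock_norm p \<alpha> f \<le> 1" .
      have keq: "fock_kernel \<alpha> w = (\<lambda>z. of_real K * f z)" using K(1) by (auto simp: f_def)
      have "fock_norm q \<alpha> (?V (fock_kernel \<alpha> w)) = ennreal K * fock_norm q \<alpha> (?V f)"
        unfolding keq volterra_comp_cmult[OF f \<psi> g] fock_norm_cmult[OF q volterra_comp_primitive(3)[OF f \<psi> g]]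
        using K(1) by simp
      also have "\<dots> \<le> ennreal K * fock_op_norm p q \<alpha> ?V"
        unfolding fock_op_norm_def
      proof (intro mult_left_mono SUP_upper)
        show "f \<in> {f \<in> fock_space p \<alpha>. fock_norm p \<alpha> f \<le> 1}"
          using f f1 order_le_less_trans[OF f1, of \<infinity>] by (simp add: fock_space_def)
      qed simp
      finally have "ennreal_powr (berezin_transform q \<alpha> \<psi> g w) (1 / q) \<le> ennreal C * (ennreal K * fock_op_norm p q \<alpha> ?V)"
        by (intro order_trans[OF C(2)[OF \<psi> g]] mult_left_mono) auto
      also have "\<dots> = ?N" using C(1) K(1) by (simp add: ennreal_mult mult.assoc)
      finally have "ennreal_powr (ennreal_powr (berezin_transform q \<alpha> \<psi> g w) (1 / q)) q \<le> ennreal_powr ?N q"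
        using q by (intro ennreal_powr_mono) auto
      then show ?thesis using q by (simp add: ennreal_powr_powr)
    qed
    then have "?S \<le> ennreal_powr ?N q" by (intro SUP_least) auto
    then have "ennreal_powr ?S (1 / q) \<le> ennreal_powr (ennreal_powr ?N q) (1 / q)"
      using q by (intro ennreal_powr_mono) auto
    also have "\<dots> = ?N" using q by (simp add: ennreal_powr_powr)
    also have "\<dots> \<le> ennreal (D + C * K) * fock_op_norm p q \<alpha> ?V"
      using D(1) by (intro mult_right_mono ennreal_leI) auto
    finally show "ennreal_powr ?S (1 / q) \<le> ennreal (D + C * K) * fock_op_norm p q \<alpha> ?V" .
  qed
qed

section \<open>Compactness of the Volterra operator\<close>

lemma ennreal_tendsto_0_comparison:
  fixes X Y :: "'a \<Rightarrow> ennreal"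
  assumes "\<And>n. X n \<le> ennreal C * Y n" "(Y \<longlongrightarrow> 0) F"
  shows "(X \<longlongrightarrow> 0) F"
proof -
  have "((\<lambda>n. ennreal C * Y n) \<longlongrightarrow> ennreal C * 0) F"
    by (rule ennreal_tendsto_cmult[OF _ assms(2)]) simp
  then show ?thesis
    using tendsto_sandwich[of "\<lambda>_. 0" X F "\<lambda>n. ennreal C * Y n" 0] assms(1) by simp
qed

text \<open>
  On a fixed disc, \<open>k\<^sub>w\<close> tends to zero as \<open>|w|\<close> tends to infinity: the term \<open>|w|\<^sup>2 / 2\<close> in the exponent
  dominates \<open>A |w|\<close>.
\<close>

lemma norm_fock_kernel_le:
  assumes \<alpha>: "0 < \<alpha>" and \<zeta>: "norm \<zeta> \<le> A" and w: "2 * A + 2 \<le> norm w"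
  shows "norm (fock_kernel \<alpha> w \<zeta>) \<le> exp (- \<alpha> * norm w)"
proof -
  have "Re (\<zeta> * cnj w) \<le> norm (\<zeta> * cnj w)" by (rule complex_Re_le_cmod)
  also have "\<dots> = norm \<zeta> * norm w" by (simp add: norm_mult)
  also have "\<dots> \<le> (norm w / 2 - 1) * norm w"
    using \<zeta> w by (intro mult_right_mono) auto
  finally have "Re (\<zeta> * cnj w) - (norm w)\<^sup>2 / 2 \<le> - norm w"
    by (simp add: power2_eq_square algebra_simps)
  then have "\<alpha> * (Re (\<zeta> * cnj w) - (norm w)\<^sup>2 / 2) \<le> \<alpha> * (- norm w)"
    using \<alpha> by (intro mult_left_mono) auto
  then show ?thesis unfolding norm_fock_kernel by simp
qed

lemma volterra_comp_kernel_tendsto_0: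
  assumes \<alpha>: "0 < \<alpha>" and \<psi>: "\<psi> holomorphic_on UNIV" and g: "g holomorphic_on UNIV"
    and w: "filterlim w at_infinity sequentially"
  shows "(\<lambda>n. volterra_comp g \<psi> (fock_kernel \<alpha> (w n)) z) \<longlonglongrightarrow> 0"
proof -
  let ?K = "cball (0::complex) (norm z)"
  have cont: "continuous_on ?K \<psi>" "continuous_on ?K (deriv g)"
    using holomorphic_UNIV_continuous[OF \<psi>] holomorphic_UNIV_continuous[OF holomorphic_deriv_UNIV[OF g]]
    by (auto intro: continuous_on_subset)
  obtain A where A: "\<And>s. s \<in> ?K \<Longrightarrow> norm (\<psi> s) \<le> A"
    using compact_imp_bounded[OF compact_continuous_image[OF cont(1) compact_cball]] unfolding bounded_iff by blast
  obtain D where D: "\<And>s. s \<in> ?K \<Longrightarrow> norm (deriv g s) \<le> D"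
    using compact_imp_bounded[OF compact_continuous_image[OF cont(2) compact_cball]] unfolding bounded_iff by blast
  have nw: "filterlim (\<lambda>n. norm (w n)) at_top sequentially"
    using w by (rule filterlim_at_infinity_imp_norm_at_top)
  have "(\<lambda>n. exp (- \<alpha> * norm (w n)) * D * norm z) \<longlonglongrightarrow> 0 * D * norm z"
  proof (intro tendsto_intros)
    have "filterlim (\<lambda>n. - \<alpha> * norm (w n)) at_bot sequentially"
      using \<alpha> by (intro filterlim_tendsto_neg_mult_at_bot[OF tendsto_const _ nw]) simp
    then show "(\<lambda>n. exp (- \<alpha> * norm (w n))) \<longlonglongrightarrow> 0"
      by (rule filterlim_compose[OF exp_at_bot])
  qed
  then have lim: "(\<lambda>n. exp (- \<alpha> * norm (w n)) * D * norm z) \<longlonglongrightarrow> 0" by simp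
  have "eventually (\<lambda>n. 2 * A + 2 \<le> norm (w n)) sequentially"
    using nw by (simp add: filterlim_at_top)
  then have "eventually (\<lambda>n. norm (volterra_comp g \<psi> (fock_kernel \<alpha> (w n)) z) \<le> exp (- \<alpha> * norm (w n)) * D * norm z) sequentially"
  proof eventually_elim
    case (elim n)
    note V = volterra_comp_primitive[OF holomorphic_fock_kernel[of \<alpha> "w n"] \<psi> g]
    have "norm (volterra_comp g \<psi> (fock_kernel \<alpha> (w n)) z - volterra_comp g \<psi> (fock_kernel \<alpha> (w n)) 0)
      \<le> (exp (- \<alpha> * norm (w n)) * D) * norm (z - 0)"
    proof (rule field_differentiable_bound[of ?K])
      fix s assume s: "s \<in> ?K"
      show "(volterra_comp g \<psi> (fock_kernel \<alpha> (w n)) has_field_derivative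
          fock_kernel \<alpha> (w n) (\<psi> s) * deriv g s) (at s within ?K)"
        by (rule has_field_derivative_at_within[OF V(1)])
      show "norm (fock_kernel \<alpha> (w n) (\<psi> s) * deriv g s) \<le> exp (- \<alpha> * norm (w n)) * D"
        unfolding norm_mult by (intro mult_mono norm_fock_kernel_le[OF \<alpha> A[OF s] elim] D[OF s]) auto
    qed auto
    then show ?case by (simp add: V(2))
  qed
  then show ?thesis by (rule Lim_null_comparison[OF _ lim])
qed

lemma fock_norm_tendsto_0_imp_pointwise:
  assumes q: "0 < q" and \<alpha>: "0 < \<alpha>"
    and hol: "\<And>n. F n holomorphic_on UNIV" and lim: "(\<lambda>n. fock_norm q \<alpha> (F n)) \<longlonglongrightarrow> 0"
  shows "(\<lambda>n. F n z) \<longlonglongrightarrow> 0"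
proof -
  obtain C :: real where C: "0 < C"
    "\<And>f z. f holomorphic_on UNIV \<Longrightarrow> ennreal (fock_mod \<alpha> f z) \<le> ennreal C * fock_norm q \<alpha> f"
    using fock_mod_le_fock_norm[OF q \<alpha>] by blast
  have "(\<lambda>n. ennreal (fock_mod \<alpha> (F n) z)) \<longlonglongrightarrow> 0"
    by (rule ennreal_tendsto_0_comparison[OF C(2)[OF hol] lim])
  then have "(\<lambda>n. fock_mod \<alpha> (F n) z) \<longlonglongrightarrow> 0"
    using tendsto_ennreal_iff[of "\<lambda>n. fock_mod \<alpha> (F n) z" sequentially 0] by simp
  then have "(\<lambda>n. fock_mod \<alpha> (F n) z * exp (\<alpha> / 2 * (norm z)\<^sup>2)) \<longlonglongrightarrow> 0 * exp (\<alpha> / 2 * (norm z)\<^sup>2)"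
    by (rule tendsto_mult_right)
  moreover have eq: "fock_mod \<alpha> (F n) z * exp (\<alpha> / 2 * (norm z)\<^sup>2) = norm (F n z)" for n
    by (simp add: fock_mod_def mult_exp_exp)
  ultimately have "(\<lambda>n. norm (F n z)) \<longlonglongrightarrow> 0" by (simp only: eq mult_zero_left)
  then show ?thesis by (simp only: tendsto_norm_zero_iff)
qed

text \<open>
  If the transform does not vanish at infinity, there are \<open>w\<^sub>n\<close> tending to infinity at which it stays above
  some \<open>e > 0\<close>. A subsequence of \<open>V k\<^sub>w\<close> along these points converges in norm, hence pointwise, and
  its pointwise limit is zero. So the norms tend to zero, and with them the values of the transform.
\<close>

lemma fock_compact_op_imp_berezin_tendsto_0:
  assumes p: "0 < p" and q: "0 < q" and \<alpha>: "0 < \<alpha>"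
    and \<psi>: "\<psi> holomorphic_on UNIV" and g: "g holomorphic_on UNIV"
    and compact: "fock_compact_op p q \<alpha> (volterra_comp g \<psi>)"
  shows "(berezin_transform q \<alpha> \<psi> g \<longlongrightarrow> 0) at_infinity"
proof (rule ccontr)
  let ?B = "berezin_transform q \<alpha> \<psi> g"
  assume "\<not> (?B \<longlongrightarrow> 0) at_infinity"
  then obtain e :: real where e: "0 < e" "\<not> eventually (\<lambda>w. ?B w \<le> ennreal e) at_infinity"
    using ennreal_tendsto_0I[of ?B at_infinity] by blast
  have "\<exists>w. real n \<le> norm w \<and> ennreal e < ?B w" for n :: nat
    using e(2) unfolding eventually_at_infinity by (meson not_le)
  then obtain w where w: "\<And>n::nat. real n \<le> norm (w n)" "\<And>n. ennreal e < ?B (w n)" by metis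
  obtain K :: real where K: "0 < K" "\<And>w. fock_norm p \<alpha> (fock_kernel \<alpha> w) \<le> ennreal K"
    using fock_norm_kernel_bounded[OF p \<alpha>] by blast
  have k: "fock_kernel \<alpha> v \<in> fock_space p \<alpha>" for v
    unfolding fock_space_def using holomorphic_fock_kernel order_le_less_trans[OF K(2)[of v]] by simp
  have all: "\<forall>F :: nat \<Rightarrow> complex \<Rightarrow> complex.
        (\<forall>n. F n \<in> fock_space p \<alpha>) \<and> (\<exists>M::real. \<forall>n. fock_norm p \<alpha> (F n) \<le> ennreal M) \<longrightarrow>
        (\<exists>r h. strict_mono r \<and> h \<in> fock_space q \<alpha> \<and>
           (\<lambda>n. fock_norm q \<alpha> (\<lambda>z. volterra_comp g \<psi> (F (r n)) z - h z)) \<longlonglongrightarrow> 0)"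
    using compact unfolding fock_compact_op_def by simp
  obtain r :: "nat \<Rightarrow> nat" and h where r: "strict_mono r" and h: "h \<in> fock_space q \<alpha>"
    and lim: "(\<lambda>n. fock_norm q \<alpha> (\<lambda>z. volterra_comp g \<psi> (fock_kernel \<alpha> (w (r n))) z - h z)) \<longlonglongrightarrow> 0"
    using all[rule_format, of "\<lambda>n. fock_kernel \<alpha> (w n)"] k K(2) by blast
  have winf: "filterlim (\<lambda>n. w (r n)) at_infinity sequentially"
  proof (rule filterlim_norm_at_top_imp_at_infinity, rule filterlim_at_top_mono[OF filterlim_real_sequentially])
    show "eventually (\<lambda>n. real n \<le> norm (w (r n))) sequentially"
      using w(1) seq_suble[OF r] by (intro always_eventually allI) (meson of_nat_mono order_trans)
  qed
  have "h z = 0" for z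
  proof -
    have "(\<lambda>n. volterra_comp g \<psi> (fock_kernel \<alpha> (w (r n))) z - h z) \<longlonglongrightarrow> 0"
      by (rule fock_norm_tendsto_0_imp_pointwise[OF q \<alpha> _ lim])
        (intro holomorphic_on_diff volterra_comp_primitive(3) holomorphic_fock_kernel \<psi> g fock_spaceD(1)[OF h])
    moreover have "(\<lambda>n. volterra_comp g \<psi> (fock_kernel \<alpha> (w (r n))) z - h z) \<longlonglongrightarrow> 0 - h z"
      by (intro tendsto_diff volterra_comp_kernel_tendsto_0[OF \<alpha> \<psi> g winf] tendsto_const)
    ultimately have "0 = 0 - h z" by (rule LIMSEQ_unique)
    then show ?thesis by simp
  qed
  then have lim0: "(\<lambda>n. fock_norm q \<alpha> (volterra_comp g \<psi> (fock_kernel \<alpha> (w (r n))))) \<longlonglongrightarrow> 0"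
    using lim by simp
  obtain C :: real where C: "0 < C"
    "\<And>\<psi> g w. \<psi> holomorphic_on UNIV \<Longrightarrow> g holomorphic_on UNIV \<Longrightarrow>
      ennreal_powr (berezin_transform q \<alpha> \<psi> g w) (1 / q)
        \<le> ennreal C * fock_norm q \<alpha> (volterra_comp g \<psi> (fock_kernel \<alpha> w))"
    using berezin_le_volterra_kernel[OF q \<alpha>] by blast
  have "(\<lambda>n. ennreal_powr (?B (w (r n))) (1 / q)) \<longlonglongrightarrow> 0"
    by (rule ennreal_tendsto_0_comparison[OF C(2)[OF \<psi> g] lim0])
  then have "(\<lambda>n. ennreal_powr (ennreal_powr (?B (w (r n))) (1 / q)) q) \<longlonglongrightarrow> 0"
    by (rule ennreal_powr_tendsto_0[OF q])
  then have "(\<lambda>n. ?B (w (r n))) \<longlonglongrightarrow> 0"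
    using q by (simp add: ennreal_powr_powr)
  then have "eventually (\<lambda>n. ?B (w (r n)) < ennreal e) sequentially"
    using e(1) by (intro order_tendstoD) auto
  then obtain n where "?B (w (r n)) < ennreal e"
    by (auto simp: eventually_sequentially)
  with w(2)[of "r n"] show False by simp
qed

text \<open>
  For \<open>|w| \<le> R\<close>, the growth of \<open>k\<^sub>w\<close> in the direction of \<open>\<zeta>\<close> is at most \<open>exp (\<alpha> R |\<zeta>|)\<close>, and one of the
  four coherent states at distance \<open>2 R\<close> from the origin grows at least as fast.
\<close>

lemma norm_kernel_powr_le_sum:
  assumes q: "0 < q" and \<alpha>: "0 < \<alpha>" and w: "norm w \<le> R"
  shows "norm (fock_kernel \<alpha> w \<zeta>) powr q
    \<le> exp (2 * q * \<alpha> * R\<^sup>2) * (\<Sum>u\<in>{1, -1, \<i>, -\<i>}. norm (fock_kernel \<alpha> (of_real (2 * R) * u) \<zeta>) powr q)"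
proof -
  have R: "0 \<le> R" using w norm_ge_zero order_trans by blast
  obtain u where u: "u \<in> {1, -1, \<i>, -\<i>}" "norm \<zeta> / 2 \<le> Re (\<zeta> * cnj u)" by (rule exists_direction)
  have u1: "norm u = 1" using u(1) by auto
  have "Re (\<zeta> * cnj w) \<le> norm (\<zeta> * cnj w)" by (rule complex_Re_le_cmod)
  also have "\<dots> \<le> norm \<zeta> * R" using w by (simp add: norm_mult mult_left_mono)
  also have "\<dots> \<le> 2 * R * Re (\<zeta> * cnj u)"
    using mult_left_mono[OF u(2) R] by (simp add: mult_ac)
  also have "\<dots> = Re (\<zeta> * cnj (of_real (2 * R) * u))"
    by (simp add: algebra_simps)
  finally have le: "Re (\<zeta> * cnj w) \<le> Re (\<zeta> * cnj (of_real (2 * R) * u))" .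
  have "(norm (of_real (2 * R) * u))\<^sup>2 / 2 = 2 * R\<^sup>2"
    using R by (simp add: norm_mult u1 power_mult_distrib)
  moreover have "0 \<le> (norm w)\<^sup>2" by simp
  ultimately have "Re (\<zeta> * cnj w) - (norm w)\<^sup>2 / 2
      \<le> 2 * R\<^sup>2 + (Re (\<zeta> * cnj (of_real (2 * R) * u)) - (norm (of_real (2 * R) * u))\<^sup>2 / 2)"
    using le by linarith
  then have "q * \<alpha> * (Re (\<zeta> * cnj w) - (norm w)\<^sup>2 / 2)
      \<le> q * \<alpha> * (2 * R\<^sup>2 + (Re (\<zeta> * cnj (of_real (2 * R) * u)) - (norm (of_real (2 * R) * u))\<^sup>2 / 2))"
    using q \<alpha> by (intro mult_left_mono) auto
  moreover have kq: "norm (fock_kernel \<alpha> v \<zeta>) powr q = exp (q * \<alpha> * (Re (\<zeta> * cnj v) - (norm v)\<^sup>2 / 2))" for v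
    by (simp add: norm_fock_kernel powr_def)
  ultimately have "norm (fock_kernel \<alpha> w \<zeta>) powr q
      \<le> exp (q * \<alpha> * (2 * R\<^sup>2 + (Re (\<zeta> * cnj (of_real (2 * R) * u)) - (norm (of_real (2 * R) * u))\<^sup>2 / 2)))"
    by (simp only: exp_le_cancel_iff)
  also have "\<dots> = exp (2 * q * \<alpha> * R\<^sup>2) * norm (fock_kernel \<alpha> (of_real (2 * R) * u) \<zeta>) powr q"
    unfolding kq distrib_left[of _ "2 * R\<^sup>2"] exp_add by (simp add: mult_ac)
  also have "\<dots> \<le> exp (2 * q * \<alpha> * R\<^sup>2) * (\<Sum>u\<in>{1, -1, \<i>, -\<i>}. norm (fock_kernel \<alpha> (of_real (2 * R) * u) \<zeta>) powr q)"
    by (intro mult_left_mono member_le_sum u(1)) auto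
  finally show ?thesis .
qed

text \<open>
  Outside a disc the transform is at most one. Inside, it is controlled by its values at four points
  outside.
\<close>

lemma berezin_bounded_if_tendsto_0:
  assumes q: "0 < q" and \<alpha>: "0 < \<alpha>"
    and \<psi>: "\<psi> holomorphic_on UNIV" and g: "g holomorphic_on UNIV"
    and lim: "(berezin_transform q \<alpha> \<psi> g \<longlongrightarrow> 0) at_infinity"
  obtains M :: real where "0 < M" "\<And>w. berezin_transform q \<alpha> \<psi> g w \<le> ennreal M"
proof -
  let ?B = "berezin_transform q \<alpha> \<psi> g"
  have "eventually (\<lambda>w. ?B w < 1) at_infinity"
    using lim by (intro order_tendstoD) auto
  then obtain R0 where R0: "\<And>w. R0 \<le> norm w \<Longrightarrow> ?B w < 1"
    unfolding eventually_at_infinity by blast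
  define R where "R = max R0 1"
  have R: "0 < R" "R0 \<le> R" by (auto simp: R_def)
  define c where "c = exp (2 * q * \<alpha> * R\<^sup>2)"
  have c: "1 \<le> c" using q \<alpha> by (simp add: c_def)
  let ?U = "{1, -1, \<i>, -\<i>} :: complex set"
  have cardU: "card ?U = 4" by (simp add: complex_eq_iff)
  have kz: "(\<lambda>z. ennreal (norm (fock_kernel \<alpha> w (\<psi> z)) powr q * volterra_density q \<alpha> g z)) \<in> borel_measurable lborel" for w
    using measurable_Pair_compose_split[OF borel_measurable_berezin_integrand[OF \<psi> g, of \<alpha> q], of "\<lambda>z. z" lborel "\<lambda>_. w"]
    by simp
  have "?B w \<le> ennreal (c * 4)" for w
  proof (cases "norm w \<le> R")
    case False
    have "?B w \<le> 1" using R0[of w] R False by simp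
    also have "1 \<le> ennreal (c * 4)" using c by simp
    finally show ?thesis .
  next
    case True
    have "?B w \<le> (\<integral>\<^sup>+z. ennreal c * (\<Sum>u\<in>?U.
        ennreal (norm (fock_kernel \<alpha> (of_real (2 * R) * u) (\<psi> z)) powr q * volterra_density q \<alpha> g z)) \<partial>lborel)"
      unfolding berezin_transform_eq
    proof (rule nn_integral_mono)
      fix z
      have "norm (fock_kernel \<alpha> w (\<psi> z)) powr q * volterra_density q \<alpha> g z
          \<le> c * (\<Sum>u\<in>?U. norm (fock_kernel \<alpha> (of_real (2 * R) * u) (\<psi> z)) powr q) * volterra_density q \<alpha> g z"
        unfolding c_def by (intro mult_right_mono norm_kernel_powr_le_sum q \<alpha> True) simp
      also have "\<dots> = c * (\<Sum>u\<in>?U. norm (fock_kernel \<alpha> (of_real (2 * R) * u) (\<psi> z)) powr q * volterra_density q \<alpha> g z)"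
        by (simp only: sum_distrib_right mult.assoc)
      finally have "ennreal (norm (fock_kernel \<alpha> w (\<psi> z)) powr q * volterra_density q \<alpha> g z)
          \<le> ennreal (c * (\<Sum>u\<in>?U. norm (fock_kernel \<alpha> (of_real (2 * R) * u) (\<psi> z)) powr q * volterra_density q \<alpha> g z))"
        by (rule ennreal_leI)
      also have "\<dots> = ennreal c * (\<Sum>u\<in>?U. ennreal (norm (fock_kernel \<alpha> (of_real (2 * R) * u) (\<psi> z)) powr q * volterra_density q \<alpha> g z))"
        using c by (subst sum_ennreal) (auto simp only: ennreal_mult intro!: ennreal_mult sum_nonneg mult_nonneg_nonneg powr_ge_zero volterra_density_nonneg)
      finally show "ennreal (norm (fock_kernel \<alpha> w (\<psi> z)) powr q * volterra_density q \<alpha> g z) \<le> ennreal c *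
          (\<Sum>u\<in>?U. ennreal (norm (fock_kernel \<alpha> (of_real (2 * R) * u) (\<psi> z)) powr q * volterra_density q \<alpha> g z))" .
    qed
    also have "\<dots> = ennreal c * (\<Sum>u\<in>?U. ?B (of_real (2 * R) * u))"
      unfolding berezin_transform_eq nn_integral_cmult[OF borel_measurable_sum[OF kz]] nn_integral_sum[OF kz] ..
    also have "\<dots> \<le> ennreal c * (\<Sum>u\<in>?U. 1)"
    proof (intro mult_left_mono sum_mono)
      fix u assume "u \<in> ?U"
      then have "norm u = 1" by auto
      then have "R0 \<le> norm (of_real (2 * R) * u)" using R by (simp add: norm_mult)
      from R0[OF this] show "?B (of_real (2 * R) * u) \<le> 1" by simp
    qed simp
    also have "\<dots> = ennreal c * ennreal 4" by (simp only: sum_constant cardU) simp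
    also have "\<dots> = ennreal (c * 4)" using c by (simp add: ennreal_mult)
    finally show ?thesis .
  qed
  then show thesis using that[of "c * 4"] c by auto
qed

text \<open>
  Fatou's lemma.
\<close>

lemma fock_norm_le_liminf:
  assumes p: "0 < p" and F: "\<And>n. F n holomorphic_on UNIV"
    and lim: "\<And>z. (\<lambda>n. F n z) \<longlonglongrightarrow> f z" and M: "\<And>n. fock_norm p \<alpha> (F n) \<le> M"
  shows "fock_norm p \<alpha> f \<le> M"
proof -
  note [measurable] = borel_measurable_entire[OF F]
  let ?c = "ennreal (p * \<alpha> / (2 * pi))"
  have lm: "(\<lambda>n. ennreal (fock_mod \<alpha> (F n) z powr p)) \<longlonglongrightarrow> ennreal (fock_mod \<alpha> f z powr p)" for z
    unfolding fock_mod_def using p by (intro tendsto_ennrealI tendsto_powr' tendsto_mult tendsto_norm lim tendsto_const) auto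
  have "?c * (\<integral>\<^sup>+z. ennreal (fock_mod \<alpha> f z powr p) \<partial>lborel)
      = (\<integral>\<^sup>+z. liminf (\<lambda>n. ?c * ennreal (fock_mod \<alpha> (F n) z powr p)) \<partial>lborel)"
  proof -
    have m: "(\<lambda>z. ennreal (fock_mod \<alpha> f z powr p)) \<in> borel_measurable lborel"
      by (rule borel_measurable_LIMSEQ_order[OF lm]) measurable
    have "liminf (\<lambda>n. ?c * ennreal (fock_mod \<alpha> (F n) z powr p)) = ?c * ennreal (fock_mod \<alpha> f z powr p)" for z
      by (intro lim_imp_Liminf ennreal_tendsto_cmult lm) auto
    then show ?thesis using nn_integral_cmult[OF m] by simp
  qed
  also have "\<dots> \<le> liminf (\<lambda>n. \<integral>\<^sup>+z. ?c * ennreal (fock_mod \<alpha> (F n) z powr p) \<partial>lborel)"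
    by (intro nn_integral_liminf) measurable
  also have "\<dots> \<le> liminf (\<lambda>n::nat. ennreal_powr M p)"
  proof (intro Liminf_mono always_eventually allI)
    fix n
    have "(\<integral>\<^sup>+z. ?c * ennreal (fock_mod \<alpha> (F n) z powr p) \<partial>lborel) = ennreal_powr (fock_norm p \<alpha> (F n)) p"
      unfolding fock_norm_powr[OF p] by (intro nn_integral_cmult) measurable
    also have "\<dots> \<le> ennreal_powr M p" using p by (intro ennreal_powr_mono M) auto
    finally show "(\<integral>\<^sup>+z. ?c * ennreal (fock_mod \<alpha> (F n) z powr p) \<partial>lborel) \<le> ennreal_powr M p" .
  qed
  also have "\<dots> = ennreal_powr M p" by (simp add: Liminf_const)
  finally have "fock_norm p \<alpha> f \<le> ennreal_powr (ennreal_powr M p) (1 / p)"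
    unfolding fock_norm_eq using p by (intro ennreal_powr_mono) auto
  then show ?thesis using p by (simp add: ennreal_powr_powr)
qed

text \<open>
  The pointwise growth bound makes a norm-bounded sequence locally uniformly bounded, so Montel's
  theorem applies.
\<close>

lemma fock_bounded_subsequence:
  assumes p: "0 < p" and \<alpha>: "0 < \<alpha>"
    and F: "\<And>n. F n holomorphic_on UNIV" and M: "\<And>n. fock_norm p \<alpha> (F n) \<le> ennreal M"
  obtains f and r :: "nat \<Rightarrow> nat" where "f holomorphic_on UNIV" "strict_mono r"
    "\<And>z. (\<lambda>n. F (r n) z) \<longlonglongrightarrow> f z"
    "\<And>K. compact K \<Longrightarrow> uniform_limit K (F \<circ> r) f sequentially"
proof -
  obtain C :: real where C: "0 < C"
    "\<And>f z. f holomorphic_on UNIV \<Longrightarrow> ennreal (fock_mod \<alpha> f z) \<le> ennreal C * fock_norm p \<alpha> f"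
    using fock_mod_le_fock_norm[OF p \<alpha>] by blast
  have bd: "fock_mod \<alpha> (F n) z \<le> C * max M 0" for n z
  proof -
    have "ennreal (fock_mod \<alpha> (F n) z) \<le> ennreal C * ennreal (max M 0)"
      by (rule order_trans[OF C(2)[OF F] mult_left_mono[OF order_trans[OF M]]]) (auto intro: ennreal_leI)
    also have "\<dots> = ennreal (C * max M 0)" using C(1) by (simp add: ennreal_mult)
    finally show ?thesis using C(1) by (simp add: ennreal_le_iff)
  qed
  show thesis
  proof (rule Montel[of UNIV "range F" F])
    show "\<And>h. h \<in> range F \<Longrightarrow> h holomorphic_on UNIV" using F by auto
    fix K :: "complex set" assume K: "compact K"
    then obtain r where r: "\<And>z. z \<in> K \<Longrightarrow> norm z \<le> r" using compact_imp_bounded bounded_iff by metis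
    have "norm (F n z) \<le> C * max M 0 * exp (\<alpha> / 2 * r\<^sup>2)" if z: "z \<in> K" for n z
    proof -
      have "norm (F n z) = fock_mod \<alpha> (F n) z * exp (\<alpha> / 2 * (norm z)\<^sup>2)"
        by (simp add: fock_mod_def mult_exp_exp)
      also have "\<dots> \<le> C * max M 0 * exp (\<alpha> / 2 * r\<^sup>2)"
      proof (intro mult_mono bd)
        show "exp (\<alpha> / 2 * (norm z)\<^sup>2) \<le> exp (\<alpha> / 2 * r\<^sup>2)"
          using r[OF z] \<alpha> by (simp add: power_mono)
      qed (use C(1) in auto)
      finally show ?thesis .
    qed
    then show "\<exists>B. \<forall>h\<in>range F. \<forall>z\<in>K. norm (h z) \<le> B" by blast
  qed (use that in auto)
qed

text \<open>
  On a large disc the functions are uniformly small and \<open>B\<close> is bounded; outside it \<open>B\<close> is small and the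
  integrals of the functions are bounded.
\<close>

lemma weighted_integral_tendsto_0:
  assumes q: "0 < q" and \<alpha>: "0 < \<alpha>"
    and G: "\<And>n. G n holomorphic_on UNIV"
    and L: "\<And>n. (\<integral>\<^sup>+z. ennreal (fock_mod \<alpha> (G n) z powr q) \<partial>lborel) \<le> ennreal L" "0 \<le> L"
    and unif: "\<And>K. compact K \<Longrightarrow> uniform_limit K G (\<lambda>_. 0) sequentially"
    and B: "B \<in> borel_measurable borel" "\<And>w. B w \<le> ennreal M" "0 < M" "(B \<longlongrightarrow> 0) at_infinity"
  shows "(\<lambda>n. \<integral>\<^sup>+w. ennreal (fock_mod \<alpha> (G n) w powr q) * B w \<partial>lborel) \<longlonglongrightarrow> 0"
proof (rule ennreal_tendsto_0I)
  fix e :: real assume e: "0 < e"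
  define \<epsilon> where "\<epsilon> = e / (2 * (L + 1))"
  have \<epsilon>: "0 < \<epsilon>" "\<epsilon> * L \<le> e / 2"
    using e L(2) by (auto simp: \<epsilon>_def field_simps)
  have "eventually (\<lambda>w. B w < ennreal \<epsilon>) at_infinity"
    using B(4) \<epsilon>(1) by (intro order_tendstoD) auto
  then obtain R0 where R0: "\<And>w. R0 \<le> norm w \<Longrightarrow> B w < ennreal \<epsilon>"
    unfolding eventually_at_infinity by blast
  define R where "R = max R0 1"
  have R: "0 < R" "R0 \<le> R" by (auto simp: R_def)
  (* If the weighted modulus is at most d on the disc of radius R, the disc contributes at most e / 2. *)
  define d where "d = (e / (2 * (M * (pi * R\<^sup>2)))) powr (1 / q)"
  have MR: "0 < M * (pi * R\<^sup>2)" using B(3) R by simp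
  have base: "0 < e / (2 * (M * (pi * R\<^sup>2)))"
    using e MR by (intro divide_pos_pos) linarith+
  then have d: "0 < d" unfolding d_def powr_gt_zero by linarith
  have dq: "d powr q * M * (pi * R\<^sup>2) = e / 2"
  proof -
    have "d powr q = e / (2 * (M * (pi * R\<^sup>2)))"
    proof -
      have "1 / q * q = 1" using q by simp
      then show ?thesis
        using base by (simp only: d_def powr_powr powr_one_gt_zero_iff less_imp_le)
    qed
    moreover have "e / (2 * x) * x = e / 2" if "0 < x" for x :: real
      using that by simp
    ultimately have "d powr q * (M * (pi * R\<^sup>2)) = e / 2"
      using MR by (simp only:)
    then show ?thesis by (simp only: mult.assoc)
  qed
  have "eventually (\<lambda>n. \<forall>z\<in>cball 0 R. dist (G n z) 0 < d) sequentially"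
    using unif[OF compact_cball] d by (simp add: uniform_limit_iff)
  then show "eventually (\<lambda>n. (\<integral>\<^sup>+w. ennreal (fock_mod \<alpha> (G n) w powr q) * B w \<partial>lborel) \<le> ennreal e) sequentially"
  proof eventually_elim
    case (elim n)
    note [measurable] = borel_measurable_entire[OF G[of n]] B(1)
    have small: "fock_mod \<alpha> (G n) w powr q \<le> d powr q" if "norm w \<le> R" for w
    proof (rule powr_mono2)
      have "fock_mod \<alpha> (G n) w \<le> norm (G n w)"
        unfolding fock_mod_def using \<alpha> by (intro mult_left_le) auto
      also have "\<dots> \<le> d" using elim that by (auto simp: dist_norm less_imp_le)
      finally show "fock_mod \<alpha> (G n) w \<le> d" .
    qed (use q in auto)
    have "(\<integral>\<^sup>+w. ennreal (fock_mod \<alpha> (G n) w powr q) * B w \<partial>lborel)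
        \<le> (\<integral>\<^sup>+w. ennreal (d powr q * M) * indicator (ball 0 R) w + ennreal \<epsilon> * ennreal (fock_mod \<alpha> (G n) w powr q) \<partial>lborel)"
    proof (rule nn_integral_mono)
      fix w :: complex
      show "ennreal (fock_mod \<alpha> (G n) w powr q) * B w
          \<le> ennreal (d powr q * M) * indicator (ball 0 R) w + ennreal \<epsilon> * ennreal (fock_mod \<alpha> (G n) w powr q)"
      proof (cases "norm w < R")
        case True
        have "ennreal (fock_mod \<alpha> (G n) w powr q) * B w \<le> ennreal (d powr q) * ennreal M"
          using True by (intro mult_mono ennreal_leI small B(2)) auto
        also have "\<dots> = ennreal (d powr q * M) * indicator (ball 0 R) w"
          using True B(3) by (simp add: ennreal_mult)
        finally show ?thesis by (simp add: add_increasing2)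
      next
        case False
        have "ennreal (fock_mod \<alpha> (G n) w powr q) * B w \<le> ennreal (fock_mod \<alpha> (G n) w powr q) * ennreal \<epsilon>"
          using R0[of w] R False by (intro mult_left_mono) auto
        then show ?thesis by (simp add: add_increasing mult.commute)
      qed
    qed
    also have "\<dots> = ennreal (d powr q * M) * ennreal (pi * R\<^sup>2)
        + ennreal \<epsilon> * (\<integral>\<^sup>+w. ennreal (fock_mod \<alpha> (G n) w powr q) \<partial>lborel)"
    proof -
      have "(\<integral>\<^sup>+w. ennreal (d powr q * M) * indicator (ball (0::complex) R) w \<partial>lborel) = ennreal (d powr q * M) * ennreal (pi * R\<^sup>2)"
        using R by (simp add: nn_integral_cmult_indicator measure_ball_complex)
      moreover have "(\<integral>\<^sup>+w. ennreal \<epsilon> * ennreal (fock_mod \<alpha> (G n) w powr q) \<partial>lborel)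
          = ennreal \<epsilon> * (\<integral>\<^sup>+w. ennreal (fock_mod \<alpha> (G n) w powr q) \<partial>lborel)"
        by (intro nn_integral_cmult) measurable
      ultimately show ?thesis by (subst nn_integral_add) auto
    qed
    also have "\<dots> \<le> ennreal (d powr q * M) * ennreal (pi * R\<^sup>2) + ennreal \<epsilon> * ennreal L"
      by (intro add_left_mono mult_left_mono L(1)) simp
    also have "\<dots> = ennreal (d powr q * M * (pi * R\<^sup>2) + \<epsilon> * L)"
      using B(3) \<epsilon>(1) L(2) by (simp add: ennreal_plus ennreal_mult)
    also have "\<dots> \<le> ennreal e"
      using dq \<epsilon>(2) by (intro ennreal_leI) linarith
    finally show ?case .
  qed
qed

lemma fock_integral_diff_le:
  assumes q: "0 < q" and f: "f holomorphic_on UNIV" and h: "h holomorphic_on UNIV"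
  shows "(\<integral>\<^sup>+z. ennreal (fock_mod \<alpha> (\<lambda>z. f z - h z) z powr q) \<partial>lborel)
    \<le> ennreal (2 powr q) * ((\<integral>\<^sup>+z. ennreal (fock_mod \<alpha> f z powr q) \<partial>lborel) + (\<integral>\<^sup>+z. ennreal (fock_mod \<alpha> h z powr q) \<partial>lborel))"
proof -
  note [measurable] = borel_measurable_entire[OF f] borel_measurable_entire[OF h]
  have pt: "fock_mod \<alpha> (\<lambda>z. f z - h z) z powr q \<le> 2 powr q * (fock_mod \<alpha> f z powr q + fock_mod \<alpha> h z powr q)" for z
  proof -
    have "fock_mod \<alpha> (\<lambda>z. f z - h z) z \<le> fock_mod \<alpha> f z + fock_mod \<alpha> h z"
      unfolding fock_mod_def distrib_right[symmetric] by (intro mult_right_mono norm_triangle_ineq4) simp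
    then have "fock_mod \<alpha> (\<lambda>z. f z - h z) z powr q \<le> (fock_mod \<alpha> f z + fock_mod \<alpha> h z) powr q"
      using q by (intro powr_mono2) auto
    also have "\<dots> \<le> 2 powr q * (fock_mod \<alpha> f z powr q + fock_mod \<alpha> h z powr q)"
      using q by (intro powr_add_le) auto
    finally show ?thesis .
  qed
  have "(\<integral>\<^sup>+z. ennreal (fock_mod \<alpha> (\<lambda>z. f z - h z) z powr q) \<partial>lborel)
      \<le> (\<integral>\<^sup>+z. ennreal (2 powr q) * (ennreal (fock_mod \<alpha> f z powr q) + ennreal (fock_mod \<alpha> h z powr q)) \<partial>lborel)"
    by (intro nn_integral_mono) (auto intro!: ennreal_leI pt simp flip: ennreal_mult ennreal_plus)
  also have "\<dots> = ennreal (2 powr q) * (\<integral>\<^sup>+z. ennreal (fock_mod \<alpha> f z powr q) + ennreal (fock_mod \<alpha> h z powr q) \<partial>lborel)"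
    by (intro nn_integral_cmult) measurable
  also have "(\<integral>\<^sup>+z. ennreal (fock_mod \<alpha> f z powr q) + ennreal (fock_mod \<alpha> h z powr q) \<partial>lborel)
      = (\<integral>\<^sup>+z. ennreal (fock_mod \<alpha> f z powr q) \<partial>lborel) + (\<integral>\<^sup>+z. ennreal (fock_mod \<alpha> h z powr q) \<partial>lborel)"
    by (intro nn_integral_add) measurable
  finally show ?thesis .
qed

text \<open>
  For a norm-bounded sequence, the images of a locally uniformly convergent subsequence converge to the
  image of its limit \<open>f\<close>: the differences \<open>G n\<close> are bounded and tend to zero locally uniformly, so the
  integral bound for \<open>V (G n)\<close> tends to zero.
\<close>

lemma fock_compact_op_if_berezin_tendsto_0:
  assumes p: "0 < p" and pq: "p \<le> q" and \<alpha>: "0 < \<alpha>"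
    and \<psi>: "\<psi> holomorphic_on UNIV" and g: "g holomorphic_on UNIV"
    and lim: "(berezin_transform q \<alpha> \<psi> g \<longlongrightarrow> 0) at_infinity"
  shows "fock_compact_op p q \<alpha> (volterra_comp g \<psi>)"
proof -
  have q: "0 < q" using p pq by simp
  let ?V = "volterra_comp g \<psi>"
  obtain M :: real where M: "0 < M" "\<And>w. berezin_transform q \<alpha> \<psi> g w \<le> ennreal M"
    using berezin_bounded_if_tendsto_0[OF q \<alpha> \<psi> g lim] by blast
  have "fock_bounded_op p q \<alpha> ?V"
    by (rule volterra_comp_bounded_if_berezin_AE_bounded[OF p pq \<alpha> \<psi> g, of "ennreal M"]) (auto simp: M(2))
  then have maps: "?V f \<in> fock_space q \<alpha>" if "f \<in> fock_space p \<alpha>" for f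
    using that by (simp add: fock_bounded_op_def)
  obtain A :: real where A: "0 < A"
    "\<And>f \<psi> g. f holomorphic_on UNIV \<Longrightarrow> \<psi> holomorphic_on UNIV \<Longrightarrow> g holomorphic_on UNIV \<Longrightarrow>
      fock_norm q \<alpha> (volterra_comp g \<psi> f) \<le> ennreal A *
        ennreal_powr (\<integral>\<^sup>+w. ennreal (fock_mod \<alpha> f w powr q) * berezin_transform q \<alpha> \<psi> g w \<partial>lborel) (1 / q)"
    using volterra_comp_le_berezin_integral[OF q \<alpha>] by blast
  obtain E :: real where E: "0 < E"
    "\<And>f. f holomorphic_on UNIV \<Longrightarrow> fock_norm q \<alpha> f \<le> ennreal E * fock_norm p \<alpha> f"
    using fock_norm_embedding[OF p pq \<alpha>] by blast
  have "\<exists>r h. strict_mono r \<and> h \<in> fock_space q \<alpha> \<and> (\<lambda>n. fock_norm q \<alpha> (\<lambda>z. ?V (F (r n)) z - h z)) \<longlonglongrightarrow> 0"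
    if F: "\<And>n. F n \<in> fock_space p \<alpha>" and N: "\<And>n. fock_norm p \<alpha> (F n) \<le> ennreal N"
    for F :: "nat \<Rightarrow> complex \<Rightarrow> complex" and N :: real
  proof -
    note holF = fock_spaceD(1)[OF F]
    obtain f and r :: "nat \<Rightarrow> nat" where f: "f holomorphic_on UNIV" and r: "strict_mono r"
      and pw: "\<And>z. (\<lambda>n. F (r n) z) \<longlonglongrightarrow> f z"
      and unif: "\<And>K. compact K \<Longrightarrow> uniform_limit K (F \<circ> r) f sequentially"
      using fock_bounded_subsequence[of p \<alpha> F N, OF p \<alpha> holF N] by blast
    have fN: "fock_norm p \<alpha> f \<le> ennreal N"
      by (rule fock_norm_le_liminf[OF p holF pw N])
    then have fp: "f \<in> fock_space p \<alpha>"
      using f order_le_less_trans[OF fN] by (simp add: fock_space_def)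
    define G where "G n z = F (r n) z - f z" for n z
    have G: "G n holomorphic_on UNIV" for n
      unfolding G_def[abs_def] by (intro holomorphic_on_diff holF f)
    define X where "X = ennreal (2 * pi / (q * \<alpha>)) * ennreal_powr (ennreal E * ennreal N) q"
    have X: "(\<integral>\<^sup>+z. ennreal (fock_mod \<alpha> k z powr q) \<partial>lborel) \<le> X"
      if "k holomorphic_on UNIV" "fock_norm p \<alpha> k \<le> ennreal N" for k
      unfolding nn_integral_fock_mod_powr[OF q \<alpha>] X_def
      using q by (intro mult_left_mono ennreal_powr_mono order_trans[OF E(2)[OF that(1)]] that(2)) auto
    have Xfin: "ennreal (2 powr q) * (X + X) < \<infinity>"
    proof -
      have "ennreal_powr (ennreal E * ennreal N) q < \<infinity>"
        unfolding ennreal_powr_less_top_iff by (simp add: ennreal_mult_less_top)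
      then show ?thesis by (simp add: X_def ennreal_mult_less_top)
    qed
    then obtain L where L: "0 \<le> L" "ennreal (2 powr q) * (X + X) = ennreal L"
      by (cases "ennreal (2 powr q) * (X + X)") auto
    have GL: "(\<integral>\<^sup>+z. ennreal (fock_mod \<alpha> (G n) z powr q) \<partial>lborel) \<le> ennreal L" for n
      unfolding G_def[abs_def] L(2)[symmetric]
      by (intro order_trans[OF fock_integral_diff_le[OF q holF f]] mult_left_mono add_mono X holF f fN N) simp
    have Gunif: "uniform_limit K G (\<lambda>_. 0) sequentially" if K: "compact K" for K
      using unif[OF K] by (simp add: uniform_limit_iff G_def dist_norm o_def)
    let ?I = "\<lambda>n. \<integral>\<^sup>+w. ennreal (fock_mod \<alpha> (G n) w powr q) * berezin_transform q \<alpha> \<psi> g w \<partial>lborel"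
    have "?I \<longlonglongrightarrow> 0"
      by (rule weighted_integral_tendsto_0[OF q \<alpha> G GL L(1) Gunif
            borel_measurable_berezin_transform[OF \<psi> g] M(2) M(1) lim])
    then have "(\<lambda>n. ennreal_powr (?I n) (1 / q)) \<longlonglongrightarrow> 0"
      by (rule ennreal_powr_tendsto_0[rotated]) (use q in simp)
    then have "(\<lambda>n. fock_norm q \<alpha> (?V (G n))) \<longlonglongrightarrow> 0"
      by (rule ennreal_tendsto_0_comparison[OF A(2)[OF G \<psi> g]])
    moreover have "?V (G n) = (\<lambda>z. ?V (F (r n)) z - ?V f z)" for n
      unfolding G_def[abs_def] by (rule volterra_comp_diff[OF holF f \<psi> g])
    ultimately show ?thesis using r maps[OF fp] by (intro exI[of _ r] exI[of _ "?V f"]) simp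
  qed
  then show ?thesis unfolding fock_compact_op_def using maps by blast
qed

theorem theorem1:
  fixes p q \<alpha> :: real
  assumes "0 < p" and "p \<le> q" and "0 < \<alpha>"
  shows "(\<forall>\<psi> g. \<psi> holomorphic_on UNIV \<longrightarrow> g holomorphic_on UNIV \<longrightarrow>
            (fock_bounded_op p q \<alpha> (volterra_comp g \<psi>) \<longleftrightarrow>
               in_Linfty lborel (berezin_transform q \<alpha> \<psi> g)))
       \<and> (\<exists>C::real. C > 0 \<and> (\<forall>\<psi> g. \<psi> holomorphic_on UNIV \<longrightarrow> g holomorphic_on UNIV \<longrightarrow>
            fock_op_norm p q \<alpha> (volterra_comp g \<psi>)
              \<le> ennreal C * ennreal_powr (SUP w. berezin_transform q \<alpha> \<psi> g w) (1 / q) \<and>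
            ennreal_powr (SUP w. berezin_transform q \<alpha> \<psi> g w) (1 / q)
              \<le> ennreal C * fock_op_norm p q \<alpha> (volterra_comp g \<psi>)))
       \<and> (\<forall>\<psi> g. \<psi> holomorphic_on UNIV \<longrightarrow> g holomorphic_on UNIV \<longrightarrow>
            (fock_compact_op p q \<alpha> (volterra_comp g \<psi>) \<longleftrightarrow>
               (berezin_transform q \<alpha> \<psi> g \<longlongrightarrow> 0) at_infinity))"
proof (intro conjI allI impI)
  have q: "0 < q" using assms by simp
  fix \<psi> g :: "complex \<Rightarrow> complex"
  assume \<psi>: "\<psi> holomorphic_on UNIV" and g: "g holomorphic_on UNIV"
  show "fock_bounded_op p q \<alpha> (volterra_comp g \<psi>) \<longleftrightarrow> in_Linfty lborel (berezin_transform q \<alpha> \<psi> g)"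
    by (rule volterra_comp_bounded_iff[OF assms \<psi> g])
  show "fock_compact_op p q \<alpha> (volterra_comp g \<psi>) \<longleftrightarrow> (berezin_transform q \<alpha> \<psi> g \<longlongrightarrow> 0) at_infinity"
    using fock_compact_op_imp_berezin_tendsto_0[OF assms(1) q assms(3) \<psi> g]
      fock_compact_op_if_berezin_tendsto_0[OF assms \<psi> g] by blast
next
  show "\<exists>C::real. C > 0 \<and> (\<forall>\<psi> g. \<psi> holomorphic_on UNIV \<longrightarrow> g holomorphic_on UNIV \<longrightarrow>
            fock_op_norm p q \<alpha> (volterra_comp g \<psi>)
              \<le> ennreal C * ennreal_powr (SUP w. berezin_transform q \<alpha> \<psi> g w) (1 / q) \<and>
            ennreal_powr (SUP w. berezin_transform q \<alpha> \<psi> g w) (1 / q)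
              \<le> ennreal C * fock_op_norm p q \<alpha> (volterra_comp g \<psi>))"
    by (rule volterra_comp_op_norm_equivalence[OF assms]) blast
qed

end
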